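(* There exists a partial Boolean function $f$ (formally, a family $f=f_n:\{0,1\}^n\times\{0,1\}^{m(n)}\to\{0,1,\bot\}$, where $\bot$ means "undefined") such that, as $n\to\infty$, $$QMA^{A\to B}(f)=O(\log n)\qquad\text{while}\qquad QCMA^{A\to B,*}(f)=\Omega\!\left(\frac{\sqrt n}{\log n}\right).$$
   Context: A partial Boolean function is a map $f:\{0,1\}^n\times\{0,1\}^m\to\{0,1,\bot\}$, where $\bot$ means "undefined". A 1-input (0-input) is a pair $(x,y)$ with $f(x,y)=1$ (respectively $f(x,y)=0$). There are three players: Merlin, who knows $x$ and $y$; Alice, who knows $x$; and Bob, who knows $y$. One-way MA protocol: Merlin sends a classical message to Alice, who sends a classical message to Bob, who gives the output (accepts or rejects). Alice and Bob share a public coin, which is not seen by Merlin. The protocol is correct for $f$ if for every 1-input there is a message from Merlin such that Bob accepts with probability at least $2/3$, and for every 0-input and every message from Merlin, Bob rejects with probability at least $2/3$. No requirement is made on inputs with $f(x,y)=\bot$. The cost is the length of Merlin's message plus the length of Alice's message. One-way QCMA protocol: defined like a one-way MA protocol (Merlin's message is still classical), except that Alice can send a quantum message to Bob, and Alice and Bob may share entanglement (an arbitrary input-independent entangled state). The cost is the number of bits sent by Merlin plus the number of qubits sent by Alice. $QCMA^{A\to B,*}(f)$ is the minimum cost of a correct protocol of this kind for $f$, with shared entanglement allowed. One-way QMA protocol: defined in the same way, except that Merlin's message may also be quantum (correctness is then required with respect to quantum messages of Merlin). The cost is the number of qubits sent by Merlin plus the number of qubits sent by Alice. $QMA^{A\to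 B}(f)$ is the minimum cost of a correct protocol of this kind for $f$ in the case where no entanglement between Alice and Bob is allowed. *)

theory Defs
  imports
    "HOL-Probability.Probability_Mass_Function"
    "HOL-Library.Landau_Symbols"
    "Jordan_Normal_Form.Schur_Decomposition"
begin

section \<open>Finite-dimensional quantum states, channels and measurements\<close>

definition mat_trace :: "complex mat \<Rightarrow> complex" where
  "mat_trace A = (\<Sum>i<dim_row A. A $$ (i, i))"

definition sum_mats :: "nat \<Rightarrow> complex mat list \<Rightarrow> complex mat" where
  "sum_mats d As = foldr (+) As (0\<^sub>m d d)"

definition kron :: "complex mat \<Rightarrow> complex mat \<Rightarrow> complex mat" where
  "kron A B = mat (dim_row A * dim_row B) (dim_col A * dim_col B)
     (\<lambda>(i, j). A $$ (i div dim_row B, j div dim_col B) * B $$ (i mod dim_row B, j mod dim_col B))"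

text \<open>In the order on the complex numbers, \<open>0 \<le> z\<close> says that \<open>z\<close> is real and nonnegative,
  so a matrix that is positive in the following sense is in particular Hermitian.\<close>

definition positive_op :: "nat \<Rightarrow> complex mat \<Rightarrow> bool" where
  "positive_op d A \<longleftrightarrow> A \<in> carrier_mat d d \<and> (\<forall>v \<in> carrier_vec d. 0 \<le> (A *\<^sub>v v) \<bullet>c v)"

definition density_op :: "nat \<Rightarrow> complex mat \<Rightarrow> bool" where
  "density_op d \<rho> \<longleftrightarrow> positive_op d \<rho> \<and> mat_trace \<rho> = 1"

text \<open>A two-outcome measurement (POVM) \<open>{M, 1 - M}\<close> is given by the element \<open>M\<close> of the
  outcome ``accept''.\<close>

definition effect :: "nat \<Rightarrow> complex mat \<Rightarrow> bool" where
  "effect d M \<longleftrightarrow> positive_op d M \<and> positive_op d (1\<^sub>m d - M)"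

definition accept_prob :: "complex mat \<Rightarrow> complex mat \<Rightarrow> real" where
  "accept_prob M \<rho> = Re (mat_trace (M * \<rho>))"

text \<open>Quantum operations (completely positive trace-preserving maps) from dimension
  \<open>d\<close> to dimension \<open>d'\<close> in operator-sum form: a channel is a list of Kraus operators.\<close>

definition channel :: "nat \<Rightarrow> nat \<Rightarrow> complex mat list \<Rightarrow> bool" where
  "channel d d' Ks \<longleftrightarrow> set Ks \<subseteq> carrier_mat d' d \<and>
     sum_mats d (map (\<lambda>K. mat_adjoint K * K) Ks) = 1\<^sub>m d"

definition apply_channel :: "nat \<Rightarrow> complex mat list \<Rightarrow> complex mat \<Rightarrow> complex mat" where
  "apply_channel d' Ks \<rho> = sum_mats d' (map (\<lambda>K. K * \<rho> * mat_adjoint K) Ks)"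

text \<open>The channel acts on the first tensor factor of a bipartite state, and the second factor, of
  dimension \<open>dB\<close>, is left alone.\<close>

definition apply_channel_left ::
    "nat \<Rightarrow> nat \<Rightarrow> complex mat list \<Rightarrow> complex mat \<Rightarrow> complex mat" where
  "apply_channel_left d' dB Ks \<rho> =
     apply_channel (d' * dB) (map (\<lambda>K. kron K (1\<^sub>m dB)) Ks) \<rho>"


section \<open>Protocols\<close>

definition bits :: "nat \<Rightarrow> bool list set" where
  "bits n = {x. length x = n}"

text \<open>The value \<open>None\<close> stands for ``undefined''; only the values on
  \<open>bits n \<times> bits m\<close> matter.\<close>

type_synonym partial_bf = "bool list \<Rightarrow> bool list \<Rightarrow> bool option"

text \<open>Here \<open>W\<close> is the set of messages that Merlin can send and \<open>acc w x y\<close> is the probability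
  that Bob accepts on input \<open>(x, y)\<close> when Merlin sends \<open>w\<close>.\<close>

definition MA_correct ::
    "nat \<Rightarrow> nat \<Rightarrow> partial_bf \<Rightarrow> 'w set \<Rightarrow> ('w \<Rightarrow> bool list \<Rightarrow> bool list \<Rightarrow> real) \<Rightarrow> bool" where
  "MA_correct n m f W acc \<longleftrightarrow>
     (\<forall>x \<in> bits n. \<forall>y \<in> bits m.
        (f x y = Some True \<longrightarrow> (\<exists>w \<in> W. acc w x y \<ge> 2 / 3)) \<and>
        (f x y = Some False \<longrightarrow> (\<forall>w \<in> W. 1 - acc w x y \<ge> 2 / 3)))"

text \<open>In both models the public coin is a random variable with distribution \<open>coin\<close>. Its
  value \<open>r\<close> is an argument of the actions of Alice and Bob, but Merlin's message does not
  depend on it.\<close>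

text \<open>QMA: Merlin sends \<open>a\<close> qubits to Alice, who applies a channel that depends on \<open>x\<close> and
  sends the resulting \<open>b\<close> qubits to Bob, who applies a measurement that depends on \<open>y\<close>.\<close>

definition QMA_protocol ::
    "nat \<Rightarrow> nat \<Rightarrow> partial_bf \<Rightarrow> nat \<Rightarrow> nat \<Rightarrow> nat pmf \<Rightarrow>
     (nat \<Rightarrow> bool list \<Rightarrow> complex mat list) \<Rightarrow> (nat \<Rightarrow> bool list \<Rightarrow> complex mat) \<Rightarrow> bool" where
  "QMA_protocol n m f a b coin alice bob \<longleftrightarrow>
     (\<forall>r. \<forall>x \<in> bits n. channel (2 ^ a) (2 ^ b) (alice r x)) \<and>
     (\<forall>r. \<forall>y \<in> bits m. effect (2 ^ b) (bob r y)) \<and>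
     MA_correct n m f {\<sigma>. density_op (2 ^ a) \<sigma>}
       (\<lambda>\<sigma> x y. measure_pmf.expectation coin
          (\<lambda>r. accept_prob (bob r y) (apply_channel (2 ^ b) (alice r x) \<sigma>)))"

definition QMA_cost :: "nat \<Rightarrow> nat \<Rightarrow> partial_bf \<Rightarrow> nat" where
  "QMA_cost n m f = (LEAST c. \<exists>a b coin alice bob.
     c = a + b \<and> QMA_protocol n m f a b coin alice bob)"

text \<open>QCMA with shared entanglement: Alice and Bob hold the two parts, of dimensions \<open>dA\<close>
  and \<open>dB\<close>, of a state \<open>\<rho>\<close>. Merlin sends \<open>a\<close> classical bits \<open>w\<close> to Alice, who applies
  to her part a channel that depends on \<open>x\<close> and \<open>w\<close>, and sends the resulting \<open>b\<close> qubits to Bob,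
  who measures them jointly with his part.\<close>

definition QCMA_ent_protocol ::
    "nat \<Rightarrow> nat \<Rightarrow> partial_bf \<Rightarrow> nat \<Rightarrow> nat \<Rightarrow> nat pmf \<Rightarrow> nat \<Rightarrow> nat \<Rightarrow> complex mat \<Rightarrow>
     (nat \<Rightarrow> bool list \<Rightarrow> bool list \<Rightarrow> complex mat list) \<Rightarrow>
     (nat \<Rightarrow> bool list \<Rightarrow> complex mat) \<Rightarrow> bool" where
  "QCMA_ent_protocol n m f a b coin dA dB \<rho> alice bob \<longleftrightarrow>
     density_op (dA * dB) \<rho> \<and>
     (\<forall>r. \<forall>x \<in> bits n. \<forall>w \<in> bits a. channel dA (2 ^ b) (alice r x w)) \<and>
     (\<forall>r. \<forall>y \<in> bits m. effect (2 ^ b * dB) (bob r y)) \<and>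
     MA_correct n m f (bits a)
       (\<lambda>w x y. measure_pmf.expectation coin
          (\<lambda>r. accept_prob (bob r y) (apply_channel_left (2 ^ b) dB (alice r x w) \<rho>)))"

definition QCMA_ent_cost :: "nat \<Rightarrow> nat \<Rightarrow> partial_bf \<Rightarrow> nat" where
  "QCMA_ent_cost n m f = (LEAST c. \<exists>a b coin dA dB \<rho> alice bob.
     c = a + b \<and> QCMA_ent_protocol n m f a b coin dA dB \<rho> alice bob)"


section \<open>The minima are over nonempty sets\<close>

text \<open>Alice may ignore Merlin and the shared state and send \<open>x\<close> as a basis state.\<close>


lemma finite_bits: "finite (bits n)" and card_bits: "card (bits n) = 2 ^ n"
  using finite_lists_length_eq[of "UNIV :: bool set" n] card_lists_length_eq[of "UNIV :: bool set" n]
  by (auto simp: bits_def)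

lemma ex_bits_code:
  obtains c where "bij_betw c (bits n) {..<2 ^ n :: nat}"
  using ex_bij_betw_finite_nat[OF finite_bits[of n]] card_bits[of n]
  by (auto simp: atLeast0LessThan)

definition ket :: "nat \<Rightarrow> nat \<Rightarrow> complex mat" where
  "ket d k = mat d 1 (\<lambda>(i, j). if i = k then 1 else 0)"

definition diag_proj :: "nat \<Rightarrow> (nat \<Rightarrow> bool) \<Rightarrow> complex mat" where
  "diag_proj d P = mat d d (\<lambda>(i, j). if i = j \<and> P i then 1 else 0)"

lemma adj_ket: "mat_adjoint (ket d k) = mat 1 d (\<lambda>(i, j). if j = k then 1 else 0)"
  by (rule eq_matI) (auto simp: mat_adjoint_def ket_def mat_of_rows_def cols_def)

lemma channel_ket: assumes "k < d" shows "channel 1 d [ket d k]"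
proof -
  have "mat_adjoint (ket d k) * ket d k = 1\<^sub>m 1"
    unfolding adj_ket using assms
    by (intro eq_matI) (auto simp: ket_def scalar_prod_def if_distrib cong: if_cong)
  then show ?thesis by (auto simp: channel_def sum_mats_def ket_def)
qed

lemma positive_diag_proj: "positive_op d (diag_proj d P)"
proof -
  have "0 \<le> (diag_proj d P *\<^sub>v v) \<bullet>c v" if v: "v \<in> carrier_vec d" for v
  proof -
    have r: "vec_index (diag_proj d P *\<^sub>v v) i = (if P i then vec_index v i else 0)" if "i < d" for i
    proof -
      have "vec_index (diag_proj d P *\<^sub>v v) i = (\<Sum>j\<in>{0..<d}. (if i = j \<and> P i then 1 else 0) * vec_index v j)"
        using that v by (auto simp: diag_proj_def scalar_prod_def intro!: sum.cong)
      also have "\<dots> = (\<Sum>j\<in>{0..<d}. if j = i then (if P i then vec_index v i else 0) else 0)"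
        by (rule sum.cong) auto
      finally show ?thesis using that by simp
    qed
    have "(diag_proj d P *\<^sub>v v) \<bullet>c v = (\<Sum>i\<in>{0..<d}. (if P i then vec_index v i else 0) * cnj (vec_index v i))"
      using v r by (auto simp: scalar_prod_def intro!: sum.cong)
    also have "\<dots> \<ge> 0"
      by (rule sum_nonneg) (auto simp: less_eq_complex_def)
    finally show ?thesis .
  qed
  then show ?thesis by (auto simp: positive_op_def diag_proj_def)
qed

lemma effect_diag_proj: "effect d (diag_proj d P)"
proof -
  have "1\<^sub>m d - diag_proj d P = diag_proj d (\<lambda>i. \<not> P i)"
    by (rule eq_matI) (auto simp: diag_proj_def)
  then show ?thesis by (simp add: effect_def positive_diag_proj)
qed

lemma accept_ket:
  assumes "k < d"
  shows "accept_prob (diag_proj d P) (apply_channel d [ket d k] (1\<^sub>m 1)) = (if P k then 1 else 0)"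
proof -
  have c: "ket d k \<in> carrier_mat d 1"
    by (simp add: ket_def)
  have "ket d k * 1\<^sub>m 1 * mat_adjoint (ket d k) =
      mat d d (\<lambda>(i, j). if i = k \<and> j = k then 1 else 0)"
    unfolding right_mult_one_mat[OF c] adj_ket
    by (intro eq_matI) (auto simp: ket_def scalar_prod_def)
  then have "apply_channel d [ket d k] (1\<^sub>m 1) = mat d d (\<lambda>(i, j). if i = k \<and> j = k then 1 else 0)"
    by (simp add: apply_channel_def sum_mats_def)
  moreover have "mat_trace (diag_proj d P * mat d d (\<lambda>(i, j). if i = k \<and> j = k then 1 else 0)) =
      (\<Sum>i<d. if i = k then (if P k then 1 else 0) else 0)"
    unfolding mat_trace_def
  proof (rule sum.cong)
    fix i assume "i \<in> {..<d}"
    then have "(diag_proj d P * mat d d (\<lambda>(i, j). if i = k \<and> j = k then 1 else 0)) $$ (i, i) =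
       (\<Sum>j\<in>{0..<d}. (if i = j \<and> P i then 1 else 0) * (if j = k \<and> i = k then 1 else 0))"
      by (auto simp: diag_proj_def scalar_prod_def intro!: sum.cong)
    also have "\<dots> = (\<Sum>j\<in>{0..<d}. if j = i then if i = k \<and> P i then 1 else 0 else 0)"
      by (rule sum.cong) auto
    finally show "(diag_proj d P * mat d d (\<lambda>(i, j). if i = k \<and> j = k then 1 else 0)) $$ (i, i) =
       (if i = k then (if P k then 1 else 0) else 0)" using \<open>i \<in> {..<d}\<close> by (simp split: if_splits)
  qed (simp add: diag_proj_def)
  ultimately show ?thesis using assms by (simp add: accept_prob_def)
qed

lemma density_op_1: "density_op 1 \<sigma> \<longleftrightarrow> \<sigma> = 1\<^sub>m 1"
proof
  assume "density_op 1 \<sigma>"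
  then show "\<sigma> = 1\<^sub>m 1"
    by (intro eq_matI) (auto simp: density_op_def positive_op_def mat_trace_def)
next
  assume "\<sigma> = 1\<^sub>m 1"
  moreover have "mat_trace (1\<^sub>m 1) = 1" by (simp add: mat_trace_def)
  moreover have "1\<^sub>m 1 = diag_proj 1 (\<lambda>_. True)" by (rule eq_matI) (auto simp: diag_proj_def)
  ultimately show "density_op 1 \<sigma>"
    using positive_diag_proj[of 1 "\<lambda>_. True"] by (metis density_op_def)
qed

lemma kron_one: "kron A (1\<^sub>m 1) = A"
  by (rule eq_matI) (auto simp: kron_def)

lemma trivial_protocols:
  obtains alice bob where
    "QMA_protocol n m f 0 n (return_pmf 0) alice bob"
    "QCMA_ent_protocol n m f 0 n (return_pmf 0) 1 1 (1\<^sub>m 1) (\<lambda>r x w. alice r x) bob"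
proof -
  obtain c :: "bool list \<Rightarrow> nat" where c: "bij_betw c (bits n) {..<2 ^ n}" by (rule ex_bits_code)
  define alice :: "nat \<Rightarrow> bool list \<Rightarrow> complex mat list" where
    "alice = (\<lambda>r x. [ket (2 ^ n) (c x)])"
  define bob :: "nat \<Rightarrow> bool list \<Rightarrow> complex mat" where
    "bob = (\<lambda>r y. diag_proj (2 ^ n) (\<lambda>k. f (inv_into (bits n) c k) y = Some True))"
  have lt: "c x < 2 ^ n" if "x \<in> bits n" for x
    using c that by (auto simp: bij_betw_def)
  have inv: "inv_into (bits n) c (c x) = x" if "x \<in> bits n" for x
    using c that by (auto simp: bij_betw_def)
  have acc: "accept_prob (bob r y) (apply_channel (2 ^ n) (alice r x) (1\<^sub>m 1)) =
      (if f x y = Some True then 1 else 0)" if "x \<in> bits n" for r x y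
    unfolding bob_def alice_def using accept_ket[OF lt[OF that]] inv[OF that] by auto
  have ch: "channel 1 (2 ^ n) (alice r x)" if "x \<in> bits n" for r x
    unfolding alice_def by (rule channel_ket[OF lt[OF that]])
  have ef: "effect (2 ^ n) (bob r y)" for r y
    unfolding bob_def by (rule effect_diag_proj)
  have left: "apply_channel_left d 1 Ks \<rho> = apply_channel d Ks \<rho>" for d Ks \<rho>
    by (simp add: apply_channel_left_def kron_one[unfolded One_nat_def])
  have d1: "Collect (density_op (Suc 0)) = {1\<^sub>m 1}"
    using density_op_1[unfolded One_nat_def] by auto
  have "QMA_protocol n m f 0 n (return_pmf 0) alice bob"
    using ch ef acc d1 by (auto simp: QMA_protocol_def MA_correct_def)
  moreover have "QCMA_ent_protocol n m f 0 n (return_pmf 0) 1 1 (1\<^sub>m 1) (\<lambda>r x w. alice r x) bob"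
    using ch ef acc left density_op_1
    by (auto simp: QCMA_ent_protocol_def MA_correct_def bits_def)
  ultimately show ?thesis by (rule that)
qed

lemma ex_QMA_protocol:
  "\<exists>a b coin alice bob. QMA_protocol n m f a b coin alice bob"
  by (rule trivial_protocols[of n m f]) blast

lemma ex_QCMA_ent_protocol:
  "\<exists>a b coin dA dB \<rho> alice bob. QCMA_ent_protocol n m f a b coin dA dB \<rho> alice bob"
  by (rule trivial_protocols[of n m f]) blast

end

(* Bob's query y picks one cell in every row of a table x over an alphabet of size 256 and claims the
   symbols found there; the value is 1 if all claims are true and 0 if at most a third of them are.
   A quantum Merlin sends the uniform superposition of the picked cells, Alice appends the symbols of
   x, and Bob projects onto the superposition that he expects; on a 0-input no message of Merlin is
   accepted with a probability above the fraction of true claims.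

   For a classical Merlin fix a message that is good for a 2^-a fraction of the tables and, for each of
   them, of the cell choices. If a is small, these tables contain a complete binary tree of queries of
   depth linear in the number N of rows (up to a constant), at each node of which the tables on one side
   are accepted and those on the other side rejected. Bob can walk down the branch of the true table x
   by measuring O(log N) copies of Alice's message (threshold measurements disturb the state only
   slightly). Alice's message of b qubits, together with Bob's half of the entangled state, is dominated
   by 4^b times a state that does not depend on x, and under this state the probabilities of the 2^d
   branches add up to at most 1. Hence d = O(b log N). *)
theory Submission
  imports Defs "HOL-Real_Asymp.Real_Asymp"
begin

section \<open>Positive kernels\<close>

text \<open>The square root comes from the shape of the table. Up to \<open>N\<close> rounds of
  queries may use up \<open>N\<close> cells in every row, and rows of \<open>256 * N\<close> cells
  keep a random column choice away from them. So \<open>12288 * N^2\<close> bits of \<open>x\<close>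
  serve a tree of depth about \<open>N / 2\<close>. The logarithm comes from the walk:
  \<open>d\<close> successive measurements stay gentle only if each of them errs with probability of
  order \<open>1 / d^2\<close>. This takes of order \<open>log d\<close> copies, and every copy
  multiplies the domination factor by \<open>4^b\<close>. The queries have to be adaptive: the fixed
  message is known to be good only for a \<open>2^-a\<close> fraction of the column choices of a
  table, and these differ from table to table. Rejection is easier to force: claims copied from a
  table that agrees with \<open>x\<close> in at most a third of the picked cells are a 0-input for
  \<open>x\<close>, whatever Merlin sends. Merlin's message is fixed by pigeonhole. The coin cannot
  be fixed, because every input is guaranteed a good average over the coin only; it becomes a part
  of the shared state.\<close>

definition quad_form :: "'a set \<Rightarrow> ('a \<Rightarrow> 'a \<Rightarrow> complex) \<Rightarrow> ('a \<Rightarrow> complex) \<Rightarrow> complex" where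
  "quad_form S A v = (\<Sum>i\<in>S. \<Sum>j\<in>S. cnj (v i) * A i j * v j)"

lemma quad_insert:
  assumes "finite S" "p \<notin> S"
  shows "quad_form (insert p S) A v = cnj (v p) * A p p * v p + cnj (v p) * (\<Sum>j\<in>S. A p j * v j)
    + (\<Sum>i\<in>S. cnj (v i) * A i p) * v p + quad_form S A v"
proof -
  have "quad_form (insert p S) A v = cnj (v p) * A p p * v p + (\<Sum>j\<in>S. cnj (v p) * A p j * v j)
    + (\<Sum>i\<in>S. cnj (v i) * A i p * v p + (\<Sum>j\<in>S. cnj (v i) * A i j * v j))"
    using assms by (simp add: quad_form_def)
  then show ?thesis
    by (simp add: quad_form_def sum.distrib sum_distrib_left sum_distrib_right mult.assoc)
qed

lemma quad_cong:
  "(\<And>i j. i \<in> S \<Longrightarrow> j \<in> S \<Longrightarrow> A i j = B i j) \<Longrightarrow> (\<And>i. i \<in> S \<Longrightarrow> v i = w i) \<Longrightarrow> quad_form S A v = quad_form S B w"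
  unfolding quad_form_def by (intro sum.cong) auto

lemma quad_zero_off:
  assumes "finite S" "T \<subseteq> S" "\<And>i. i \<in> S - T \<Longrightarrow> v i = 0"
  shows "quad_form S A v = quad_form T A v"
proof -
  have "quad_form S A v = (\<Sum>i\<in>T. \<Sum>j\<in>S. cnj (v i) * A i j * v j)"
    unfolding quad_form_def using assms by (intro sum.mono_neutral_right) auto
  also have "\<dots> = quad_form T A v"
    unfolding quad_form_def using assms by (intro sum.cong refl sum.mono_neutral_right) auto
  finally show ?thesis .
qed

text \<open>A complex number is at least 0 only if it is real, so positivity for all
  \<open>v\<close> makes the kernel Hermitian. The index set is an arbitrary one: tensor powers and
  a classical register then become lists and pairs, without index arithmetic.\<close>

definition psd :: "'a set \<Rightarrow> ('a \<Rightarrow> 'a \<Rightarrow> complex) \<Rightarrow> bool" where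
  "psd S A \<longleftrightarrow> (\<forall>v. 0 \<le> quad_form S A v)"

lemma psd_subset: "finite S \<Longrightarrow> T \<subseteq> S \<Longrightarrow> psd S A \<Longrightarrow> psd T A"
proof -
  assume a: "finite S" "T \<subseteq> S" "psd S A"
  have "0 \<le> quad_form T A v" for v
  proof -
    have "quad_form S A (\<lambda>i. if i \<in> T then v i else 0) = quad_form T A v"
      using quad_zero_off[OF a(1,2), of "\<lambda>i. if i \<in> T then v i else 0" A]
      by (simp cong: quad_cong)
    then show ?thesis using a(3) by (metis psd_def)
  qed
  then show ?thesis by (simp add: psd_def)
qed

lemma psd_diag: assumes "finite S" "i \<in> S" "psd S A" shows "0 \<le> A i i"
proof -
  have "psd {i} A" using psd_subset assms by blast
  then have "0 \<le> quad_form {i} A (\<lambda>_. 1)" by (simp add: psd_def)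
  then show ?thesis by (simp add: quad_form_def)
qed

text \<open>Polarization on the 2 by 2 block: the vector (1, 1) makes the imaginary parts of the two
  off-diagonal entries cancel, and (1, \<i>) makes their real parts equal.\<close>

lemma psd_hermitian:
  assumes "finite S" "i \<in> S" "j \<in> S" "psd S A"
  shows "A j i = cnj (A i j)"
proof (cases "i = j")
  case True
  then show ?thesis using psd_diag[of S i A] assms by (auto simp: complex_eq_iff less_eq_complex_def)
next
  case False
  have p: "psd {i,j} A" using psd_subset[of S "{i,j}" A] assms by blast
  have d: "0 \<le> A i i" "0 \<le> A j j" using psd_diag[OF assms(1) _ assms(4)] assms(2,3) by auto
  have q: "quad_form {i,j} A v = cnj (v i) * A i i * v i + cnj (v i) * A i j * v j
      + cnj (v j) * A j i * v i + cnj (v j) * A j j * v j" for v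
    using False by (simp add: quad_form_def algebra_simps)
  have "0 \<le> quad_form {i,j} A (\<lambda>_. 1)" "0 \<le> quad_form {i,j} A (\<lambda>k. if k = i then 1 else \<i>)"
    using p by (auto simp: psd_def)
  then show ?thesis
    using False d by (auto simp: q complex_eq_iff less_eq_complex_def)
qed

text \<open>Cholesky decomposition: one row is eliminated at a time by a Schur complement.\<close>

lemma psd_gram:
  assumes "finite S" "psd S A"
  shows "\<exists>vs. \<forall>i\<in>S. \<forall>j\<in>S. A i j = (\<Sum>v\<leftarrow>vs. v i * cnj (v j))"
  using assms
proof (induction S arbitrary: A rule: finite_induct)
  case empty
  then show ?case by simp
next
  case (insert p S)
  define c where "c = Re (A p p)"
  have App: "A p p = of_real c" and c0: "c \<ge> 0"
    using psd_diag[of "insert p S" p A] insert by (auto simp: c_def less_eq_complex_def complex_eq_iff)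
  have herm: "A j i = cnj (A i j)" if "i \<in> insert p S" "j \<in> insert p S" for i j
    by (rule psd_hermitian[of "insert p S"]) (use insert that in auto)
  have zero: "A p i = 0" if "c = 0" "i \<in> S" for i
  proof (rule ccontr)
    assume nz: "A p i \<noteq> 0"
    have ne: "p \<noteq> i" using that insert by auto
    have ps: "psd {p,i} A" using psd_subset[of "insert p S" "{p,i}" A] insert that by auto
    \<comment> \<open>With \<open>A p p = 0\<close> the form at \<open>v\<close> is
      \<open>A i i - 2 * s * |A p i|^2\<close>. This \<open>s\<close> makes it
      \<open>- A i i - 2\<close>, which is negative, so a zero pivot has a zero row.\<close>
    define s where "s = (Re (A i i) + 1) / (cmod (A p i))\<^sup>2"
    define v where "v = (\<lambda>k. if k = p then - of_real s * A p i else 1)"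
    have "quad_form {p,i} A v = cnj (v p) * A p p * v p + cnj (v p) * A p i * v i
      + cnj (v i) * A i p * v p + cnj (v i) * A i i * v i"
      using ne by (simp add: quad_form_def algebra_simps)
    also have "\<dots> = A i i - 2 * of_real s * (A p i * cnj (A p i))"
      using ne that App herm[of p i] by (simp add: v_def algebra_simps)
    also have "\<dots> = A i i - of_real (2 * s * (cmod (A p i))\<^sup>2)"
      by (simp add: complex_norm_square[symmetric] mult.assoc)
    finally have "0 \<le> A i i - of_real (2 * s * (cmod (A p i))\<^sup>2)"
      using ps by (metis psd_def)
    then have "0 \<le> Re (A i i) - 2 * s * (cmod (A p i))\<^sup>2"
      by (simp add: less_eq_complex_def)
    moreover have "s * (cmod (A p i))\<^sup>2 = Re (A i i) + 1" using nz by (simp add: s_def)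
    moreover have "0 \<le> Re (A i i)"
      using psd_diag[of "insert p S" i A] insert that by (auto simp: less_eq_complex_def)
    ultimately show False by (simp add: mult.assoc)
  qed
  define A' where "A' = (\<lambda>i j. A i j - A i p * A p j / of_real c)"
  have "0 \<le> quad_form S A' v" for v
  proof -
    define b where "b = (\<Sum>j\<in>S. A p j * v j)"
    \<comment> \<open>For \<open>c > 0\<close> the new coordinate is the one that minimises the form
      of \<open>A\<close>, and the minimum is the form of the Schur complement \<open>A'\<close> at
      \<open>v\<close>. If \<open>c = 0\<close>, division by zero yields 0, so
      \<open>w p = 0\<close> and \<open>A' = A\<close>.\<close>
    define w where "w = (\<lambda>i. if i = p then - b / of_real c else v i)"
    have cb: "(\<Sum>i\<in>S. cnj (v i) * A i p) = cnj b"
      unfolding b_def cnj_sum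
    proof (rule sum.cong)
      fix i assume "i \<in> S"
      then show "cnj (v i) * A i p = cnj (A p i * v i)" using herm[of p i] by simp
    qed simp
    have wv: "w i = v i" if "i \<in> S" for i using insert(2) that by (auto simp: w_def)
    have bw: "(\<Sum>j\<in>S. A p j * w j) = b" and bw': "(\<Sum>i\<in>S. cnj (w i) * A i p) = cnj b"
      and qw: "quad_form S A w = quad_form S A v"
      unfolding cb[symmetric] using wv by (auto simp: b_def intro!: sum.cong quad_cong)
    have "quad_form (insert p S) A w = cnj (w p) * A p p * w p + cnj (w p) * b + cnj b * w p + quad_form S A v"
      using quad_insert[OF insert(1,2), of A w] bw bw' qw by simp
    also have "cnj (w p) * A p p * w p + cnj (w p) * b + cnj b * w p = - (cnj b * b / of_real c)"
      using c0 by (cases "c = 0") (auto simp: w_def App field_simps)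
    also have "- (cnj b * b / of_real c) + quad_form S A v = quad_form S A' v"
    proof -
      have "cnj b * b = (\<Sum>i\<in>S. \<Sum>j\<in>S. cnj (v i) * (A i p * A p j) * v j)"
        unfolding cb[symmetric] unfolding b_def sum_product by (simp add: mult_ac)
      then show ?thesis
        by (simp add: quad_form_def A'_def sum_subtractf[symmetric] sum_divide_distrib algebra_simps)
    qed
    finally show ?thesis using insert.prems by (metis psd_def)
  qed
  then obtain vs where vs: "\<And>i j. i \<in> S \<Longrightarrow> j \<in> S \<Longrightarrow> A' i j = (\<Sum>v\<leftarrow>vs. v i * cnj (v j))"
    using insert.IH[of A'] unfolding psd_def by blast
  define v0 where "v0 = (\<lambda>i. A i p / of_real (sqrt c))"
  have sq: "of_real (sqrt c) * of_real (sqrt c) = (of_real c :: complex)"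
    using c0 by (simp flip: of_real_mult)
  have v0: "v0 i * cnj (v0 j) = A i p * A p j / of_real c" if "i \<in> insert p S" "j \<in> insert p S" for i j
    using herm[OF that(2), of p] sq by (simp add: v0_def)
  \<comment> \<open>The induction hypothesis says nothing about the vectors of \<open>vs\<close> at
    \<open>p\<close>. They are set to 0 there, so that \<open>v0\<close> alone produces row and
    column \<open>p\<close>.\<close>
  have "A i j = (\<Sum>v\<leftarrow>v0 # map (\<lambda>v. v(p := 0)) vs. v i * cnj (v j))"
    if "i \<in> insert p S" "j \<in> insert p S" for i j
  proof (cases "i = p \<or> j = p")
    case True
    then have "(\<Sum>v\<leftarrow>map (\<lambda>v. v(p := 0)) vs. v i * cnj (v j)) = 0"
      by (auto simp: o_def)
    moreover have "A i p * A p j / of_real c = A i j"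
    proof (cases "c = 0")
      case True
      have row: "A p k = 0" if "k \<in> insert p S" for k
        using zero[OF True, of k] App True that by auto
      have "A k p = 0" if "k \<in> insert p S" for k
        using row[OF that] herm[OF _ that, of p] by simp
      with row show ?thesis using \<open>i = p \<or> j = p\<close> that True by auto
    next
      case False
      then show ?thesis using \<open>i = p \<or> j = p\<close> by (auto simp: App)
    qed
    ultimately show ?thesis using v0[OF that] by simp
  next
    case False
    then have "(\<Sum>v\<leftarrow>map (\<lambda>v. v(p := 0)) vs. v i * cnj (v j)) = A' i j"
      using vs[of i j] that by (simp add: o_def)
    then show ?thesis using v0[OF that] by (simp add: A'_def)
  qed
  then show ?case by blast
qed

section \<open>Inner products and effects on a finite index set\<close>

definition inner_sum :: "'a set \<Rightarrow> ('a \<Rightarrow> complex) \<Rightarrow> ('a \<Rightarrow> complex) \<Rightarrow> complex" where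
  "inner_sum L u v = (\<Sum>l\<in>L. cnj (u l) * v l)"

definition apply_kernel :: "'a set \<Rightarrow> ('b \<Rightarrow> 'a \<Rightarrow> complex) \<Rightarrow> ('a \<Rightarrow> complex) \<Rightarrow> 'b \<Rightarrow> complex" where
  "apply_kernel L A v = (\<lambda>l. \<Sum>m\<in>L. A l m * v m)"

definition norm2 :: "'a set \<Rightarrow> ('a \<Rightarrow> complex) \<Rightarrow> real" where
  "norm2 L u = (\<Sum>l\<in>L. (cmod (u l))\<^sup>2)"

definition id_kernel :: "'a \<Rightarrow> 'a \<Rightarrow> complex" where
  "id_kernel i j = (if i = j then 1 else 0)"

definition compose_kernel :: "'a set \<Rightarrow> ('b \<Rightarrow> 'a \<Rightarrow> complex) \<Rightarrow> ('a \<Rightarrow> 'c \<Rightarrow> complex) \<Rightarrow> 'b \<Rightarrow> 'c \<Rightarrow> complex" where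
  "compose_kernel L A B = (\<lambda>i k. \<Sum>j\<in>L. A i j * B j k)"

definition effect_kernel :: "'a set \<Rightarrow> ('a \<Rightarrow> 'a \<Rightarrow> complex) \<Rightarrow> bool" where
  "effect_kernel L Q \<longleftrightarrow> psd L Q \<and> psd L (\<lambda>i j. id_kernel i j - Q i j)"

lemma quad_ip: "quad_form L A v = inner_sum L v (apply_kernel L A v)"
  by (simp add: quad_form_def inner_sum_def apply_kernel_def sum_distrib_left mult.assoc)

lemma ip_cong: "(\<And>l. l \<in> L \<Longrightarrow> u l = u' l) \<Longrightarrow> (\<And>l. l \<in> L \<Longrightarrow> v l = v' l) \<Longrightarrow> inner_sum L u v = inner_sum L u' v'"
  by (simp add: inner_sum_def)

lemma norm2_cong: "(\<And>l. l \<in> L \<Longrightarrow> u l = v l) \<Longrightarrow> norm2 L u = norm2 L v"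
  by (simp add: norm2_def)

lemma norm2_nonneg: "norm2 L u \<ge> 0"
  by (simp add: norm2_def sum_nonneg)

lemma Re_ip_self: "Re (inner_sum L u u) = norm2 L u"
  unfolding inner_sum_def norm2_def Re_sum by (intro sum.cong refl) (simp add: cmod_power2, simp add: power2_eq_square)

lemma ip_diff_left: "inner_sum L (\<lambda>l. u l - v l) w = inner_sum L u w - inner_sum L v w"
  and ip_diff_right: "inner_sum L w (\<lambda>l. u l - v l) = inner_sum L w u - inner_sum L w v"
  by (simp_all add: inner_sum_def sum_subtractf algebra_simps)

lemma app_diff_vec: "apply_kernel L A (\<lambda>l. u l - v l) = (\<lambda>l. apply_kernel L A u l - apply_kernel L A v l)"
  and app_diff_kernel: "apply_kernel L (\<lambda>i j. A i j - B i j) u = (\<lambda>l. apply_kernel L A u l - apply_kernel L B u l)"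
  by (simp_all add: apply_kernel_def sum_subtractf algebra_simps)

lemma app_idk: "finite L \<Longrightarrow> l \<in> L \<Longrightarrow> apply_kernel L id_kernel u l = u l"
  by (simp add: apply_kernel_def id_kernel_def if_distrib[where f = "\<lambda>x. x * _"] cong: if_cong)

lemma app_comp_kernel: "apply_kernel M (compose_kernel L A B) u = apply_kernel L A (apply_kernel M B u)"
proof
  fix i
  have "apply_kernel M (compose_kernel L A B) u i = (\<Sum>k\<in>M. \<Sum>j\<in>L. A i j * B j k * u k)"
    by (simp add: apply_kernel_def compose_kernel_def sum_distrib_right)
  also have "\<dots> = (\<Sum>j\<in>L. \<Sum>k\<in>M. A i j * B j k * u k)"
    by (rule sum.swap)
  also have "\<dots> = apply_kernel L A (apply_kernel M B u) i"
    by (simp add: apply_kernel_def sum_distrib_left mult.assoc)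
  finally show "apply_kernel M (compose_kernel L A B) u i = apply_kernel L A (apply_kernel M B u) i" .
qed

lemma ip_app_selfadjoint:
  assumes "finite L" "psd L Q"
  shows "inner_sum L u (apply_kernel L Q v) = inner_sum L (apply_kernel L Q u) v"
proof -
  have "inner_sum L u (apply_kernel L Q v) = (\<Sum>l\<in>L. \<Sum>m\<in>L. cnj (u l) * Q l m * v m)"
    by (simp add: inner_sum_def apply_kernel_def sum_distrib_left mult.assoc)
  also have "\<dots> = (\<Sum>m\<in>L. \<Sum>l\<in>L. cnj (u l) * Q l m * v m)"
    by (rule sum.swap)
  also have "\<dots> = (\<Sum>m\<in>L. \<Sum>l\<in>L. cnj (Q m l * u l) * v m)"
  proof (intro sum.cong refl)
    fix m l assume "m \<in> L" "l \<in> L"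
    then have "Q l m = cnj (Q m l)" by (intro psd_hermitian[OF assms(1) _ _ assms(2)])
    then show "cnj (u l) * Q l m * v m = cnj (Q m l * u l) * v m" by simp
  qed
  also have "\<dots> = inner_sum L (apply_kernel L Q u) v"
    by (simp add: inner_sum_def apply_kernel_def sum_distrib_right)
  finally show ?thesis .
qed

text \<open>A weighted arithmetic-geometric mean bound in place of Cauchy-Schwarz: it is linear in
  the squared norms, so it can be summed over all Gram vectors of a mixed state with one common
  \<eta>.\<close>

lemma young_ip:
  assumes "\<eta> > (0::real)"
  shows "Re (inner_sum L u v) \<le> (norm2 L u / \<eta> + \<eta> * norm2 L v) / 2"
proof -
  have pt: "Re (cnj a * b) \<le> ((cmod a)\<^sup>2 / \<eta> + \<eta> * (cmod b)\<^sup>2) / 2" for a b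
  proof -
    have "Re (cnj a * b) \<le> cmod a * cmod b"
      by (metis complex_Re_le_cmod complex_mod_cnj norm_mult)
    moreover have "0 \<le> (cmod a - \<eta> * cmod b)\<^sup>2 / \<eta>" using assms by simp
    then have "2 * (cmod a * cmod b) \<le> (cmod a)\<^sup>2 / \<eta> + \<eta> * (cmod b)\<^sup>2"
      using assms by (simp add: power2_diff power_mult_distrib field_simps power2_eq_square)
    ultimately show ?thesis by simp
  qed
  have "Re (inner_sum L u v) \<le> (\<Sum>l\<in>L. ((cmod (u l))\<^sup>2 / \<eta> + \<eta> * (cmod (v l))\<^sup>2) / 2)"
    unfolding inner_sum_def Re_sum by (intro sum_mono pt)
  also have "\<dots> = (norm2 L u / \<eta> + \<eta> * norm2 L v) / 2"
    by (simp add: norm2_def sum.distrib sum_distrib_left sum_divide_distrib add_divide_distrib)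
  finally show ?thesis .
qed

context
  fixes L :: "'a set" and Q :: "'a \<Rightarrow> 'a \<Rightarrow> complex"
  assumes fin: "finite L" and effect_kernel: "effect_kernel L Q"
begin

private lemma sa: "inner_sum L u (apply_kernel L Q v) = inner_sum L (apply_kernel L Q u) v"
  using ip_app_selfadjoint fin effect_kernel by (auto simp: effect_kernel_def)

private lemma quadC: "quad_form L (\<lambda>i j. id_kernel i j - Q i j) u = inner_sum L u u - quad_form L Q u"
proof -
  have "inner_sum L u (apply_kernel L id_kernel u) = inner_sum L u u" by (rule ip_cong) (simp_all add: app_idk fin)
  then show ?thesis by (simp add: quad_ip app_diff_kernel ip_diff_right)
qed

lemma eff_quad_bounds: "0 \<le> Re (quad_form L Q u)" "Re (quad_form L Q u) \<le> norm2 L u"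
proof -
  have "0 \<le> quad_form L Q u" "0 \<le> quad_form L (\<lambda>i j. id_kernel i j - Q i j) u"
    using effect_kernel by (auto simp: effect_kernel_def psd_def)
  then show "0 \<le> Re (quad_form L Q u)" "Re (quad_form L Q u) \<le> norm2 L u"
    by (auto simp: quadC less_eq_complex_def simp flip: Re_ip_self)
qed

text \<open>This is \<open>Q^2 \<le> Q\<close>, from
  \<open>Q - Q^2 = (1 - Q) Q (1 - Q) + Q (1 - Q) Q\<close>, where both summands are
  positive.\<close>

lemma eff_square: "norm2 L (apply_kernel L Q u) \<le> Re (quad_form L Q u)"
proof -
  let ?w = "\<lambda>l. u l - apply_kernel L Q u l"
  have "0 \<le> Re (quad_form L Q ?w)" by (rule eff_quad_bounds)
  moreover have "Re (quad_form L Q (apply_kernel L Q u)) \<le> norm2 L (apply_kernel L Q u)" by (rule eff_quad_bounds)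
  moreover have "quad_form L Q ?w = quad_form L Q u - inner_sum L (apply_kernel L Q u) (apply_kernel L Q u)
      - (inner_sum L (apply_kernel L Q u) (apply_kernel L Q u) - quad_form L Q (apply_kernel L Q u))"
    unfolding quad_ip by (simp add: app_diff_vec ip_diff_left ip_diff_right sa)
  ultimately show ?thesis by (simp add: Re_ip_self)
qed

lemma eff_compl_square: "norm2 L (\<lambda>l. u l - apply_kernel L Q u l) = norm2 L u - 2 * Re (quad_form L Q u) + norm2 L (apply_kernel L Q u)"
proof -
  have "norm2 L (\<lambda>l. u l - apply_kernel L Q u l) = norm2 L u - Re (quad_form L Q u) - (Re (inner_sum L (apply_kernel L Q u) u) - norm2 L (apply_kernel L Q u))"
    unfolding Re_ip_self[symmetric] quad_ip by (simp add: ip_diff_left ip_diff_right)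
  then show ?thesis by (simp add: quad_ip sa)
qed

text \<open>The outcomes act as \<open>Q\<close> and \<open>1 - Q\<close> themselves, not as their
  square roots. As \<open>Q^2 + (1 - Q)^2 \<le> 1\<close>, the two branches together still carry at
  most the norm of \<open>u\<close>, which is what the walk down a tree requires.\<close>

lemma eff_split: "norm2 L (apply_kernel L Q u) + norm2 L (\<lambda>l. u l - apply_kernel L Q u l) \<le> norm2 L u"
  using eff_square[of u] by (simp add: eff_compl_square)

text \<open>Gentle measurement in terms of overlaps: \<open>s\<close> is the original vector and
  \<open>v\<close> the one already disturbed by earlier measurements. The loss is the inner product
  of \<open>(1 - Q) s\<close> with \<open>v\<close>, and the squared norm of
  \<open>(1 - Q) s\<close> is at most the rejection weight of \<open>s\<close>.\<close>

lemma eff_overlap_accept: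
  assumes "\<eta> > 0"
  shows "Re (inner_sum L s (apply_kernel L Q v)) \<ge> Re (inner_sum L s v) - ((norm2 L s - Re (quad_form L Q s)) / \<eta> + \<eta> * norm2 L v) / 2"
proof -
  have "Re (inner_sum L s v) - Re (inner_sum L s (apply_kernel L Q v)) = Re (inner_sum L (\<lambda>l. s l - apply_kernel L Q s l) v)"
    by (simp add: sa ip_diff_left)
  also have "\<dots> \<le> (norm2 L (\<lambda>l. s l - apply_kernel L Q s l) / \<eta> + \<eta> * norm2 L v) / 2"
    by (rule young_ip[OF assms])
  also have "\<dots> \<le> ((norm2 L s - Re (quad_form L Q s)) / \<eta> + \<eta> * norm2 L v) / 2"
    using assms eff_square[of s] by (simp add: eff_compl_square divide_right_mono)
  finally show ?thesis by linarith
qed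

lemma eff_overlap_reject:
  assumes "\<eta> > 0"
  shows "Re (inner_sum L s (\<lambda>l. v l - apply_kernel L Q v l)) \<ge> Re (inner_sum L s v) - (Re (quad_form L Q s) / \<eta> + \<eta> * norm2 L v) / 2"
proof -
  have "Re (inner_sum L s v) - Re (inner_sum L s (\<lambda>l. v l - apply_kernel L Q v l)) = Re (inner_sum L (apply_kernel L Q s) v)"
    by (simp add: sa ip_diff_right)
  also have "\<dots> \<le> (norm2 L (apply_kernel L Q s) / \<eta> + \<eta> * norm2 L v) / 2"
    by (rule young_ip[OF assms])
  also have "\<dots> \<le> (Re (quad_form L Q s) / \<eta> + \<eta> * norm2 L v) / 2"
    using assms eff_square[of s] by (simp add: divide_right_mono)
  finally show ?thesis by linarith
qed

end

section \<open>Query trees\<close>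

text \<open>A Littlestone tree for a relation with a gap: all leaves have depth \<open>d\<close>,
  the query \<open>y\<close> may depend on the branch, and elements that are neither clearly
  accepted nor clearly rejected are dropped on the way. Only the leaves are required to be
  nonempty.\<close>

inductive shatter :: "('x \<Rightarrow> 'y \<Rightarrow> bool) \<Rightarrow> ('x \<Rightarrow> 'y \<Rightarrow> bool) \<Rightarrow> nat \<Rightarrow> 'x set \<Rightarrow> bool"
  for acc rej where
  leaf: "x \<in> X \<Longrightarrow> shatter acc rej 0 X"
| node: "X0 \<subseteq> X \<Longrightarrow> X1 \<subseteq> X \<Longrightarrow> (\<And>x. x \<in> X0 \<Longrightarrow> acc x y) \<Longrightarrow> (\<And>x. x \<in> X1 \<Longrightarrow> rej x y) \<Longrightarrow>
    shatter acc rej d X0 \<Longrightarrow> shatter acc rej d X1 \<Longrightarrow> shatter acc rej (Suc d) X"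

lemma sum_list_loss:
  fixes f g h :: "'a \<Rightarrow> real"
  shows "(\<Sum>s\<leftarrow>xs. f s - (g s / \<eta> + \<eta> * h s) / 2) =
    (\<Sum>s\<leftarrow>xs. f s) - ((\<Sum>s\<leftarrow>xs. g s) / \<eta> + \<eta> * (\<Sum>s\<leftarrow>xs. h s)) / 2"
  by (induction xs) (simp_all add: add_divide_distrib distrib_left)

text \<open>The states \<open>ss x\<close> are given by Gram vectors and are dominated by one fixed operator. Along
  the branch that is correct for \<open>x\<close> the measurements disturb the state of \<open>x\<close> only little, while at
  every node the outcomes split the norm of the dominating operator.\<close>

lemma shatter_dominated:
  fixes ss :: "'x \<Rightarrow> ('a \<Rightarrow> complex) list" and ts :: "('a \<Rightarrow> complex) list"
  assumes fin: "finite L" and effect_kernel: "\<And>y. effect_kernel L (Q y)" and eta: "\<eta> > 0"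
    and one: "\<And>x. x \<in> U \<Longrightarrow> (\<Sum>s\<leftarrow>ss x. norm2 L s) = 1"
    and dom: "\<And>x A. x \<in> U \<Longrightarrow> (\<Sum>s\<leftarrow>ss x. norm2 L (apply_kernel L A s)) \<le> \<Lambda> * (\<Sum>s\<leftarrow>ts. norm2 L (apply_kernel L A s))"
    and acc: "\<And>x y. x \<in> U \<Longrightarrow> acc x y \<Longrightarrow> 1 - (\<Sum>s\<leftarrow>ss x. Re (quad_form L (Q y) s)) \<le> \<delta>"
    and rej: "\<And>x y. x \<in> U \<Longrightarrow> rej x y \<Longrightarrow> (\<Sum>s\<leftarrow>ss x. Re (quad_form L (Q y) s)) \<le> \<delta>"
    and Lam: "\<Lambda> \<ge> 0"
    and sh: "shatter acc rej d X"
  shows "X \<subseteq> U \<Longrightarrow> (\<And>u. norm2 L (apply_kernel L A u) \<le> norm2 L u) \<Longrightarrow>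
    (\<And>x. x \<in> X \<Longrightarrow> (\<Sum>s\<leftarrow>ss x. Re (inner_sum L s (apply_kernel L A s))) \<ge> 1 - lam) \<Longrightarrow>
    2 ^ d * (1 - 2 * (lam + d * ((\<delta> / \<eta> + \<eta>) / 2))) \<le> \<Lambda> * (\<Sum>s\<leftarrow>ts. norm2 L (apply_kernel L A s))"
  using sh
proof (induction d X arbitrary: A lam rule: shatter.induct)
  case (leaf x X)
  \<comment> \<open>This expands \<open>|s - A s|^2 \<ge> 0\<close>. An overlap of at least
    \<open>1 - lam\<close> thus leaves norm at least \<open>1 - 2 * lam\<close>, which explains the
    factor 2 in the claim.\<close>
  have "(\<Sum>s\<leftarrow>ss x. 2 * Re (inner_sum L s (apply_kernel L A s)) - norm2 L s) \<le> (\<Sum>s\<leftarrow>ss x. norm2 L (apply_kernel L A s))"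
  proof (rule sum_list_mono)
    fix s
    show "2 * Re (inner_sum L s (apply_kernel L A s)) - norm2 L s \<le> norm2 L (apply_kernel L A s)"
      using young_ip[of 1 L s "apply_kernel L A s"] by simp
  qed
  moreover have "(\<Sum>s\<leftarrow>ss x. 2 * Re (inner_sum L s (apply_kernel L A s)) - norm2 L s)
      = 2 * (\<Sum>s\<leftarrow>ss x. Re (inner_sum L s (apply_kernel L A s))) - (\<Sum>s\<leftarrow>ss x. norm2 L s)"
    by (simp add: sum_list_subtractf sum_list_const_mult)
  moreover have "x \<in> U" using leaf by auto
  ultimately show ?case
    using leaf(4)[OF leaf(1)] one[of x] dom[of x A] by simp
next
  case (node X0 X X1 y d)
  \<comment> \<open>The overlap lost at one node; for \<open>\<delta> = \<eta>\<^sup>2\<close> it is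
    just \<eta>.\<close>
  define \<epsilon> where "\<epsilon> = (\<delta> / \<eta> + \<eta>) / 2"
  \<comment> \<open>\<open>A\<close> is the product of the outcomes on the path so far;
    \<open>A0\<close> and \<open>A1\<close> append the outcomes accept and reject of the query
    \<open>y\<close>.\<close>
  define A0 where "A0 = compose_kernel L (Q y) A"
  define A1 where "A1 = (\<lambda>i j. A i j - A0 i j)"
  have a0: "apply_kernel L A0 u = apply_kernel L (Q y) (apply_kernel L A u)" for u
    by (simp add: A0_def app_comp_kernel)
  have a1: "apply_kernel L A1 u = (\<lambda>l. apply_kernel L A u l - apply_kernel L (Q y) (apply_kernel L A u) l)" for u
    by (simp add: A1_def app_diff_kernel a0)
  note e = fin effect_kernel[of y]
  have loss: "F \<le> v \<Longrightarrow> F = f - (G + \<eta>) / 2 \<Longrightarrow> G \<le> \<delta> / \<eta> \<Longrightarrow> 1 - lam \<le> f \<Longrightarrow>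
      1 - (lam + (\<delta> / \<eta> + \<eta>) / 2) \<le> v" for F G f v
    by argo
  have split: "norm2 L (apply_kernel L A0 u) + norm2 L (apply_kernel L A1 u) \<le> norm2 L (apply_kernel L A u)" for u
    unfolding a0 a1 by (rule eff_split[OF e])
  have c0: "norm2 L (apply_kernel L A0 u) \<le> norm2 L u" and c1: "norm2 L (apply_kernel L A1 u) \<le> norm2 L u" for u
    using split[of u] node.prems(2)[of u] norm2_nonneg[of L "apply_kernel L A0 u"] norm2_nonneg[of L "apply_kernel L A1 u"]
    by linarith+
  have o0: "(\<Sum>s\<leftarrow>ss x. Re (inner_sum L s (apply_kernel L A0 s))) \<ge> 1 - (lam + \<epsilon>)" if "x \<in> X0" for x
  proof -
    have x: "x \<in> X" "x \<in> U" using that node by auto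
    have "(\<Sum>s\<leftarrow>ss x. Re (inner_sum L s (apply_kernel L A s)) - ((norm2 L s - Re (quad_form L (Q y) s)) / \<eta> + \<eta> * norm2 L s) / 2)
        \<le> (\<Sum>s\<leftarrow>ss x. Re (inner_sum L s (apply_kernel L A0 s)))"
    proof (rule sum_list_mono)
      fix s
      have "Re (inner_sum L s (apply_kernel L A s)) - ((norm2 L s - Re (quad_form L (Q y) s)) / \<eta> + \<eta> * norm2 L (apply_kernel L A s)) / 2
          \<le> Re (inner_sum L s (apply_kernel L A0 s))"
        unfolding a0 using eff_overlap_accept[OF e eta] .
      \<comment> \<open>\<open>A\<close> is a contraction, so the disturbed vector can be replaced
        by \<open>s\<close> in the error term; the norms of the vectors \<open>s\<close> add up to
        1.\<close>
      moreover have "\<eta> * norm2 L (apply_kernel L A s) \<le> \<eta> * norm2 L s" using eta node.prems(2)[of s] by simp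
      ultimately show "Re (inner_sum L s (apply_kernel L A s)) - ((norm2 L s - Re (quad_form L (Q y) s)) / \<eta> + \<eta> * norm2 L s) / 2
          \<le> Re (inner_sum L s (apply_kernel L A0 s))" by argo
    qed
    moreover have "(\<Sum>s\<leftarrow>ss x. Re (inner_sum L s (apply_kernel L A s)) - ((norm2 L s - Re (quad_form L (Q y) s)) / \<eta> + \<eta> * norm2 L s) / 2)
      = (\<Sum>s\<leftarrow>ss x. Re (inner_sum L s (apply_kernel L A s)))
        - (((\<Sum>s\<leftarrow>ss x. norm2 L s) - (\<Sum>s\<leftarrow>ss x. Re (quad_form L (Q y) s))) / \<eta> + \<eta> * (\<Sum>s\<leftarrow>ss x. norm2 L s)) / 2"
      unfolding sum_list_loss sum_list_subtractf ..
    moreover have "(1 - (\<Sum>s\<leftarrow>ss x. Re (quad_form L (Q y) s))) / \<eta> \<le> \<delta> / \<eta>"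
      using acc[OF x(2) node.hyps(3)[OF that]] eta by (simp add: divide_right_mono)
    ultimately show ?thesis
      using node.prems(3)[OF x(1)] unfolding one[OF x(2)] \<epsilon>_def mult_1_right
      by (rule loss)
  qed
  have o1: "(\<Sum>s\<leftarrow>ss x. Re (inner_sum L s (apply_kernel L A1 s))) \<ge> 1 - (lam + \<epsilon>)" if "x \<in> X1" for x
  proof -
    have x: "x \<in> X" "x \<in> U" using that node by auto
    have "(\<Sum>s\<leftarrow>ss x. Re (inner_sum L s (apply_kernel L A s)) - (Re (quad_form L (Q y) s) / \<eta> + \<eta> * norm2 L s) / 2)
        \<le> (\<Sum>s\<leftarrow>ss x. Re (inner_sum L s (apply_kernel L A1 s)))"
    proof (rule sum_list_mono)
      fix s
      have "Re (inner_sum L s (apply_kernel L A s)) - (Re (quad_form L (Q y) s) / \<eta> + \<eta> * norm2 L (apply_kernel L A s)) / 2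
          \<le> Re (inner_sum L s (apply_kernel L A1 s))"
        unfolding a1 using eff_overlap_reject[OF e eta] .
      moreover have "\<eta> * norm2 L (apply_kernel L A s) \<le> \<eta> * norm2 L s" using eta node.prems(2)[of s] by simp
      ultimately show "Re (inner_sum L s (apply_kernel L A s)) - (Re (quad_form L (Q y) s) / \<eta> + \<eta> * norm2 L s) / 2
          \<le> Re (inner_sum L s (apply_kernel L A1 s))" by argo
    qed
    moreover have "(\<Sum>s\<leftarrow>ss x. Re (inner_sum L s (apply_kernel L A s)) - (Re (quad_form L (Q y) s) / \<eta> + \<eta> * norm2 L s) / 2)
      = (\<Sum>s\<leftarrow>ss x. Re (inner_sum L s (apply_kernel L A s)))
        - ((\<Sum>s\<leftarrow>ss x. Re (quad_form L (Q y) s)) / \<eta> + \<eta> * (\<Sum>s\<leftarrow>ss x. norm2 L s)) / 2"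
      unfolding sum_list_loss ..
    moreover have "(\<Sum>s\<leftarrow>ss x. Re (quad_form L (Q y) s)) / \<eta> \<le> \<delta> / \<eta>"
      using rej[OF x(2) node.hyps(4)[OF that]] eta by (simp add: divide_right_mono)
    ultimately show ?thesis
      using node.prems(3)[OF x(1)] unfolding one[OF x(2)] \<epsilon>_def mult_1_right
      by (rule loss)
  qed
  have "2 ^ d * (1 - 2 * (lam + \<epsilon> + d * \<epsilon>)) \<le> \<Lambda> * (\<Sum>s\<leftarrow>ts. norm2 L (apply_kernel L A0 s))"
    unfolding \<epsilon>_def by (rule node.IH(1)) (use node.hyps(1) node.prems(1) c0 o0[unfolded \<epsilon>_def] in auto)
  moreover have "2 ^ d * (1 - 2 * (lam + \<epsilon> + d * \<epsilon>)) \<le> \<Lambda> * (\<Sum>s\<leftarrow>ts. norm2 L (apply_kernel L A1 s))"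
    unfolding \<epsilon>_def by (rule node.IH(2)) (use node.hyps(2) node.prems(1) c1 o1[unfolded \<epsilon>_def] in auto)
  \<comment> \<open>The dominating family is the same for all \<open>x\<close>, so both subtrees
    have to share its norm. This is what doubles the left-hand side at every level.\<close>
  moreover have "(\<Sum>s\<leftarrow>ts. norm2 L (apply_kernel L A0 s)) + (\<Sum>s\<leftarrow>ts. norm2 L (apply_kernel L A1 s)) \<le> (\<Sum>s\<leftarrow>ts. norm2 L (apply_kernel L A s))"
    unfolding sum_list_addf[symmetric] by (rule sum_list_mono) (rule split)
  then have "\<Lambda> * (\<Sum>s\<leftarrow>ts. norm2 L (apply_kernel L A0 s)) + \<Lambda> * (\<Sum>s\<leftarrow>ts. norm2 L (apply_kernel L A1 s)) \<le> \<Lambda> * (\<Sum>s\<leftarrow>ts. norm2 L (apply_kernel L A s))"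
    using Lam by (metis distrib_left mult_left_mono)
  ultimately have "2 * (2 ^ d * (1 - 2 * (lam + \<epsilon> + d * \<epsilon>))) \<le> \<Lambda> * (\<Sum>s\<leftarrow>ts. norm2 L (apply_kernel L A s))"
    by linarith
  moreover have "2 ^ Suc d * (1 - 2 * (lam + Suc d * \<epsilon>)) = 2 * (2 ^ d * (1 - 2 * (lam + \<epsilon> + d * \<epsilon>)))"
    by (simp add: algebra_simps)
  ultimately show ?case unfolding \<epsilon>_def[symmetric] by linarith
qed

section \<open>Amplification\<close>

text \<open>The indices of the \<open>t\<close>-fold tensor power, as lists, so that inductions can
  peel off the first copy.\<close>

primrec tuples :: "'a set \<Rightarrow> nat \<Rightarrow> 'a list set" where
  "tuples S 0 = {[]}"
| "tuples S (Suc t) = (\<lambda>(i, l). i # l) ` (S \<times> tuples S t)"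

primrec product_vec :: "('a \<Rightarrow> complex) list \<Rightarrow> 'a list \<Rightarrow> complex" where
  "product_vec [] l = 1"
| "product_vec (u # us) l = u (hd l) * product_vec us (tl l)"

definition tensor_kernel :: "('a \<Rightarrow> 'a \<Rightarrow> complex) \<Rightarrow> ('a list \<Rightarrow> 'a list \<Rightarrow> complex) \<Rightarrow> 'a list \<Rightarrow> 'a list \<Rightarrow> complex" where
  "tensor_kernel E Q l m = E (hd l) (hd m) * Q (tl l) (tl m)"

text \<open>\<open>threshold_kernel E t s\<close>: at least \<open>s\<close> of \<open>t\<close> independent measurements of \<open>E\<close> accept.\<close>

fun threshold_kernel :: "('a \<Rightarrow> 'a \<Rightarrow> complex) \<Rightarrow> nat \<Rightarrow> nat \<Rightarrow> 'a list \<Rightarrow> 'a list \<Rightarrow> complex" where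
  "threshold_kernel E t 0 = id_kernel"
| "threshold_kernel E 0 (Suc s) = (\<lambda>_ _. 0)"
| "threshold_kernel E (Suc t) (Suc s) = (\<lambda>l m. tensor_kernel E (threshold_kernel E t s) l m + tensor_kernel (\<lambda>i j. id_kernel i j - E i j) (threshold_kernel E t (Suc s)) l m)"

text \<open>The probability that a binomial variable with parameters \<open>t\<close> and
  \<open>p\<close> is at least \<open>s\<close>, by conditioning on the first trial: the recursion
  of \<open>threshold_kernel\<close>.\<close>

fun binomial_tail :: "real \<Rightarrow> nat \<Rightarrow> nat \<Rightarrow> real" where
  "binomial_tail p t 0 = 1"
| "binomial_tail p 0 (Suc s) = 0"
| "binomial_tail p (Suc t) (Suc s) = p * binomial_tail p t s + (1 - p) * binomial_tail p t (Suc s)"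

section \<open>Tensor powers of kernels and of Gram vectors\<close>

lemma finite_Ls: "finite S \<Longrightarrow> finite (tuples S t)"
  by (induction t) auto

lemma sum_Ls_Suc: "(\<Sum>l\<in>tuples S (Suc t). g l) = (\<Sum>i\<in>S. \<Sum>l\<in>tuples S t. g (i # l))"
proof -
  have "inj_on (\<lambda>(i, l). i # l) (S \<times> tuples S t)" by (auto simp: inj_on_def)
  then show ?thesis by (simp add: sum.reindex sum.cartesian_product case_prod_unfold)
qed

lemma sum_list_n_lists_Suc:
  fixes g :: "_ \<Rightarrow> 'b::comm_monoid_add"
  shows "(\<Sum>us\<leftarrow>List.n_lists (Suc t) vs. g us) = (\<Sum>us\<leftarrow>List.n_lists t vs. \<Sum>u\<leftarrow>vs. g (u # us))"
proof -
  have "sum_list (concat xss) = sum_list (map sum_list xss)" for xss :: "'b list list"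
    by (induction xss) simp_all
  then show ?thesis by (simp add: map_concat o_def)
qed

lemma sum_sum_list: "(\<Sum>i\<in>S. \<Sum>v\<leftarrow>vs. f i v) = (\<Sum>v\<leftarrow>vs. \<Sum>i\<in>S. (f i v :: 'b::comm_monoid_add))"
  by (induction vs) (simp_all add: sum.distrib)

lemma sum_list_swap:
  "(\<Sum>u\<leftarrow>us. \<Sum>v\<leftarrow>vs. f u v) = (\<Sum>v\<leftarrow>vs. \<Sum>u\<leftarrow>us. (f u v :: 'b::comm_monoid_add))"
  by (induction us) (simp_all add: sum_list_addf)

lemma quad_tens:
  "quad_form (tuples S (Suc t)) (tensor_kernel E Q) \<psi> =
    (\<Sum>i\<in>S. \<Sum>l\<in>tuples S t. \<Sum>j\<in>S. \<Sum>m\<in>tuples S t. cnj (\<psi> (i # l)) * (E i j * Q l m) * \<psi> (j # m))"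
  unfolding quad_form_def sum_Ls_Suc by (simp add: tensor_kernel_def)

lemma quad_tens_pv:
  "quad_form (tuples S (Suc t)) (tensor_kernel E Q) (product_vec (u # us)) = quad_form S E u * quad_form (tuples S t) Q (product_vec us)"
proof -
  have "quad_form (tuples S (Suc t)) (tensor_kernel E Q) (product_vec (u # us)) =
     (\<Sum>i\<in>S. \<Sum>l\<in>tuples S t. (\<Sum>j\<in>S. cnj (u i) * E i j * u j) * (\<Sum>m\<in>tuples S t. cnj (product_vec us l) * Q l m * product_vec us m))"
    unfolding quad_tens sum_product by (intro sum.cong refl) simp
  then show ?thesis by (simp only: quad_form_def sum_product)
qed

text \<open>Only \<open>E\<close> is decomposed. Each of its Gram vectors \<open>v\<close>,
  contracted with the first tensor factor of \<psi>, leaves a vector on \<open>t\<close> copies, and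
  the form of the tensor product is the sum of the forms of \<open>Q\<close> at these
  vectors.\<close>

lemma psd_tens:
  assumes "finite S" "psd S E" "psd (tuples S t) Q"
  shows "psd (tuples S (Suc t)) (tensor_kernel E Q)"
  unfolding psd_def
proof
  fix \<psi>
  obtain vs where vs: "\<And>i j. i \<in> S \<Longrightarrow> j \<in> S \<Longrightarrow> E i j = (\<Sum>v\<leftarrow>vs. v i * cnj (v j))"
    using psd_gram[OF assms(1,2)] by blast
  have "quad_form (tuples S (Suc t)) (tensor_kernel E Q) \<psi> =
     (\<Sum>i\<in>S. \<Sum>l\<in>tuples S t. \<Sum>j\<in>S. \<Sum>m\<in>tuples S t. \<Sum>v\<leftarrow>vs. (v i * cnj (\<psi> (i # l))) * Q l m * (cnj (v j) * \<psi> (j # m)))"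
    unfolding quad_tens
  proof (intro sum.cong refl)
    fix i l j m assume "i \<in> S" "j \<in> S"
    then show "cnj (\<psi> (i # l)) * (E i j * Q l m) * \<psi> (j # m) =
      (\<Sum>v\<leftarrow>vs. (v i * cnj (\<psi> (i # l))) * Q l m * (cnj (v j) * \<psi> (j # m)))"
      unfolding vs[OF \<open>i \<in> S\<close> \<open>j \<in> S\<close>] sum_list_mult_const[symmetric] sum_list_const_mult[symmetric]
      by (intro arg_cong[where f = sum_list] map_cong refl) (simp only: mult_ac)
  qed
  also have "\<dots> = (\<Sum>v\<leftarrow>vs. \<Sum>i\<in>S. \<Sum>l\<in>tuples S t. \<Sum>j\<in>S. \<Sum>m\<in>tuples S t. (v i * cnj (\<psi> (i # l))) * Q l m * (cnj (v j) * \<psi> (j # m)))"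
    by (simp only: sum_sum_list)
  also have "\<dots> = (\<Sum>v\<leftarrow>vs. quad_form (tuples S t) Q (\<lambda>l. \<Sum>i\<in>S. cnj (v i) * \<psi> (i # l)))"
  proof (intro arg_cong[where f = sum_list] map_cong refl)
    fix v
    let ?a = "\<lambda>i l. v i * cnj (\<psi> (i # l))" and ?b = "\<lambda>j m. cnj (v j) * \<psi> (j # m)"
    have "(\<Sum>i\<in>S. \<Sum>l\<in>tuples S t. \<Sum>j\<in>S. \<Sum>m\<in>tuples S t. ?a i l * Q l m * ?b j m) =
      (\<Sum>l\<in>tuples S t. \<Sum>i\<in>S. \<Sum>m\<in>tuples S t. \<Sum>j\<in>S. ?a i l * Q l m * ?b j m)"
      by (subst sum.swap, intro sum.cong refl, rule sum.swap)
    also have "\<dots> = (\<Sum>l\<in>tuples S t. \<Sum>m\<in>tuples S t. \<Sum>i\<in>S. \<Sum>j\<in>S. ?a i l * Q l m * ?b j m)"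
      by (intro sum.cong refl, rule sum.swap)
    also have "\<dots> = (\<Sum>l\<in>tuples S t. \<Sum>m\<in>tuples S t. \<Sum>j\<in>S. \<Sum>i\<in>S. ?a i l * Q l m * ?b j m)"
      by (rule sum.cong[OF refl], rule sum.cong[OF refl], rule sum.swap)
    also have "\<dots> = quad_form (tuples S t) Q (\<lambda>l. \<Sum>i\<in>S. ?b i l)"
      by (simp add: quad_form_def sum_distrib_left sum_distrib_right)
    finally show "(\<Sum>i\<in>S. \<Sum>l\<in>tuples S t. \<Sum>j\<in>S. \<Sum>m\<in>tuples S t. ?a i l * Q l m * ?b j m) =
      quad_form (tuples S t) Q (\<lambda>l. \<Sum>i\<in>S. ?b i l)" .
  qed
  also have "0 \<le> \<dots>"
    using assms(3) by (intro sum_list_nonneg) (auto simp: psd_def)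
  finally show "0 \<le> quad_form (tuples S (Suc t)) (tensor_kernel E Q) \<psi>" .
qed

lemma quad_add_kernel: "quad_form S (\<lambda>i j. A i j + B i j) v = quad_form S A v + quad_form S B v"
  by (simp add: quad_form_def sum.distrib distrib_left distrib_right)

lemma psd_add: "psd S A \<Longrightarrow> psd S B \<Longrightarrow> psd S (\<lambda>i j. A i j + B i j)"
  by (simp add: psd_def quad_add_kernel)

lemma psd_cong: "(\<And>i j. i \<in> S \<Longrightarrow> j \<in> S \<Longrightarrow> A i j = B i j) \<Longrightarrow> psd S A \<longleftrightarrow> psd S B"
  using quad_cong[of S A B] unfolding psd_def by auto

lemma quad_idk: "finite S \<Longrightarrow> quad_form S id_kernel v = of_real (norm2 S v)"
proof -
  assume "finite S"
  then have "quad_form S id_kernel v = inner_sum S v v"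
    unfolding quad_ip by (intro ip_cong) (simp_all add: app_idk)
  also have "\<dots> = of_real (norm2 S v)"
    by (simp add: inner_sum_def norm2_def complex_norm_square mult.commute del: of_real_power)
  finally show ?thesis .
qed

lemma psd_idk: "finite S \<Longrightarrow> psd S id_kernel"
  by (simp add: psd_def quad_idk norm2_nonneg less_eq_complex_def)

lemma psd_zero: "psd S (\<lambda>_ _. 0)"
  by (simp add: psd_def quad_form_def)

lemma idk_Cons: "id_kernel (i # l) (j # m) = id_kernel i j * id_kernel l m"
  by (simp add: id_kernel_def)

text \<open>The complement of a threshold kernel obeys the same recursion, with the complements of
  the two smaller kernels, because \<open>E\<close> and \<open>1 - E\<close> add up to the identity.
  So both positivity conditions pass through one induction.\<close>

lemma eff_maj:
  assumes "finite S" "effect_kernel S E"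
  shows "effect_kernel (tuples S t) (threshold_kernel E t s)"
  using assms(2)
proof (induction E t s rule: threshold_kernel.induct)
  case (1 E t)
  then show ?case using psd_idk[OF finite_Ls[OF assms(1)]] by (simp add: effect_kernel_def psd_zero)
next
  case (2 E s)
  then show ?case using psd_idk[of "{[]}"] by (simp add: effect_kernel_def psd_zero)
next
  case (3 E t s)
  let ?C = "\<lambda>i j. id_kernel i j - E i j"
  have E: "psd S E" "psd S ?C" using 3(3) by (auto simp: effect_kernel_def)
  have IH: "psd (tuples S t) (threshold_kernel E t s)" "psd (tuples S t) (\<lambda>l m. id_kernel l m - threshold_kernel E t s l m)"
      "psd (tuples S t) (threshold_kernel E t (Suc s))" "psd (tuples S t) (\<lambda>l m. id_kernel l m - threshold_kernel E t (Suc s) l m)"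
    using 3 by (auto simp: effect_kernel_def)
  have "psd (tuples S (Suc t)) (\<lambda>l m. tensor_kernel E (\<lambda>l m. id_kernel l m - threshold_kernel E t s l m) l m
      + tensor_kernel ?C (\<lambda>l m. id_kernel l m - threshold_kernel E t (Suc s) l m) l m)"
    using E IH assms(1) by (intro psd_add psd_tens)
  moreover have "tensor_kernel E (\<lambda>l m. id_kernel l m - threshold_kernel E t s l m) l m + tensor_kernel ?C (\<lambda>l m. id_kernel l m - threshold_kernel E t (Suc s) l m) l m
     = id_kernel l m - threshold_kernel E (Suc t) (Suc s) l m" if "l \<in> tuples S (Suc t)" "m \<in> tuples S (Suc t)" for l m
    using that by (auto simp: tensor_kernel_def idk_Cons algebra_simps)
  ultimately have "psd (tuples S (Suc t)) (\<lambda>l m. id_kernel l m - threshold_kernel E (Suc t) (Suc s) l m)"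
    by (subst (asm) psd_cong) auto
  moreover have "psd (tuples S (Suc t)) (threshold_kernel E (Suc t) (Suc s))"
    unfolding threshold_kernel.simps using E IH assms(1) by (intro psd_add psd_tens)
  ultimately show ?case by (simp add: effect_kernel_def del: threshold_kernel.simps tuples.simps)
qed

lemma norm2_pv:
  assumes "finite S"
  shows "norm2 (tuples S (Suc t)) (product_vec (u # us)) = norm2 S u * norm2 (tuples S t) (product_vec us)"
  by (simp add: norm2_def sum_Ls_Suc sum_product norm_mult power_mult_distrib del: tuples.simps)

lemma sum_norm2_pv:
  assumes "finite S"
  shows "(\<Sum>us\<leftarrow>List.n_lists t vs. norm2 (tuples S t) (product_vec us)) = (\<Sum>v\<leftarrow>vs. norm2 S v) ^ t"
proof (induction t)
  case 0
  then show ?case by (simp add: norm2_def)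
next
  case (Suc t)
  have "(\<Sum>us\<leftarrow>List.n_lists (Suc t) vs. norm2 (tuples S (Suc t)) (product_vec us)) =
      (\<Sum>us\<leftarrow>List.n_lists t vs. (\<Sum>v\<leftarrow>vs. norm2 S v) * norm2 (tuples S t) (product_vec us))"
    unfolding sum_list_n_lists_Suc norm2_pv[OF assms] sum_list_mult_const ..
  then show ?case by (simp add: sum_list_const_mult Suc.IH)
qed

text \<open>The lists of \<open>t\<close> Gram vectors of a state give, through
  \<open>product_vec\<close>, Gram vectors of its \<open>t\<close>-th tensor power. On them a tensor
  kernel factorizes, and the first copy contributes \<open>p\<close> or
  \<open>1 - p\<close>.\<close>

lemma sum_quad_maj:
  assumes fin: "finite S" and one: "(\<Sum>v\<leftarrow>vs. norm2 S v) = 1"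
    and p: "(\<Sum>v\<leftarrow>vs. quad_form S E v) = of_real p"
  shows "(\<Sum>us\<leftarrow>List.n_lists t vs. quad_form (tuples S t) (threshold_kernel E t s) (product_vec us)) = of_real (binomial_tail p t s)"
proof (induction t arbitrary: s)
  case 0
  then show ?case by (cases s) (simp_all add: quad_form_def id_kernel_def)
next
  case (Suc t)
  show ?case
  proof (cases s)
    case 0
    have "(\<Sum>us\<leftarrow>xs. complex_of_real (f us)) = of_real (\<Sum>us\<leftarrow>xs. f us)" for f :: "('a \<Rightarrow> complex) list \<Rightarrow> real" and xs
      by (induction xs) auto
    then show ?thesis
      by (simp add: 0 quad_idk finite_Ls fin sum_norm2_pv one del: tuples.simps List.n_lists.simps)
  next
    case (Suc s')
    let ?C = "\<lambda>i j. id_kernel i j - E i j"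
    have q: "quad_form S ?C v = of_real (norm2 S v) - quad_form S E v" for v
      using quad_add_kernel[of S ?C E v] by (simp add: quad_idk fin)
    have one': "(\<Sum>v\<leftarrow>vs. complex_of_real (norm2 S v)) = 1"
    proof -
      have "(\<Sum>v\<leftarrow>vs. complex_of_real (norm2 S v)) = of_real (\<Sum>v\<leftarrow>vs. norm2 S v)"
        by (induction vs) auto
      then show ?thesis using one by simp
    qed
    have pc: "(\<Sum>v\<leftarrow>vs. quad_form S ?C v) = of_real (1 - p)"
      unfolding q sum_list_subtractf p one' by simp
    have "(\<Sum>us\<leftarrow>List.n_lists (Suc t) vs. quad_form (tuples S (Suc t)) (threshold_kernel E (Suc t) (Suc s')) (product_vec us)) =
      (\<Sum>us\<leftarrow>List.n_lists t vs. of_real p * quad_form (tuples S t) (threshold_kernel E t s') (product_vec us) + of_real (1 - p) * quad_form (tuples S t) (threshold_kernel E t (Suc s')) (product_vec us))"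
      unfolding sum_list_n_lists_Suc threshold_kernel.simps quad_add_kernel quad_tens_pv sum_list_addf sum_list_mult_const p pc ..
    then show ?thesis
      by (simp add: Suc Suc.IH sum_list_addf sum_list_const_mult del: threshold_kernel.simps tuples.simps List.n_lists.simps)
  qed
qed

text \<open>The hypothesis is the operator inequality between two states, up to the factor
  \<Lambda>, tested on all linear functionals. One tensor factor is exchanged at a time: for fixed
  other factors, \<open>A\<close> gives one functional of the first factor for each
  \<open>l\<close>; for a fixed first factor, contraction leaves a kernel on one copy less.\<close>

lemma product_dominated:
  fixes vs ts :: "('a \<Rightarrow> complex) list" and A :: "'b \<Rightarrow> 'a list \<Rightarrow> complex"
  assumes dom: "\<And>a. (\<Sum>v\<leftarrow>vs. (cmod (\<Sum>i\<in>S. a i * v i))\<^sup>2) \<le> \<Lambda> * (\<Sum>v\<leftarrow>ts. (cmod (\<Sum>i\<in>S. a i * v i))\<^sup>2)"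
    and Lam: "\<Lambda> \<ge> 0"
  shows "(\<Sum>us\<leftarrow>List.n_lists t vs. norm2 L (apply_kernel (tuples S t) A (product_vec us)))
    \<le> \<Lambda> ^ t * (\<Sum>us\<leftarrow>List.n_lists t ts. norm2 L (apply_kernel (tuples S t) A (product_vec us)))"
proof (induction t arbitrary: A)
  case 0
  then show ?case by simp
next
  case (Suc t)
  have slice: "apply_kernel (tuples S (Suc t)) A (product_vec (u # us)) = apply_kernel (tuples S t) (\<lambda>l m. \<Sum>i\<in>S. A l (i # m) * u i) (product_vec us)" for u us
  proof
    fix l
    have "apply_kernel (tuples S (Suc t)) A (product_vec (u # us)) l = (\<Sum>i\<in>S. \<Sum>m\<in>tuples S t. A l (i # m) * (u i * product_vec us m))"
      by (simp add: apply_kernel_def sum_Ls_Suc del: tuples.simps)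
    also have "\<dots> = (\<Sum>m\<in>tuples S t. \<Sum>i\<in>S. A l (i # m) * (u i * product_vec us m))" by (rule sum.swap)
    also have "\<dots> = apply_kernel (tuples S t) (\<lambda>l m. \<Sum>i\<in>S. A l (i # m) * u i) (product_vec us) l"
      by (simp add: apply_kernel_def sum_distrib_right mult.assoc)
    finally show "apply_kernel (tuples S (Suc t)) A (product_vec (u # us)) l = apply_kernel (tuples S t) (\<lambda>l m. \<Sum>i\<in>S. A l (i # m) * u i) (product_vec us) l" .
  qed
  have first: "(\<Sum>u\<leftarrow>vs. norm2 L (apply_kernel (tuples S (Suc t)) A (product_vec (u # us)))) \<le>
    \<Lambda> * (\<Sum>u\<leftarrow>ts. norm2 L (apply_kernel (tuples S (Suc t)) A (product_vec (u # us))))" for us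
  proof -
    have lin: "apply_kernel (tuples S (Suc t)) A (product_vec (u # us)) l = (\<Sum>i\<in>S. (\<Sum>m\<in>tuples S t. A l (i # m) * product_vec us m) * u i)" for u l
      by (simp add: apply_kernel_def sum_Ls_Suc sum_distrib_right sum_distrib_left mult_ac del: tuples.simps)
    have "(\<Sum>u\<leftarrow>vs. norm2 L (apply_kernel (tuples S (Suc t)) A (product_vec (u # us)))) =
      (\<Sum>l\<in>L. \<Sum>u\<leftarrow>vs. (cmod (\<Sum>i\<in>S. (\<Sum>m\<in>tuples S t. A l (i # m) * product_vec us m) * u i))\<^sup>2)"
      unfolding norm2_def lin sum_sum_list ..
    also have "\<dots> \<le> (\<Sum>l\<in>L. \<Lambda> * (\<Sum>u\<leftarrow>ts. (cmod (\<Sum>i\<in>S. (\<Sum>m\<in>tuples S t. A l (i # m) * product_vec us m) * u i))\<^sup>2))"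
      by (intro sum_mono dom)
    also have "\<dots> = \<Lambda> * (\<Sum>u\<leftarrow>ts. norm2 L (apply_kernel (tuples S (Suc t)) A (product_vec (u # us))))"
      unfolding norm2_def lin sum_sum_list[symmetric] sum_distrib_left ..
    finally show ?thesis .
  qed
  have "(\<Sum>us\<leftarrow>List.n_lists (Suc t) vs. norm2 L (apply_kernel (tuples S (Suc t)) A (product_vec us))) \<le>
    (\<Sum>us\<leftarrow>List.n_lists t vs. \<Lambda> * (\<Sum>u\<leftarrow>ts. norm2 L (apply_kernel (tuples S (Suc t)) A (product_vec (u # us)))))"
    unfolding sum_list_n_lists_Suc by (intro sum_list_mono first)
  also have "\<dots> = \<Lambda> * (\<Sum>u\<leftarrow>ts. \<Sum>us\<leftarrow>List.n_lists t vs. norm2 L (apply_kernel (tuples S (Suc t)) A (product_vec (u # us))))"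
    unfolding sum_list_const_mult by (subst sum_list_swap) (rule refl)
  also have "\<dots> \<le> \<Lambda> * (\<Sum>u\<leftarrow>ts. \<Lambda> ^ t * (\<Sum>us\<leftarrow>List.n_lists t ts. norm2 L (apply_kernel (tuples S (Suc t)) A (product_vec (u # us)))))"
    unfolding slice by (intro mult_left_mono sum_list_mono Suc.IH Lam)
  also have "\<dots> = \<Lambda> ^ Suc t * (\<Sum>us\<leftarrow>List.n_lists (Suc t) ts. norm2 L (apply_kernel (tuples S (Suc t)) A (product_vec us)))"
    unfolding sum_list_n_lists_Suc sum_list_const_mult
    by (subst sum_list_swap) (simp only: power_Suc mult.assoc)
  finally show ?case .
qed

text \<open>Chernoff's bound with the weight \<open>5 / 3\<close>, which is
  \<open>(1 - p) / p\<close> at \<open>p = 3 / 8\<close> and hence the best one for a threshold at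
  half of the trials: the mean of \<open>(5 / 3) ^ X\<close> is
  \<open>(1 + 2 / 3 * p) ^ t \<le> (5 / 4) ^ t\<close>.\<close>

lemma btail_upper:
  fixes p :: real
  assumes "0 \<le> p" "p \<le> 3 / 8"
  shows "binomial_tail p t s \<le> (3 / 5) ^ s * (5 / 4) ^ t"
proof (induction t arbitrary: s)
  case 0
  then show ?case by (cases s) simp_all
next
  case (Suc t)
  show ?case
  proof (cases s)
    case 0
    then show ?thesis using one_le_power[of "5/4 :: real" "Suc t"] by simp
  next
    case (Suc s')
    define X :: real where "X = (3 / 5) ^ s' * (5 / 4) ^ t"
    have X: "X \<ge> 0" by (simp add: X_def)
    have "binomial_tail p (Suc t) s \<le> p * X + (1 - p) * (3 / 5 * X)"
      unfolding Suc binomial_tail.simps X_def using assms Suc.IH[of s'] Suc.IH[of "Suc s'"]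
      by (intro add_mono mult_left_mono) auto
    also have "\<dots> = (3 / 5 + 2 / 5 * p) * X" by (simp add: field_simps)
    also have "\<dots> \<le> 3 / 4 * X" using assms X by (intro mult_right_mono) auto
    finally show ?thesis by (simp add: Suc X_def mult_ac)
  qed
qed

lemma btail_lower:
  fixes p :: real
  assumes "5 / 8 \<le> p" "p \<le> 1"
  shows "1 - binomial_tail p t s \<le> (5 / 3) ^ s * (3 / 4) ^ t"
proof (induction t arbitrary: s)
  case 0
  then show ?case using one_le_power[of "5 / 3 :: real" s] by (cases s) simp_all
next
  case (Suc t)
  show ?case
  proof (cases s)
    case 0
    then show ?thesis by simp
  next
    case (Suc s')
    define X :: real where "X = (5 / 3) ^ s' * (3 / 4) ^ t"
    have X: "X \<ge> 0" by (simp add: X_def)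
    have "1 - binomial_tail p (Suc t) s = p * (1 - binomial_tail p t s') + (1 - p) * (1 - binomial_tail p t (Suc s'))"
      by (simp add: Suc algebra_simps)
    also have "\<dots> \<le> p * X + (1 - p) * (5 / 3 * X)"
      unfolding X_def using assms Suc.IH[of s'] Suc.IH[of "Suc s'"]
      by (intro add_mono mult_left_mono) auto
    also have "\<dots> = (5 / 3 - 2 / 3 * p) * X" by (simp add: field_simps)
    also have "\<dots> \<le> 5 / 4 * X" using assms X by (intro mult_right_mono) auto
    finally show ?thesis by (simp add: Suc X_def mult_ac)
  qed
qed

text \<open>The rate is \<open>3 / 5 * (5 / 4)^2 = 15 / 16\<close>. The lower tail gives the same
  one, \<open>5 / 3 * (3 / 4)^2\<close>.\<close>

lemma btail_upper_half: "0 \<le> p \<Longrightarrow> p \<le> 3 / 8 \<Longrightarrow> binomial_tail p (2 * s) s \<le> (15 / 16) ^ s"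
  using btail_upper[of p "2 * s" s] by (simp add: power_mult power2_eq_square flip: power_mult_distrib)

lemma btail_lower_half: "5 / 8 \<le> p \<Longrightarrow> p \<le> 1 \<Longrightarrow> 1 - binomial_tail p (2 * s) s \<le> (15 / 16) ^ s"
  using btail_lower[of p "2 * s" s] by (simp add: power_mult power2_eq_square flip: power_mult_distrib)

text \<open>Constant errors would use up the overlap after a few nodes. A majority over
  \<open>2 * s\<close> copies makes them small enough for \<open>d\<close> nodes, and it raises the
  domination factor and the norm of the dominating family to the power \<open>2 * s\<close>.\<close>

theorem shatter_bound:
  fixes ss :: "'x \<Rightarrow> ('a \<Rightarrow> complex) list" and ts :: "('a \<Rightarrow> complex) list" and E :: "'y \<Rightarrow> 'a \<Rightarrow> 'a \<Rightarrow> complex"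
  assumes fin: "finite S" and effect_kernel: "\<And>y. effect_kernel S (E y)"
    and one: "\<And>x. x \<in> U \<Longrightarrow> (\<Sum>v\<leftarrow>ss x. norm2 S v) = 1"
    and dom: "\<And>x a. x \<in> U \<Longrightarrow> (\<Sum>v\<leftarrow>ss x. (cmod (\<Sum>i\<in>S. a i * v i))\<^sup>2) \<le> \<Lambda> * (\<Sum>v\<leftarrow>ts. (cmod (\<Sum>i\<in>S. a i * v i))\<^sup>2)"
    and acc: "\<And>x y. x \<in> U \<Longrightarrow> acc x y \<Longrightarrow> 5 / 8 \<le> (\<Sum>v\<leftarrow>ss x. Re (quad_form S (E y) v))"
    and rej: "\<And>x y. x \<in> U \<Longrightarrow> rej x y \<Longrightarrow> (\<Sum>v\<leftarrow>ss x. Re (quad_form S (E y) v)) \<le> 3 / 8"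
    and Lam: "\<Lambda> \<ge> 0" and sh: "shatter acc rej d U"
    and d: "d \<ge> 1" and s: "(15 / 16) ^ s \<le> 1 / (16 * (real d)\<^sup>2)"
  shows "2 ^ d / 2 \<le> (\<Lambda> * (\<Sum>v\<leftarrow>ts. norm2 S v)) ^ (2 * s)"
proof -
  define t where "t = 2 * s"
  define L where "L = tuples S t"
  define p where "p = (\<lambda>x y. \<Sum>v\<leftarrow>ss x. Re (quad_form S (E y) v))"
  \<comment> \<open>The amplified error is at most \<eta>^2, so a node costs \<eta> and the whole
    branch \<open>d * \<eta> = 1 / 4\<close>; the factor \<open>1 - 2 / 4\<close> that remains is
    the half in the conclusion.\<close>
  define \<eta> where "\<eta> = 1 / (4 * real d)"
  have eta: "\<eta> > 0" and eta2: "1 / (16 * (real d)\<^sup>2) = \<eta>\<^sup>2" using d by (auto simp: \<eta>_def power2_eq_square)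
  have finL: "finite L" by (simp add: L_def finite_Ls fin)
  have sumC: "(\<Sum>us\<leftarrow>xs. complex_of_real (f us)) = of_real (\<Sum>us\<leftarrow>xs. f us)" for f :: "'z \<Rightarrow> real" and xs
    by (induction xs) auto
  have ReC: "(\<Sum>us\<leftarrow>xs. Re (f us)) = Re (\<Sum>us\<leftarrow>xs. f us)" for f :: "'z \<Rightarrow> complex" and xs
    by (induction xs) auto
  have quadR: "quad_form S (E y) v = of_real (Re (quad_form S (E y) v))" for v y
    using effect_kernel[of y] by (auto simp: effect_kernel_def psd_def less_eq_complex_def complex_eq_iff)
  have pq: "(\<Sum>v\<leftarrow>ss x. quad_form S (E y) v) = of_real (p x y)" for x y
    unfolding p_def by (subst quadR) (rule sumC)
  have p01: "0 \<le> p x y" "p x y \<le> 1" if "x \<in> U" for x y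
  proof -
    note b = eff_quad_bounds[OF fin effect_kernel[of y]]
    show "0 \<le> p x y" unfolding p_def using b by (intro sum_list_nonneg) auto
    have "p x y \<le> (\<Sum>v\<leftarrow>ss x. norm2 S v)" unfolding p_def using b by (intro sum_list_mono) auto
    then show "p x y \<le> 1" using one[OF that] by simp
  qed
  have bt: "(\<Sum>u\<leftarrow>map product_vec (List.n_lists t (ss x)). Re (quad_form L (threshold_kernel (E y) t s) u)) = binomial_tail (p x y) t s" if "x \<in> U" for x y
    using sum_quad_maj[OF fin one[OF that] pq[of y x], of t s] by (simp add: ReC o_def L_def)
  have "2 ^ d * (1 - 2 * (0 + real d * ((\<eta>\<^sup>2 / \<eta> + \<eta>) / 2))) \<le>
      \<Lambda> ^ t * (\<Sum>u\<leftarrow>map product_vec (List.n_lists t ts). norm2 L (apply_kernel L id_kernel u))"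
  proof (rule shatter_dominated[where ss = "\<lambda>x. map product_vec (List.n_lists t (ss x))" and U = U and X = U
        and Q = "\<lambda>y. threshold_kernel (E y) t s" and acc = acc and rej = rej])
    show "effect_kernel L (threshold_kernel (E y) t s)" for y unfolding L_def by (rule eff_maj[OF fin effect_kernel])
    show norm: "(\<Sum>u\<leftarrow>map product_vec (List.n_lists t (ss x)). norm2 L u) = 1" if "x \<in> U" for x
      using sum_norm2_pv[OF fin, of t "ss x"] one[OF that] by (simp add: o_def L_def)
    show "(\<Sum>u\<leftarrow>map product_vec (List.n_lists t (ss x)). norm2 L (apply_kernel L A u)) \<le>
        \<Lambda> ^ t * (\<Sum>u\<leftarrow>map product_vec (List.n_lists t ts). norm2 L (apply_kernel L A u))" if "x \<in> U" for x A
      using product_dominated[where A = A and L = L and t = t, OF dom[OF that] Lam] by (simp add: o_def L_def)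
    show "1 - (\<Sum>u\<leftarrow>map product_vec (List.n_lists t (ss x)). Re (quad_form L (threshold_kernel (E y) t s) u)) \<le> \<eta>\<^sup>2" if "x \<in> U" "acc x y" for x y
      unfolding bt[OF that(1)] unfolding t_def
      using btail_lower_half[of "p x y" s] acc[OF that] p01[OF that(1)] s eta2 by (simp add: p_def)
    show "(\<Sum>u\<leftarrow>map product_vec (List.n_lists t (ss x)). Re (quad_form L (threshold_kernel (E y) t s) u)) \<le> \<eta>\<^sup>2" if "x \<in> U" "rej x y" for x y
      unfolding bt[OF that(1)] unfolding t_def
      using btail_upper_half[of "p x y" s] rej[OF that] p01[OF that(1)] s eta2 by (simp add: p_def)
    have id: "norm2 L (apply_kernel L id_kernel u) = norm2 L u" "inner_sum L u (apply_kernel L id_kernel u) = inner_sum L u u" for u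
      using app_idk[OF finL] by (auto intro!: norm2_cong ip_cong)
    show "norm2 L (apply_kernel L id_kernel u) \<le> norm2 L u" for u by (simp add: id)
    show "1 - 0 \<le> (\<Sum>u\<leftarrow>map product_vec (List.n_lists t (ss x)). Re (inner_sum L u (apply_kernel L id_kernel u)))" if "x \<in> U" for x
      using norm[OF that] unfolding id Re_ip_self by linarith
  qed (use finL eta Lam sh in auto)
  also have "(\<Sum>u\<leftarrow>map product_vec (List.n_lists t ts). norm2 L (apply_kernel L id_kernel u)) = (\<Sum>v\<leftarrow>ts. norm2 S v) ^ t"
  proof -
    have "norm2 L (apply_kernel L id_kernel u) = norm2 L u" for u
      using app_idk[OF finL] by (auto intro!: norm2_cong)
    then show ?thesis using sum_norm2_pv[OF fin, of t ts] by (simp add: o_def L_def)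
  qed
  also have "2 ^ d * (1 - 2 * (0 + real d * ((\<eta>\<^sup>2 / \<eta> + \<eta>) / 2))) = 2 ^ d / 2"
  proof -
    have "real d * ((\<eta>\<^sup>2 / \<eta> + \<eta>) / 2) = 1 / 4"
      using d by (simp add: \<eta>_def power2_eq_square)
    then show ?thesis by simp
  qed
  finally show ?thesis by (simp add: t_def power_mult_distrib)
qed

section \<open>One-way protocols with entanglement\<close>

definition kernel :: "complex mat \<Rightarrow> nat \<Rightarrow> nat \<Rightarrow> complex" where
  "kernel A i j = A $$ (i, j)"

lemma psd_kernel:
  assumes "positive_op d A"
  shows "psd {..<d} (kernel A)"
  unfolding psd_def
proof
  fix v
  have A: "A \<in> carrier_mat d d" using assms by (simp add: positive_op_def)
  have "(A *\<^sub>v vec d v) \<bullet>c vec d v = (\<Sum>i<d. \<Sum>j<d. A $$ (i, j) * v j * cnj (v i))"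
    using A by (simp add: scalar_prod_def sum_distrib_right atLeast0LessThan)
  also have "\<dots> = quad_form {..<d} (kernel A) v"
    by (simp add: quad_form_def kernel_def mult_ac)
  finally show "0 \<le> quad_form {..<d} (kernel A) v"
    using assms by (metis positive_op_def vec_carrier)
qed

lemma eff_kernel:
  assumes "effect d M"
  shows "effect_kernel {..<d} (kernel M)"
proof -
  have "M \<in> carrier_mat d d" using assms by (simp add: effect_def positive_op_def)
  then have "psd {..<d} (kernel (1\<^sub>m d - M)) \<longleftrightarrow> psd {..<d} (\<lambda>i j. id_kernel i j - kernel M i j)"
    by (intro psd_cong) (auto simp: kernel_def id_kernel_def)
  then show ?thesis using assms psd_kernel by (auto simp: effect_kernel_def effect_def)
qed

section \<open>Gram vectors of states and of channel outputs\<close>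

lemma sum_mats_index:
  assumes "set As \<subseteq> carrier_mat d d" "i < d" "j < d"
  shows "sum_mats d As $$ (i, j) = (\<Sum>A\<leftarrow>As. A $$ (i, j))"
proof -
  have "foldr (+) As (0\<^sub>m d d) \<in> carrier_mat d d \<and> foldr (+) As (0\<^sub>m d d) $$ (i, j) = (\<Sum>A\<leftarrow>As. A $$ (i, j))"
    using assms by (induction As) auto
  then show ?thesis by (simp add: sum_mats_def)
qed

lemma sum_mats_carrier: "set As \<subseteq> carrier_mat d d \<Longrightarrow> sum_mats d As \<in> carrier_mat d d"
  unfolding sum_mats_def by (induction As) auto

lemma adjoint_index:
  "K \<in> carrier_mat d' d \<Longrightarrow> mat_adjoint K \<in> carrier_mat d d'"
  "K \<in> carrier_mat d' d \<Longrightarrow> i < d \<Longrightarrow> j < d' \<Longrightarrow> mat_adjoint K $$ (i, j) = cnj (K $$ (j, i))"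
  by (auto simp: mat_adjoint_def mat_of_rows_def)

lemma mult_index:
  assumes "A \<in> carrier_mat r n" "B \<in> carrier_mat n c" "i < r" "j < c"
  shows "(A * B) $$ (i, j) = (\<Sum>k<n. A $$ (i, k) * B $$ (k, j))"
  using assms by (simp add: scalar_prod_def atLeast0LessThan)

lemma density_op_gram:
  assumes "density_op d \<sigma>"
  shows "\<exists>gs. (\<forall>i j. i < d \<longrightarrow> j < d \<longrightarrow> \<sigma> $$ (i, j) = (\<Sum>g\<leftarrow>gs. g i * cnj (g j))) \<and>
    (\<Sum>g\<leftarrow>gs. norm2 {..<d} g) = 1"
proof -
  have \<sigma>c: "\<sigma> \<in> carrier_mat d d" and \<sigma>p: "positive_op d \<sigma>" and tr: "mat_trace \<sigma> = 1"
    using assms by (auto simp: density_op_def positive_op_def)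
  obtain gs where gram: "\<And>i j. i < d \<Longrightarrow> j < d \<Longrightarrow> \<sigma> $$ (i, j) = (\<Sum>g\<leftarrow>gs. g i * cnj (g j))"
    using psd_gram[OF _ psd_kernel[OF \<sigma>p]] by (auto simp: kernel_def)
  have "complex_of_real (\<Sum>g\<leftarrow>gs. norm2 {..<d} g) = (\<Sum>i<d. \<Sum>g\<leftarrow>gs. g i * cnj (g i))"
    unfolding sum_sum_list
    by (induction gs) (simp_all add: norm2_def complex_norm_square del: of_real_power)
  also have "\<dots> = mat_trace \<sigma>" using \<sigma>c by (simp add: mat_trace_def gram)
  finally have "(\<Sum>g\<leftarrow>gs. norm2 {..<d} g) = 1" using tr by simp
  then show ?thesis using gram by blast
qed

definition apply_mat :: "nat \<Rightarrow> complex mat \<Rightarrow> (nat \<Rightarrow> complex) \<Rightarrow> nat \<Rightarrow> complex" where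
  "apply_mat d K g = (\<lambda>i. \<Sum>j<d. K $$ (i, j) * g j)"

lemma conj_gram:
  assumes K: "K \<in> carrier_mat d' d" and \<rho>: "\<rho> \<in> carrier_mat d d"
    and gram: "\<And>i j. i < d \<Longrightarrow> j < d \<Longrightarrow> \<rho> $$ (i, j) = (\<Sum>g\<leftarrow>gs. g i * cnj (g j))"
    and "i < d'" "j < d'"
  shows "(K * \<rho> * mat_adjoint K) $$ (i, j) = (\<Sum>g\<leftarrow>gs. apply_mat d K g i * cnj (apply_mat d K g j))"
proof -
  have "(K * \<rho> * mat_adjoint K) $$ (i, j) = (\<Sum>b<d. (\<Sum>a<d. K $$ (i, a) * \<rho> $$ (a, b)) * cnj (K $$ (j, b)))"
    using assms adjoint_index[OF K]
    by (subst mult_index[where r = d' and n = d and c = d'])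
      (auto intro!: sum.cong mult_carrier_mat simp del: index_mult_mat simp: mult_index[OF K \<rho>])
  also have "\<dots> = (\<Sum>b<d. \<Sum>a<d. \<Sum>g\<leftarrow>gs. (K $$ (i, a) * g a) * (cnj (K $$ (j, b) * g b)))"
    unfolding sum_distrib_right
  proof (intro sum.cong refl)
    fix a b assume "a \<in> {..<d}" "b \<in> {..<d}"
    then have "\<rho> $$ (a, b) = (\<Sum>g\<leftarrow>gs. g a * cnj (g b))" using gram by simp
    then show "K $$ (i, a) * \<rho> $$ (a, b) * cnj (K $$ (j, b)) = (\<Sum>g\<leftarrow>gs. (K $$ (i, a) * g a) * (cnj (K $$ (j, b) * g b)))"
      by (simp add: sum_list_const_mult[symmetric] sum_list_mult_const[symmetric] mult_ac)
  qed
  also have "\<dots> = (\<Sum>g\<leftarrow>gs. \<Sum>b<d. \<Sum>a<d. (K $$ (i, a) * g a) * (cnj (K $$ (j, b) * g b)))"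
    by (simp only: sum_sum_list)
  also have "\<dots> = (\<Sum>g\<leftarrow>gs. apply_mat d K g i * cnj (apply_mat d K g j))"
    unfolding apply_mat_def cnj_sum sum_product
    by (intro arg_cong[where f = sum_list] map_cong refl sum.swap)
  finally show ?thesis .
qed

text \<open>The passage from matrices to kernels: the vectors \<open>K g\<close>, for all Kraus
  operators \<open>K\<close> and Gram vectors \<open>g\<close> of the input, are Gram vectors of the
  output, and each of them contributes the form of \<open>M\<close>.\<close>

lemma accept_prob_gram:
  assumes M: "M \<in> carrier_mat d' d'" and Ks: "set Ks \<subseteq> carrier_mat d' d" and \<rho>: "\<rho> \<in> carrier_mat d d"
    and gram: "\<And>i j. i < d \<Longrightarrow> j < d \<Longrightarrow> \<rho> $$ (i, j) = (\<Sum>g\<leftarrow>gs. g i * cnj (g j))"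
  shows "accept_prob M (apply_channel d' Ks \<rho>) = (\<Sum>K\<leftarrow>Ks. \<Sum>g\<leftarrow>gs. Re (quad_form {..<d'} (kernel M) (apply_mat d K g)))"
proof -
  let ?X = "apply_channel d' Ks \<rho>"
  have c: "K * \<rho> * mat_adjoint K \<in> carrier_mat d' d'" if "K \<in> set Ks" for K
    using that Ks adjoint_index(1)[of K d' d] \<rho> by auto
  have Xc: "?X \<in> carrier_mat d' d'"
    unfolding apply_channel_def using c by (intro sum_mats_carrier) auto
  have X: "?X $$ (j, i) = (\<Sum>K\<leftarrow>Ks. \<Sum>g\<leftarrow>gs. apply_mat d K g j * cnj (apply_mat d K g i))" if "i < d'" "j < d'" for i j
  proof -
    have "?X $$ (j, i) = (\<Sum>K\<leftarrow>Ks. (K * \<rho> * mat_adjoint K) $$ (j, i))"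
      unfolding apply_channel_def using c that by (subst sum_mats_index) (auto simp: o_def)
    also have "\<dots> = (\<Sum>K\<leftarrow>Ks. \<Sum>g\<leftarrow>gs. apply_mat d K g j * cnj (apply_mat d K g i))"
      using Ks that by (intro arg_cong[where f = sum_list] map_cong refl conj_gram[OF _ \<rho> gram]) auto
    finally show ?thesis .
  qed
  have "mat_trace (M * ?X) = (\<Sum>i<d'. \<Sum>j<d'. M $$ (i, j) * ?X $$ (j, i))"
    using M Xc by (simp add: mat_trace_def scalar_prod_def atLeast0LessThan)
  also have "\<dots> = (\<Sum>i<d'. \<Sum>j<d'. \<Sum>K\<leftarrow>Ks. \<Sum>g\<leftarrow>gs. cnj (apply_mat d K g i) * M $$ (i, j) * apply_mat d K g j)"
    by (intro sum.cong refl) (simp add: X sum_list_const_mult[symmetric] mult_ac)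
  also have "\<dots> = (\<Sum>K\<leftarrow>Ks. \<Sum>g\<leftarrow>gs. quad_form {..<d'} (kernel M) (apply_mat d K g))"
    by (simp only: sum_sum_list quad_form_def kernel_def)
  finally have tr: "mat_trace (M * ?X) = (\<Sum>K\<leftarrow>Ks. \<Sum>g\<leftarrow>gs. quad_form {..<d'} (kernel M) (apply_mat d K g))" .
  have ReC: "Re (\<Sum>u\<leftarrow>xs. f u) = (\<Sum>u\<leftarrow>xs. Re (f u))" for f :: "'z \<Rightarrow> complex" and xs
    by (induction xs) auto
  show ?thesis unfolding accept_prob_def tr ReC ..
qed

lemma channel_norm2:
  assumes "channel d d' Ks"
  shows "(\<Sum>K\<leftarrow>Ks. norm2 {..<d'} (apply_mat d K h)) = norm2 {..<d} h"
proof -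
  have Ks: "K \<in> carrier_mat d' d" if "K \<in> set Ks" for K using assms that by (auto simp: channel_def)
  have one: "(\<Sum>K\<leftarrow>Ks. \<Sum>i<d'. cnj (K $$ (i, a)) * K $$ (i, b)) = id_kernel a b" if "a < d" "b < d" for a b
  proof -
    have "(\<Sum>K\<leftarrow>Ks. \<Sum>i<d'. cnj (K $$ (i, a)) * K $$ (i, b)) = (\<Sum>K\<leftarrow>Ks. (mat_adjoint K * K) $$ (a, b))"
    proof (intro arg_cong[where f = sum_list] map_cong refl)
      fix K assume "K \<in> set Ks"
      note K = Ks[OF this]
      show "(\<Sum>i<d'. cnj (K $$ (i, a)) * K $$ (i, b)) = (mat_adjoint K * K) $$ (a, b)"
        unfolding mult_index[OF adjoint_index(1)[OF K] K that]
        using that by (intro sum.cong refl) (simp add: adjoint_index(2)[OF K])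
    qed
    also have "\<dots> = sum_mats d (map (\<lambda>K. mat_adjoint K * K) Ks) $$ (a, b)"
      using Ks adjoint_index(1) that by (subst sum_mats_index) (auto simp: o_def intro!: mult_carrier_mat)
    also have "\<dots> = id_kernel a b" using assms that by (simp add: channel_def id_kernel_def)
    finally show ?thesis .
  qed
  have "complex_of_real (\<Sum>K\<leftarrow>Ks. norm2 {..<d'} (apply_mat d K h)) = (\<Sum>K\<leftarrow>Ks. inner_sum {..<d'} (apply_mat d K h) (apply_mat d K h))"
  proof -
    have "complex_of_real (\<Sum>K\<leftarrow>xs. norm2 {..<d'} (apply_mat d K h)) = (\<Sum>K\<leftarrow>xs. inner_sum {..<d'} (apply_mat d K h) (apply_mat d K h))" for xs
      by (induction xs) (simp_all add: inner_sum_def norm2_def complex_norm_square mult.commute del: of_real_power)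
    then show ?thesis .
  qed
  also have "\<dots> = (\<Sum>K\<leftarrow>Ks. \<Sum>i<d'. \<Sum>a<d. \<Sum>b<d. (cnj (h a) * h b) * (cnj (K $$ (i, a)) * K $$ (i, b)))"
    unfolding inner_sum_def apply_mat_def cnj_sum sum_product complex_cnj_mult by (simp only: mult_ac)
  also have "\<dots> = (\<Sum>K\<leftarrow>Ks. \<Sum>a<d. \<Sum>b<d. (cnj (h a) * h b) * (\<Sum>i<d'. cnj (K $$ (i, a)) * K $$ (i, b)))"
  proof (intro arg_cong[where f = sum_list] map_cong refl)
    fix K
    have "(\<Sum>i<d'. \<Sum>a<d. \<Sum>b<d. (cnj (h a) * h b) * (cnj (K $$ (i, a)) * K $$ (i, b))) =
      (\<Sum>a<d. \<Sum>i<d'. \<Sum>b<d. (cnj (h a) * h b) * (cnj (K $$ (i, a)) * K $$ (i, b)))"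
      by (rule sum.swap)
    also have "\<dots> = (\<Sum>a<d. \<Sum>b<d. \<Sum>i<d'. (cnj (h a) * h b) * (cnj (K $$ (i, a)) * K $$ (i, b)))"
      by (rule sum.cong[OF refl], rule sum.swap)
    finally show "(\<Sum>i<d'. \<Sum>a<d. \<Sum>b<d. (cnj (h a) * h b) * (cnj (K $$ (i, a)) * K $$ (i, b))) =
      (\<Sum>a<d. \<Sum>b<d. (cnj (h a) * h b) * (\<Sum>i<d'. cnj (K $$ (i, a)) * K $$ (i, b)))"
      by (simp add: sum_distrib_left)
  qed
  also have "\<dots> = (\<Sum>a<d. \<Sum>b<d. (cnj (h a) * h b) * (\<Sum>K\<leftarrow>Ks. \<Sum>i<d'. cnj (K $$ (i, a)) * K $$ (i, b)))"
    unfolding sum_list_const_mult[symmetric] sum_sum_list ..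
  also have "\<dots> = quad_form {..<d} id_kernel h"
    unfolding quad_form_def
  proof (intro sum.cong refl)
    fix a b assume "a \<in> {..<d}" "b \<in> {..<d}"
    then have "(\<Sum>K\<leftarrow>Ks. \<Sum>i<d'. cnj (K $$ (i, a)) * K $$ (i, b)) = id_kernel a b" by (intro one) auto
    then show "cnj (h a) * h b * (\<Sum>K\<leftarrow>Ks. \<Sum>i<d'. cnj (K $$ (i, a)) * K $$ (i, b)) = cnj (h a) * id_kernel a b * h b"
      by (simp only: mult_ac)
  qed
  finally have "complex_of_real (\<Sum>K\<leftarrow>Ks. norm2 {..<d'} (apply_mat d K h)) = of_real (norm2 {..<d} h)"
    by (simp add: quad_idk)
  then show ?thesis by (simp only: of_real_eq_iff)
qed

section \<open>Alice's channel on her half of the shared state\<close>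

lemma sum_div_mod:
  fixes f :: "nat \<Rightarrow> 'b::comm_monoid_add"
  shows "(\<Sum>i<D * dB. f i) = (\<Sum>e<D. \<Sum>c<dB. f (e * dB + c))"
proof (induction D)
  case (Suc D)
  have "(\<Sum>i<Suc D * dB. f i) = (\<Sum>i<D * dB. f i) + (\<Sum>i\<in>{D * dB..<Suc D * dB}. f i)"
    by (subst sum.union_disjoint[symmetric]) (auto intro: sum.cong)
  also have "(\<Sum>i\<in>{D * dB..<Suc D * dB}. f i) = (\<Sum>c<dB. f (D * dB + c))"
    using sum.shift_bounds_nat_ivl[of f 0 "D * dB" dB] by (simp add: atLeast0LessThan add.commute)
  finally show ?case using Suc by simp
qed simp

lemma cmod_sum_square_le_card:
  "(cmod (\<Sum>e\<in>T. z e))\<^sup>2 \<le> real (card T) * (\<Sum>e\<in>T. (cmod (z e))\<^sup>2)"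
proof -
  have "(cmod (\<Sum>e\<in>T. z e))\<^sup>2 \<le> (\<Sum>e\<in>T. cmod (z e))\<^sup>2"
    by (intro power_mono norm_sum) simp
  also have "\<dots> \<le> real (card T) * (\<Sum>e\<in>T. (cmod (z e))\<^sup>2)"
    using sum_squared_le_sum_of_squares[of "\<lambda>e. cmod (z e)" T] by (simp add: mult.commute)
  finally show ?thesis .
qed

text \<open>In the index convention of \<open>kron\<close>, \<open>e * dB + c\<close> stands for
  Alice's index \<open>e\<close> and Bob's index \<open>c\<close>. A slice fixes Bob's index, and
  \<open>K \<otimes> 1\<close> acts on every slice separately.\<close>

definition slice :: "nat \<Rightarrow> (nat \<Rightarrow> complex) \<Rightarrow> nat \<Rightarrow> nat \<Rightarrow> complex" where
  "slice dB g c = (\<lambda>e. g (e * dB + c))"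

lemma kmap_kron_one:
  assumes "K \<in> carrier_mat D dA" "e < D" "c < dB"
  shows "apply_mat (dA * dB) (kron K (1\<^sub>m dB)) g (e * dB + c) = apply_mat dA K (slice dB g c) e"
proof -
  have lt: "e * dB + c < D * dB" if "e < D" "c < dB" for e D c
  proof -
    have "e * dB + c < Suc e * dB" using that by simp
    also have "\<dots> \<le> D * dB" using that by (intro mult_right_mono) auto
    finally show ?thesis .
  qed
  have dm: "(e * dB + c) div dB = e" "(e * dB + c) mod dB = c" if "c < dB" for e c
    using that by auto
  have "apply_mat (dA * dB) (kron K (1\<^sub>m dB)) g (e * dB + c) =
      (\<Sum>e'<dA. \<Sum>c'<dB. kron K (1\<^sub>m dB) $$ (e * dB + c, e' * dB + c') * g (e' * dB + c'))"
    by (simp add: apply_mat_def sum_div_mod)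
  also have "\<dots> = (\<Sum>e'<dA. \<Sum>c'<dB. if c' = c then K $$ (e, e') * g (e' * dB + c') else 0)"
    using assms lt dm by (intro sum.cong refl) (auto simp: kron_def)
  also have "\<dots> = apply_mat dA K (slice dB g c) e"
    using assms(3) by (simp add: apply_mat_def slice_def)
  finally show ?thesis .
qed

lemma norm2_div_mod: "norm2 {..<D * dB} f = (\<Sum>c<dB. norm2 {..<D} (slice dB f c))"
  unfolding norm2_def sum_div_mod slice_def by (rule sum.swap)

lemma channel_left_norm2:
  assumes "channel dA D Ks"
  shows "(\<Sum>K\<leftarrow>Ks. norm2 {..<D * dB} (apply_mat (dA * dB) (kron K (1\<^sub>m dB)) g)) = norm2 {..<dA * dB} g"
proof -
  have Ks: "K \<in> carrier_mat D dA" if "K \<in> set Ks" for K using assms that by (auto simp: channel_def)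
  have "(\<Sum>K\<leftarrow>Ks. norm2 {..<D * dB} (apply_mat (dA * dB) (kron K (1\<^sub>m dB)) g)) =
     (\<Sum>K\<leftarrow>Ks. \<Sum>c<dB. norm2 {..<D} (apply_mat dA K (slice dB g c)))"
    unfolding norm2_div_mod
    by (intro arg_cong[where f = sum_list] map_cong refl sum.cong norm2_cong)
      (simp add: slice_def[of dB "apply_mat _ _ _"] kmap_kron_one[OF Ks])
  also have "\<dots> = (\<Sum>c<dB. norm2 {..<dA} (slice dB g c))"
    unfolding sum_sum_list[symmetric] channel_norm2[OF assms] ..
  finally show ?thesis by (simp add: norm2_div_mod)
qed

text \<open>The Gram vectors of \<open>1 \<otimes> \<rho>\<^sub>B\<close>, where \<open>\<rho>\<^sub>B\<close> is Bob's half of the shared state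
  \<open>\<rho> = \<Sum> g g\<^sup>*\<close>. It does not depend on what Alice does.\<close>

definition bob_vec :: "nat \<Rightarrow> (nat \<Rightarrow> complex) \<Rightarrow> nat \<Rightarrow> nat \<Rightarrow> nat \<Rightarrow> complex" where
  "bob_vec dB g f e = (\<lambda>i. if i div dB = f then g (e * dB + i mod dB) else 0)"

lemma sum_tvec:
  assumes "f < D"
  shows "(\<Sum>i<D * dB. a i * bob_vec dB g f e i) = (\<Sum>c<dB. a (f * dB + c) * g (e * dB + c))"
proof -
  have "(\<Sum>i<D * dB. a i * bob_vec dB g f e i) =
      (\<Sum>f'<D. if f' = f then \<Sum>c<dB. a (f * dB + c) * g (e * dB + c) else 0)"
    unfolding sum_div_mod by (intro sum.cong refl) (auto simp: bob_vec_def)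
  then show ?thesis using assms by simp
qed

lemma norm2_tvec:
  assumes "f < D"
  shows "norm2 {..<D * dB} (bob_vec dB g f e) = (\<Sum>c<dB. (cmod (g (e * dB + c)))\<^sup>2)"
proof -
  have "norm2 {..<D * dB} (bob_vec dB g f e) =
      (\<Sum>f'<D. if f' = f then \<Sum>c<dB. (cmod (g (e * dB + c)))\<^sup>2 else 0)"
    unfolding norm2_def sum_div_mod by (intro sum.cong refl) (auto simp: bob_vec_def)
  then show ?thesis using assms by simp
qed

text \<open>Alice's output together with Bob's half is at most \<open>D\<close> times
  \<open>1 \<otimes> \<rho>_B\<close>, tested on the functional \<open>a\<close>. Paired with
  \<open>a\<close>, a Kraus operator gives a sum over the \<open>D\<close> output indices
  \<open>f\<close> of one coordinate of \<open>K (h f)\<close>. Cauchy-Schwarz over \<open>f\<close>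
  costs the factor \<open>D\<close>; completing each coordinate to a full norm makes trace
  preservation applicable.\<close>

lemma channel_left_dominated:
  assumes "channel dA D Ks"
  shows "(\<Sum>K\<leftarrow>Ks. (cmod (\<Sum>i<D * dB. a i * apply_mat (dA * dB) (kron K (1\<^sub>m dB)) g i))\<^sup>2)
    \<le> real D * (\<Sum>f<D. \<Sum>e<dA. (cmod (\<Sum>i<D * dB. a i * bob_vec dB g f e i))\<^sup>2)"
proof -
  define h where "h = (\<lambda>f e. \<Sum>c<dB. a (f * dB + c) * g (e * dB + c))"
  have Ks: "K \<in> carrier_mat D dA" if "K \<in> set Ks" for K using assms that by (auto simp: channel_def)
  have ex: "(\<Sum>i<D * dB. a i * apply_mat (dA * dB) (kron K (1\<^sub>m dB)) g i) = (\<Sum>f<D. apply_mat dA K (h f) f)" if "K \<in> set Ks" for K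
  proof -
    have "(\<Sum>i<D * dB. a i * apply_mat (dA * dB) (kron K (1\<^sub>m dB)) g i) =
        (\<Sum>f<D. \<Sum>c<dB. \<Sum>e<dA. K $$ (f, e) * (a (f * dB + c) * g (e * dB + c)))"
      unfolding sum_div_mod
      by (intro sum.cong refl, subst kmap_kron_one[OF Ks[OF that]])
        (simp_all add: apply_mat_def slice_def sum_distrib_left mult_ac)
    also have "\<dots> = (\<Sum>f<D. \<Sum>e<dA. \<Sum>c<dB. K $$ (f, e) * (a (f * dB + c) * g (e * dB + c)))"
      by (rule sum.cong[OF refl], rule sum.swap)
    finally show ?thesis by (simp add: apply_mat_def h_def sum_distrib_left)
  qed
  have "(\<Sum>K\<leftarrow>Ks. (cmod (\<Sum>i<D * dB. a i * apply_mat (dA * dB) (kron K (1\<^sub>m dB)) g i))\<^sup>2) =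
      (\<Sum>K\<leftarrow>Ks. (cmod (\<Sum>f<D. apply_mat dA K (h f) f))\<^sup>2)"
    by (intro arg_cong[where f = sum_list] map_cong refl) (simp add: ex)
  also have "\<dots> \<le> (\<Sum>K\<leftarrow>Ks. real D * (\<Sum>f<D. norm2 {..<D} (apply_mat dA K (h f))))"
  proof (rule sum_list_mono)
    fix K
    have "(cmod (\<Sum>f<D. apply_mat dA K (h f) f))\<^sup>2 \<le> real D * (\<Sum>f<D. (cmod (apply_mat dA K (h f) f))\<^sup>2)"
      using cmod_sum_square_le_card[of "\<lambda>f. apply_mat dA K (h f) f" "{..<D}"] by simp
    also have "\<dots> \<le> real D * (\<Sum>f<D. norm2 {..<D} (apply_mat dA K (h f)))"
      unfolding norm2_def by (intro mult_left_mono sum_mono member_le_sum) auto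
    finally show "(cmod (\<Sum>f<D. apply_mat dA K (h f) f))\<^sup>2 \<le> real D * (\<Sum>f<D. norm2 {..<D} (apply_mat dA K (h f)))" .
  qed
  also have "\<dots> = real D * (\<Sum>f<D. norm2 {..<dA} (h f))"
    unfolding sum_list_const_mult sum_sum_list[symmetric] channel_norm2[OF assms] ..
  also have "\<dots> = real D * (\<Sum>f<D. \<Sum>e<dA. (cmod (\<Sum>i<D * dB. a i * bob_vec dB g f e i))\<^sup>2)"
    unfolding norm2_def by (simp add: sum_tvec h_def)
  finally show ?thesis .
qed

text \<open>The public coin, once its support is finite, is a classical register of the shared state.\<close>

definition coinvec :: "(nat \<Rightarrow> real) \<Rightarrow> nat \<Rightarrow> (nat \<Rightarrow> complex) \<Rightarrow> nat \<times> nat \<Rightarrow> complex" where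
  "coinvec w r u = (\<lambda>(r', i). if r' = r then of_real (sqrt (w r)) * u i else 0)"

definition coinker :: "(nat \<Rightarrow> nat \<Rightarrow> nat \<Rightarrow> complex) \<Rightarrow> nat \<times> nat \<Rightarrow> nat \<times> nat \<Rightarrow> complex" where
  "coinker E = (\<lambda>(r, i) (r', j). if r = r' then E r i j else 0)"

lemma quad_coinker:
  assumes "finite I"
  shows "quad_form ({..<R} \<times> I) (coinker E) v = (\<Sum>r<R. quad_form I (E r) (\<lambda>i. v (r, i)))"
proof -
  have "quad_form ({..<R} \<times> I) (coinker E) v = (\<Sum>r<R. \<Sum>i\<in>I. \<Sum>r'<R. \<Sum>j\<in>I. cnj (v (r, i)) * coinker E (r, i) (r', j) * v (r', j))"
    unfolding quad_form_def by (simp add: sum.cartesian_product' )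
  also have "\<dots> = (\<Sum>r<R. \<Sum>i\<in>I. \<Sum>r'<R. if r' = r then \<Sum>j\<in>I. cnj (v (r, i)) * E r i j * v (r, j) else 0)"
    by (intro sum.cong refl) (auto simp: coinker_def)
  finally show ?thesis by (simp add: quad_form_def)
qed

lemma eff_coinker:
  assumes "finite I" "\<And>r. effect_kernel I (E r)"
  shows "effect_kernel ({..<R} \<times> I) (coinker E)"
proof -
  have psd: "psd ({..<R} \<times> I) (coinker A)" if "\<And>r. psd I (A r)" for A
    using that by (auto simp: psd_def quad_coinker[OF assms(1)] intro!: sum_nonneg)
  have "psd ({..<R} \<times> I) (\<lambda>x y. id_kernel x y - coinker E x y) \<longleftrightarrow>
      psd ({..<R} \<times> I) (coinker (\<lambda>r i j. id_kernel i j - E r i j))"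
    by (rule psd_cong) (auto simp: coinker_def id_kernel_def split: if_splits)
  then show ?thesis using psd[of E] psd[of "\<lambda>r i j. id_kernel i j - E r i j"] assms(2) by (auto simp: effect_kernel_def)
qed

lemma sum_coinvec:
  assumes "finite I" "r < R"
  shows "(\<Sum>x\<in>{..<R} \<times> I. a x * coinvec w r u x) = of_real (sqrt (w r)) * (\<Sum>i\<in>I. a (r, i) * u i)"
proof -
  have "(\<Sum>x\<in>{..<R} \<times> I. a x * coinvec w r u x) = (\<Sum>r'<R. \<Sum>i\<in>I. a (r', i) * coinvec w r u (r', i))"
    by (simp add: sum.cartesian_product')
  also have "\<dots> = (\<Sum>r'<R. if r' = r then of_real (sqrt (w r)) * (\<Sum>i\<in>I. a (r, i) * u i) else 0)"
    by (intro sum.cong refl) (auto simp: coinvec_def sum_distrib_left mult_ac)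
  finally show ?thesis using assms by simp
qed

lemma quad_coinvec:
  assumes "finite I" "r < R" "w r \<ge> 0"
  shows "quad_form ({..<R} \<times> I) (coinker E) (coinvec w r u) = of_real (w r) * quad_form I (E r) u"
proof -
  have sq: "of_real (sqrt (w r)) * of_real (sqrt (w r)) = (of_real (w r) :: complex)"
    using assms(3) by (simp flip: of_real_mult)
  have "quad_form I (E r') (\<lambda>i. coinvec w r u (r', i)) = (if r' = r then of_real (w r) * quad_form I (E r) u else 0)" for r'
    unfolding sq[symmetric] by (simp add: coinvec_def quad_form_def sum_distrib_left mult_ac)
  then show ?thesis using assms by (simp add: quad_coinker)
qed

lemma norm2_coinvec:
  assumes "finite I" "r < R" "w r \<ge> 0"
  shows "norm2 ({..<R} \<times> I) (coinvec w r u) = w r * norm2 I u"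
proof -
  have "norm2 ({..<R} \<times> I) (coinvec w r u) = (\<Sum>r'<R. \<Sum>i\<in>I. (cmod (coinvec w r u (r', i)))\<^sup>2)"
    by (simp add: norm2_def sum.cartesian_product')
  also have "\<dots> = (\<Sum>r'<R. if r' = r then w r * norm2 I u else 0)"
    using assms(3) by (intro sum.cong refl) (auto simp: coinvec_def norm2_def norm_mult power_mult_distrib sum_distrib_left)
  finally show ?thesis using assms by simp
qed

lemma sum_list_concat_map:
  "(\<Sum>s\<leftarrow>concat (map F xs). f s) = (\<Sum>x\<leftarrow>xs. \<Sum>s\<leftarrow>F x. (f s :: 'b::comm_monoid_add))"
  by (induction xs) simp_all

lemma sum_list_upt_sum: "(\<Sum>r\<leftarrow>[0..<R]. f r) = (\<Sum>r<R. (f r :: 'b::comm_monoid_add))"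
  by (induction R) simp_all

text \<open>Kernels are summed over finite index sets, while the support of the coin may be
  infinite. All but \<epsilon> of its mass lies below some \<open>R\<close>; the rest is moved to
  the value 0, which changes the mean of a function with values in [0, 1] by at most
  \<epsilon>.\<close>

lemma finite_coin:
  fixes coin :: "nat pmf"
  assumes "\<epsilon> > (0::real)"
  obtains R w where "\<And>r. w r \<ge> 0" "(\<Sum>r<R. w r) = 1"
    "\<And>g. (\<And>r. 0 \<le> g r \<and> g r \<le> 1) \<Longrightarrow> \<bar>measure_pmf.expectation coin g - (\<Sum>r<R. w r * g r)\<bar> \<le> \<epsilon>"
proof -
  have "(\<lambda>R. measure (measure_pmf coin) {..<R}) \<longlonglongrightarrow> measure (measure_pmf coin) (\<Union>R. {..<R})"
    by (rule measure_pmf.finite_Lim_measure_incseq) (auto simp: incseq_def)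
  moreover have "(\<Union>R::nat. {..<R}) = UNIV" by auto
  ultimately have lim: "(\<lambda>R. measure (measure_pmf coin) {..<R}) \<longlonglongrightarrow> 1" by simp
  have "eventually (\<lambda>R. measure (measure_pmf coin) {..<R} > 1 - \<epsilon>) sequentially"
    using order_tendstoD(1)[OF lim, of "1 - \<epsilon>"] assms by simp
  then have "eventually (\<lambda>R. measure (measure_pmf coin) {..<R} > 1 - \<epsilon> \<and> R > 0) sequentially"
    using eventually_gt_at_top[of "0::nat"] by eventually_elim simp
  then obtain R where R: "measure (measure_pmf coin) {..<R} > 1 - \<epsilon>" "R > 0"
    by (auto simp: eventually_sequentially)
  define W where "W = (\<Sum>r<R. pmf coin r)"
  have W: "measure (measure_pmf coin) {..<R} = W" by (simp add: W_def measure_measure_pmf_finite)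
  have W1: "W \<le> 1" using measure_pmf.prob_le_1[of coin "{..<R}"] W by simp
  define w where "w = (\<lambda>r. pmf coin r + (if r = 0 then 1 - W else 0))"
  show ?thesis
  proof (rule that[of w R])
    show "w r \<ge> 0" for r using W1 by (simp add: w_def)
    show "(\<Sum>r<R. w r) = 1" using R(2) by (simp add: w_def sum.distrib W_def[symmetric])
    fix g :: "nat \<Rightarrow> real" assume g: "\<And>r. 0 \<le> g r \<and> g r \<le> 1"
    have int: "integrable (measure_pmf coin) h" if "\<And>r. 0 \<le> h r \<and> h r \<le> 1" for h :: "nat \<Rightarrow> real"
      using that by (intro measure_pmf.integrable_const_bound[where B = 1]) auto
    have fin: "measure_pmf.expectation coin (\<lambda>r. indicator {..<R} r * h r) = (\<Sum>r<R. pmf coin r * h r)" for h :: "nat \<Rightarrow> real"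
    proof -
      have "measure_pmf.expectation coin (\<lambda>r. indicator {..<R} r * h r) = (\<Sum>r<R. pmf coin r * (indicator {..<R} r * h r))"
        by (subst integral_measure_pmf[of "{..<R}"]) (auto simp: indicator_def)
      then show ?thesis by simp
    qed
    have int01: "integrable (measure_pmf coin) (\<lambda>r. indicator A r * g r)" for A
      using g by (intro int) (auto simp: indicator_def)
    have "measure_pmf.expectation coin g = measure_pmf.expectation coin (\<lambda>r. indicator {..<R} r * g r + indicator (- {..<R}) r * g r)"
      by (intro Bochner_Integration.integral_cong) (auto simp: indicator_def)
    also have "\<dots> = (\<Sum>r<R. pmf coin r * g r) + measure_pmf.expectation coin (\<lambda>r. indicator (- {..<R}) r * g r)"
      by (subst Bochner_Integration.integral_add[OF int01 int01]) (simp only: fin)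
    finally have ex: "measure_pmf.expectation coin g = (\<Sum>r<R. pmf coin r * g r) + measure_pmf.expectation coin (\<lambda>r. indicator (- {..<R}) r * g r)" .
    have "measure_pmf.expectation coin (\<lambda>r. indicator (- {..<R}) r * g r) \<ge> 0"
      using g by (intro integral_nonneg_AE) auto
    moreover have "measure_pmf.expectation coin (\<lambda>r. indicator (- {..<R}) r * g r) \<le> measure_pmf.expectation coin (\<lambda>r. indicator (- {..<R}) r)"
      using g by (intro integral_mono int) (auto simp: indicator_def)
    moreover have "measure_pmf.expectation coin (\<lambda>r. indicator (- {..<R}) r) = 1 - W"
      using measure_pmf.prob_compl[of "{..<R}" coin] W by (simp add: Compl_eq_Diff_UNIV)
    moreover have "(\<Sum>r<R. w r * g r) = (\<Sum>r<R. pmf coin r * g r) + (1 - W) * g 0"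
    proof -
      have "(\<Sum>r<R. w r * g r) = (\<Sum>r<R. pmf coin r * g r + (if r = 0 then (1 - W) * g 0 else 0))"
        by (intro sum.cong refl) (auto simp: w_def algebra_simps)
      then show ?thesis using R(2) by (simp add: sum.distrib)
    qed
    moreover have "0 \<le> (1 - W) * g 0" "(1 - W) * g 0 \<le> 1 - W"
      using g[of 0] W1 by (auto intro: mult_left_le)
    ultimately show "\<bar>measure_pmf.expectation coin g - (\<Sum>r<R. w r * g r)\<bar> \<le> \<epsilon>"
      using R(1) W ex by linarith
  qed
qed

text \<open>Merlin's message is already fixed here and hidden in \<open>alice\<close>. For each coin
  value the same Gram vectors of \<open>1 \<otimes> \<rho>_B\<close> dominate, so weighting with the
  coin keeps the factor \<open>D\<close>.\<close>

theorem qcma_shatter_bound: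
  fixes alice :: "nat \<Rightarrow> 'x \<Rightarrow> complex mat list" and bob :: "nat \<Rightarrow> 'y \<Rightarrow> complex mat"
  assumes \<rho>: "density_op (dA * dB) \<rho>"
    and ch: "\<And>r x. x \<in> U \<Longrightarrow> channel dA D (alice r x)"
    and ef: "\<And>r y. y \<in> Y \<Longrightarrow> effect (D * dB) (bob r y)"
    and acc_def: "\<And>x y. acc x y = measure_pmf.expectation coin
          (\<lambda>r. accept_prob (bob r y) (apply_channel_left D dB (alice r x) \<rho>))"
    and sh: "shatter (\<lambda>x y. x \<in> U \<and> y \<in> Y \<and> acc x y \<ge> 2 / 3) (\<lambda>x y. x \<in> U \<and> y \<in> Y \<and> acc x y \<le> 1 / 3) d U"
    and d: "d \<ge> 1" and s: "(15 / 16) ^ s \<le> 1 / (16 * (real d)\<^sup>2)"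
  shows "2 ^ d / 2 \<le> (real D * real D) ^ (2 * s)"
proof -
  define dd where "dd = dA * dB"
  define I where "I = {..<D * dB}"
  have finI: "finite I" by (simp add: I_def)
  have \<rho>c: "\<rho> \<in> carrier_mat dd dd"
    using \<rho> by (auto simp: density_op_def positive_op_def dd_def)
  obtain gs where gram: "\<And>i j. i < dd \<Longrightarrow> j < dd \<Longrightarrow> \<rho> $$ (i, j) = (\<Sum>g\<leftarrow>gs. g i * cnj (g j))"
    and gsn: "(\<Sum>g\<leftarrow>gs. norm2 {..<dd} g) = 1"
    using density_op_gram[OF \<rho>] unfolding dd_def by blast
  define u where "u = (\<lambda>K. apply_mat dd (kron K (1\<^sub>m dB)))"
  define us where "us = (\<lambda>r x. concat (map (\<lambda>K. map (u K) gs) (alice r x)))"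
  define tvs where "tvs = concat (map (\<lambda>g. concat (map (\<lambda>f. map (bob_vec dB g f) [0..<dA]) [0..<D])) gs)"
  have us_norm: "(\<Sum>v\<leftarrow>us r x. norm2 I v) = 1" if "x \<in> U" for r x
  proof -
    have "(\<Sum>v\<leftarrow>us r x. norm2 I v) = (\<Sum>g\<leftarrow>gs. \<Sum>K\<leftarrow>alice r x. norm2 I (u K g))"
      by (simp add: us_def sum_list_concat_map o_def) (rule sum_list_swap)
    then show ?thesis
      using channel_left_norm2[OF ch[OF that], of dB] gsn by (simp add: u_def dd_def I_def)
  qed
  have us_dom: "(\<Sum>v\<leftarrow>us r x. (cmod (\<Sum>i\<in>I. a i * v i))\<^sup>2) \<le> real D * (\<Sum>v\<leftarrow>tvs. (cmod (\<Sum>i\<in>I. a i * v i))\<^sup>2)"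
    if "x \<in> U" for r x a
  proof -
    have "(\<Sum>v\<leftarrow>us r x. (cmod (\<Sum>i\<in>I. a i * v i))\<^sup>2) = (\<Sum>g\<leftarrow>gs. \<Sum>K\<leftarrow>alice r x. (cmod (\<Sum>i\<in>I. a i * u K g i))\<^sup>2)"
      by (simp add: us_def sum_list_concat_map o_def) (rule sum_list_swap)
    also have "\<dots> \<le> (\<Sum>g\<leftarrow>gs. real D * (\<Sum>f<D. \<Sum>e<dA. (cmod (\<Sum>i\<in>I. a i * bob_vec dB g f e i))\<^sup>2))"
      unfolding u_def dd_def I_def by (intro sum_list_mono channel_left_dominated[OF ch[OF that]])
    also have "\<dots> = real D * (\<Sum>v\<leftarrow>tvs. (cmod (\<Sum>i\<in>I. a i * v i))\<^sup>2)"
      by (simp add: tvs_def sum_list_concat_map o_def sum_list_const_mult sum_list_upt_sum del: sum_list_upt upt_Suc)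
    finally show ?thesis .
  qed
  \<comment> \<open>The trace of \<open>1 \<otimes> \<rho>_B\<close>. Together with the domination
    factor \<open>D\<close> it gives \<open>D^2\<close>, which is \<open>4^b\<close> for
    \<open>b\<close> qubits.\<close>
  have tvs_norm: "(\<Sum>v\<leftarrow>tvs. norm2 I v) = real D"
  proof -
    have "(\<Sum>v\<leftarrow>tvs. norm2 I v) = (\<Sum>g\<leftarrow>gs. \<Sum>f<D. \<Sum>e<dA. norm2 I (bob_vec dB g f e))"
      by (simp add: tvs_def sum_list_concat_map o_def sum_list_upt_sum del: sum_list_upt upt_Suc)
    also have "\<dots> = (\<Sum>g\<leftarrow>gs. real D * norm2 {..<dd} g)"
      by (intro arg_cong[where f = sum_list] map_cong refl)
        (simp add: I_def norm2_tvec norm2_def[of "{..<dA * dB}"] dd_def sum_div_mod)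
    finally show ?thesis by (simp add: sum_list_const_mult gsn)
  qed
  have acc_q: "accept_prob (bob r y) (apply_channel_left D dB (alice r x) \<rho>) =
      (\<Sum>v\<leftarrow>us r x. Re (quad_form I (kernel (bob r y)) v))" if "x \<in> U" "y \<in> Y" for r x y
  proof -
    have "bob r y \<in> carrier_mat (D * dB) (D * dB)"
      using ef[OF that(2), of r] by (simp add: effect_def positive_op_def)
    moreover have "set (map (\<lambda>K. kron K (1\<^sub>m dB)) (alice r x)) \<subseteq> carrier_mat (D * dB) dd"
      using ch[OF that(1), of r] by (auto simp: channel_def kron_def dd_def)
    ultimately show ?thesis
      unfolding apply_channel_left_def
      by (subst accept_prob_gram[OF _ _ \<rho>c gram]) (auto simp: us_def u_def I_def sum_list_concat_map o_def)
  qed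
  \<comment> \<open>Outside \<open>Y\<close> nothing is known about \<open>bob\<close>; the identity
    serves as a default, because an effect is required for every \<open>y\<close>.\<close>
  define E where "E = (\<lambda>y r. if y \<in> Y then kernel (bob r y) else id_kernel)"
  have effE: "effect_kernel I (E y r)" for y r
    using eff_kernel[OF ef] psd_idk[OF finI] by (auto simp: E_def I_def effect_kernel_def psd_zero)
  define q where "q = (\<lambda>x y r. \<Sum>v\<leftarrow>us r x. Re (quad_form I (E y r) v))"
  have q01: "0 \<le> q x y r \<and> q x y r \<le> 1" if "x \<in> U" for x y r
  proof -
    note b = eff_quad_bounds[OF finI effE[of y r]]
    have "q x y r \<le> (\<Sum>v\<leftarrow>us r x. norm2 I v)" unfolding q_def using b by (intro sum_list_mono) auto
    moreover have "0 \<le> q x y r" unfolding q_def using b by (intro sum_list_nonneg) auto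
    ultimately show ?thesis using us_norm[OF that] by simp
  qed
  have accq: "acc x y = measure_pmf.expectation coin (q x y)" if "x \<in> U" "y \<in> Y" for x y
    unfolding acc_def using that by (simp add: acc_q q_def E_def)
  \<comment> \<open>An error of \<open>1 / 24\<close> turns the bounds \<open>2 / 3\<close> and
    \<open>1 / 3\<close> into \<open>5 / 8\<close> and \<open>3 / 8\<close>.\<close>
  obtain R w where w: "\<And>r. w r \<ge> 0" "(\<Sum>r<R. w r) = 1"
    "\<And>g. (\<And>r. 0 \<le> g r \<and> g r \<le> 1) \<Longrightarrow> \<bar>measure_pmf.expectation coin g - (\<Sum>r<R. w r * g r)\<bar> \<le> (1 / 24 :: real)"
    by (rule finite_coin[of "1 / 24" coin]) auto
  define S where "S = {..<R} \<times> I"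
  define ext where "ext = (\<lambda>F. concat (map (\<lambda>r. map (coinvec w r) (F r)) [0..<R]))"
  have extsum: "(\<Sum>v\<leftarrow>ext F. h v) = (\<Sum>r<R. \<Sum>v\<leftarrow>F r. h (coinvec w r v))" for F and h :: "_ \<Rightarrow> real"
    by (simp add: ext_def sum_list_concat_map o_def sum_list_upt_sum del: sum_list_upt upt_Suc)
  have Req: "(\<Sum>v\<leftarrow>ext (\<lambda>r. us r x). Re (quad_form S (coinker (E y)) v)) = (\<Sum>r<R. w r * q x y r)" for x y
    unfolding extsum q_def S_def
    by (intro sum.cong refl) (simp add: quad_coinvec finI w(1) sum_list_const_mult)
  have close: "\<bar>acc x y - (\<Sum>v\<leftarrow>ext (\<lambda>r. us r x). Re (quad_form S (coinker (E y)) v))\<bar> \<le> 1 / 24" if "x \<in> U" "y \<in> Y" for x y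
    unfolding Req accq[OF that] using q01[OF that(1)] by (rule w(3))
  have "2 ^ d / 2 \<le> (real D * (\<Sum>v\<leftarrow>ext (\<lambda>_. tvs). norm2 S v)) ^ (2 * s)"
  proof (rule shatter_bound[where ss = "\<lambda>x. ext (\<lambda>r. us r x)" and E = "\<lambda>y. coinker (E y)" and U = U, OF _ _ _ _ _ _ _ sh d s])
    show "finite S" by (simp add: S_def finI)
    show "effect_kernel S (coinker (E y))" for y unfolding S_def by (rule eff_coinker[OF finI effE])
    show "(\<Sum>v\<leftarrow>ext (\<lambda>r. us r x). norm2 S v) = 1" if "x \<in> U" for x
      using us_norm[OF that] w(2) by (simp add: extsum S_def norm2_coinvec finI w(1) sum_list_const_mult)
    show "(\<Sum>v\<leftarrow>ext (\<lambda>r. us r x). (cmod (\<Sum>i\<in>S. a i * v i))\<^sup>2) \<le> real D * (\<Sum>v\<leftarrow>ext (\<lambda>_. tvs). (cmod (\<Sum>i\<in>S. a i * v i))\<^sup>2)"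
      if "x \<in> U" for x a
    proof -
      have c: "(cmod (\<Sum>i\<in>S. a i * coinvec w r v i))\<^sup>2 = w r * (cmod (\<Sum>i\<in>I. a (r, i) * v i))\<^sup>2" if "r < R" for r v
        unfolding S_def sum_coinvec[OF finI that] by (simp add: norm_mult power_mult_distrib w(1))
      have "(\<Sum>v\<leftarrow>ext (\<lambda>r. us r x). (cmod (\<Sum>i\<in>S. a i * v i))\<^sup>2) =
          (\<Sum>r<R. w r * (\<Sum>v\<leftarrow>us r x. (cmod (\<Sum>i\<in>I. a (r, i) * v i))\<^sup>2))"
        unfolding extsum by (intro sum.cong refl) (simp add: c sum_list_const_mult)
      also have "\<dots> \<le> (\<Sum>r<R. w r * (real D * (\<Sum>v\<leftarrow>tvs. (cmod (\<Sum>i\<in>I. a (r, i) * v i))\<^sup>2)))"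
        by (intro sum_mono mult_left_mono us_dom[OF that] w(1))
      also have "\<dots> = real D * (\<Sum>v\<leftarrow>ext (\<lambda>_. tvs). (cmod (\<Sum>i\<in>S. a i * v i))\<^sup>2)"
        unfolding extsum sum_distrib_left by (intro sum.cong refl) (simp add: c sum_list_const_mult)
      finally show ?thesis .
    qed
    show "5 / 8 \<le> (\<Sum>v\<leftarrow>ext (\<lambda>r. us r x). Re (quad_form S (coinker (E y)) v))" if "x \<in> U" "x \<in> U \<and> y \<in> Y \<and> 2 / 3 \<le> acc x y" for x y
      using close[of x y] that unfolding abs_le_iff by simp
    show "(\<Sum>v\<leftarrow>ext (\<lambda>r. us r x). Re (quad_form S (coinker (E y)) v)) \<le> 3 / 8" if "x \<in> U" "x \<in> U \<and> y \<in> Y \<and> acc x y \<le> 1 / 3" for x y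
      using close[of x y] that unfolding abs_le_iff by simp
  qed simp
  also have "(\<Sum>v\<leftarrow>ext (\<lambda>_. tvs). norm2 S v) = real D"
    using tvs_norm w(2) by (simp add: extsum S_def norm2_coinvec finI w(1) sum_list_const_mult flip: sum_distrib_right)
  finally show ?thesis .
qed

section \<open>Query trees from dense sets of tables\<close>

lemma shatter_superset:
  assumes "shatter acc rej d X" "X \<subseteq> Z"
  shows "shatter acc rej d Z"
  using assms(1)
proof cases
  case (leaf x)
  then show ?thesis using assms(2) by (auto intro: shatter.leaf)
next
  case (node X0 X1 y d')
  show ?thesis unfolding node(1)
    by (rule shatter.node[of X0 _ X1 _ y]) (use node assms(2) in auto)
qed

text \<open>Union bound over the at most \<open>2 ^ card W\<close> sets of \<kappa> rows in which
  hits are prescribed. It serves twice: the targets are the cells queried before, and later the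
  symbols of one fixed answer.\<close>

lemma card_many_hits:
  fixes T :: "'a \<Rightarrow> nat set"
  assumes W: "finite W" and T: "\<And>l. l \<in> W \<Longrightarrow> card (T l \<inter> {..<M}) \<le> s"
  shows "card {g \<in> PiE W (\<lambda>_. {..<M}). \<kappa> \<le> card {l \<in> W. g l \<in> T l}} \<le> 2 ^ card W * (s ^ \<kappa> * M ^ (card W - \<kappa>))"
proof -
  define box where "box = (\<lambda>A. PiE W (\<lambda>l. if l \<in> A then T l \<inter> {..<M} else {..<M}))"
  define As where "As = {A. A \<subseteq> W \<and> card A = \<kappa>}"
  have finAs: "finite As" using W by (auto simp: As_def)
  have "{g \<in> PiE W (\<lambda>_. {..<M}). \<kappa> \<le> card {l \<in> W. g l \<in> T l}} \<subseteq> (\<Union>A\<in>As. box A)"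
  proof
    fix g assume g: "g \<in> {g \<in> PiE W (\<lambda>_. {..<M}). \<kappa> \<le> card {l \<in> W. g l \<in> T l}}"
    then obtain A where "A \<subseteq> {l \<in> W. g l \<in> T l}" "card A = \<kappa>"
      by (metis (no_types, lifting) mem_Collect_eq obtain_subset_with_card_n)
    then show "g \<in> (\<Union>A\<in>As. box A)"
      using g by (auto simp: As_def box_def PiE_iff intro!: bexI[of _ A])
  qed
  moreover have finbox: "finite (box A)" for A
    unfolding box_def using W by (intro finite_PiE) auto
  ultimately have "card {g \<in> PiE W (\<lambda>_. {..<M}). \<kappa> \<le> card {l \<in> W. g l \<in> T l}} \<le> card (\<Union>A\<in>As. box A)"
    using finAs by (intro card_mono) auto
  also have "\<dots> \<le> (\<Sum>A\<in>As. card (box A))" by (rule card_UN_le[OF finAs])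
  also have "\<dots> \<le> (\<Sum>A\<in>As. s ^ \<kappa> * M ^ (card W - \<kappa>))"
  proof (rule sum_mono)
    fix A assume A: "A \<in> As"
    have "card (box A) = (\<Prod>l\<in>W. if l \<in> A then card (T l \<inter> {..<M}) else M)"
      unfolding box_def card_PiE[OF W] by (intro prod.cong refl) auto
    also have "\<dots> \<le> (\<Prod>l\<in>W. if l \<in> A then s else M)"
      using T by (intro prod_mono) auto
    also have "\<dots> = s ^ card (W \<inter> A) * M ^ card (W - A)"
      using W by (simp add: prod.If_cases Diff_eq)
    also have "\<dots> = s ^ \<kappa> * M ^ (card W - \<kappa>)"
      using A W by (auto simp: As_def Int_absorb1 card_Diff_subset finite_subset)
    finally show "card (box A) \<le> s ^ \<kappa> * M ^ (card W - \<kappa>)" .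
  qed
  also have "\<dots> \<le> 2 ^ card W * (s ^ \<kappa> * M ^ (card W - \<kappa>))"
  proof -
    have "card As \<le> card (Pow W)" using W by (intro card_mono) (auto simp: As_def)
    then have "card As \<le> 2 ^ card W" by (simp add: card_Pow W)
    then show ?thesis by (simp add: mult_right_mono)
  qed
  finally show ?thesis .
qed

lemma card_agreeing_le:
  fixes q :: nat
  assumes P: "finite P" and X: "X \<subseteq> PiE P (\<lambda>_. {..<q})"
    and agree: "\<And>x y p. x \<in> X \<Longrightarrow> y \<in> X \<Longrightarrow> p \<in> P \<Longrightarrow> p \<notin> Q \<Longrightarrow> x p = y p" and "Q \<subseteq> P"
  shows "inj_on (\<lambda>x. restrict x Q) X" "card X \<le> q ^ card Q"
proof -
  show inj: "inj_on (\<lambda>x. restrict x Q) X"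
  proof (rule inj_onI)
    fix x y assume xy: "x \<in> X" "y \<in> X" "restrict x Q = restrict y Q"
    show "x = y"
    proof (rule PiE_ext[of _ P])
      show "x \<in> PiE P (\<lambda>_. {..<q})" "y \<in> PiE P (\<lambda>_. {..<q})" using X xy by auto
      fix p assume "p \<in> P"
      then show "x p = y p" using agree[OF xy(1,2), of p] xy(3) by (cases "p \<in> Q") (auto dest: fun_cong[of _ _ p])
    qed
  qed
  have finQ: "finite Q" using P assms(4) finite_subset by blast
  have "(\<lambda>x. restrict x Q) ` X \<subseteq> PiE Q (\<lambda>_. {..<q})"
    using X assms(4) by (auto simp: PiE_iff subset_iff)
  then have "card X \<le> card (PiE Q (\<lambda>_. {..<q}))"
    using inj finQ by (intro card_inj_on_le) (auto intro: finite_PiE)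
  then show "card X \<le> q ^ card Q" by (simp add: card_PiE finQ)
qed

definition read_cells :: "nat \<Rightarrow> (nat \<times> nat \<Rightarrow> nat) \<Rightarrow> (nat \<Rightarrow> nat) \<Rightarrow> nat \<Rightarrow> nat" where
  "read_cells k x I = (\<lambda>l\<in>{..<k}. x (l, I l))"

definition agreement :: "nat \<Rightarrow> (nat \<Rightarrow> nat) \<Rightarrow> (nat \<Rightarrow> nat) \<Rightarrow> nat" where
  "agreement k v v' = card {l \<in> {..<k}. v l = v' l}"

text \<open>The constants are such that a random choice from at least 256 options in each of \<open>6 * N\<close> rows
  hits one given option per row in \<open>N\<close> rows with probability at most \<open>2 ^ (6 * N) / 256 ^ N = 1 / 4 ^ N\<close>.\<close>

abbreviation words :: "nat \<Rightarrow> (nat \<times> nat \<Rightarrow> nat) set" where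
  "words N \<equiv> PiE ({..<6 * N} \<times> {..<256 * N}) (\<lambda>_. {..<256})"

abbreviation columns :: "nat \<Rightarrow> (nat \<Rightarrow> nat) set" where
  "columns N \<equiv> PiE {..<6 * N} (\<lambda>_. {..<256 * N})"

text \<open>A set of inputs that has density \<open>\<delta>\<close> in the subcube given by the queried cells \<open>U\<close> either
  splits into two far apart dense fibres over a new query, which gives a node of the tree, or it
  concentrates on few fibres, one of which then has density at least \<open>2 ^ N * \<delta>\<close>.\<close>

lemma build_tree:
  fixes N :: nat and A :: real and G :: "(nat \<times> nat \<Rightarrow> nat) \<Rightarrow> (nat \<Rightarrow> nat) set"
  defines "B \<equiv> 2 ^ N :: real"
  assumes A: "1 \<le> A" "4 * A \<le> B"
    and G: "\<And>x. G x \<subseteq> columns N"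
    and acc: "\<And>x I. x \<in> words N \<Longrightarrow> I \<in> G x \<Longrightarrow> acc x (I, read_cells (6 * N) x I)"
    and rej: "\<And>x x' I. x \<in> words N \<Longrightarrow> x' \<in> words N \<Longrightarrow> I \<in> columns N \<Longrightarrow>
      3 * agreement (6 * N) (read_cells (6 * N) x I) (read_cells (6 * N) x' I) \<le> 6 * N \<Longrightarrow> rej x (I, read_cells (6 * N) x' I)"
  shows "X \<subseteq> words N \<Longrightarrow> U \<subseteq> {..<6 * N} \<times> {..<256 * N} \<Longrightarrow>
    (\<And>x y p. x \<in> X \<Longrightarrow> y \<in> X \<Longrightarrow> p \<in> U \<Longrightarrow> x p = y p) \<Longrightarrow>
    (\<And>x. x \<in> X \<Longrightarrow> real (card (columns N)) \<le> A * real (card (G x))) \<Longrightarrow>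
    (\<And>l. l < 6 * N \<Longrightarrow> card {i. (l, i) \<in> U} \<le> N - n) \<Longrightarrow> n \<le> N \<Longrightarrow> \<delta> > 0 \<Longrightarrow>
    \<delta> * 256 ^ card ({..<6 * N} \<times> {..<256 * N} - U) \<le> real (card X) \<Longrightarrow>
    (4 * A * B) ^ d \<le> \<delta> * B ^ n \<Longrightarrow> shatter acc rej d X"
\<comment> \<open>The quantity \<open>\<delta> * B ^ n\<close> is a potential, with \<open>n\<close>
  the number of rounds left. A node lowers it by the factor \<open>4 * A * B\<close>. A round
  without a node uses up one \<open>B\<close> but multiplies the density by
  \<open>B\<^sup>2 / (4 * A)\<close>, which is at least \<open>B\<close>. When no rounds are left,
  the density is at most 1 and the potential admits only \<open>d = 0\<close>.\<close>
proof (induction n arbitrary: d U X \<delta>)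
  case 0
  define P where "P = {..<6 * N} \<times> {..<256 * N}"
  have "card X \<le> 256 ^ card (P - U)"
    using 0(1-3) by (intro card_agreeing_le(2)[of P]) (auto simp: P_def)
  then have "real (card X) \<le> 256 ^ card (P - U)"
    by (metis of_nat_le_iff of_nat_numeral of_nat_power)
  then have "\<delta> * 256 ^ card (P - U) \<le> 1 * 256 ^ card (P - U)" using 0(8) unfolding P_def by linarith
  then have "\<delta> \<le> 1" by (simp only: mult_le_cancel_right) simp
  have "d = 0"
  proof (rule ccontr)
    assume "d \<noteq> 0"
    have "4 * 1 * 1 \<le> 4 * A * B" using A by (intro mult_mono) (auto simp: B_def)
    then have "1 < 4 * A * B" by simp
    then have "1 < (4 * A * B) ^ d" using \<open>d \<noteq> 0\<close> by (simp add: one_less_power)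
    then show False using 0(9) \<open>\<delta> \<le> 1\<close> by simp
  qed
  moreover have "0 < \<delta> * 256 ^ card (P - U)" using 0(7) by simp
  then have "X \<noteq> {}" using 0(8) unfolding P_def by auto
  ultimately show ?case by (auto intro: shatter.leaf)
next
  case (Suc n)
  note prems = Suc.prems
  show ?case
  proof (cases d)
    case 0
    have "0 < \<delta> * 256 ^ card ({..<6 * N} \<times> {..<256 * N} - U)" using prems(7) by simp
    then have "X \<noteq> {}" using prems(8) by auto
    then show ?thesis using 0 by (auto intro: shatter.leaf)
  next
    case (Suc d')
    define P where "P = {..<6 * N} \<times> {..<256 * N}"
    define k where "k = 6 * N"
    have finP: "finite P" by (simp add: P_def)
    have finX: "finite X"
      using prems(1) by (rule finite_subset) (auto intro: finite_PiE)
    have finF: "finite (columns N)" by (auto intro: finite_PiE)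
    have N: "N \<ge> 1" using prems(6) by simp
    have B1: "1 \<le> B" by (simp add: B_def)
    define F where "F = real (card (columns N))"
    have F: "F = real (256 * N) ^ (6 * N)" by (simp add: F_def card_PiE)
    have F0: "F > 0" using N by (simp add: F)
    \<comment> \<open>Column choices that repeat many queried cells. They are at most a
      \<open>1 / B\<^sup>2\<close> fraction, so removing them costs at most half of every
      \<open>G x\<close>, and every other choice reads a new cell in more than \<open>5 * N\<close>
      rows.\<close>
    define Bad where "Bad = {I \<in> columns N. N \<le> card {l \<in> {..<6 * N}. I l \<in> {i. (l, i) \<in> U}}}"
    have BadF: "real (card Bad) * B\<^sup>2 \<le> F"
    proof -
      have "card Bad \<le> 2 ^ card {..<6 * N} * (N ^ N * (256 * N) ^ (card {..<6 * N} - N))"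
        unfolding Bad_def
      proof (rule card_many_hits)
        fix l assume "l \<in> {..<6 * N}"
        then have "card {i. (l, i) \<in> U} \<le> N" using prems(5)[of l] by simp
        moreover have "finite {i. (l, i) \<in> U}"
          using prems(2) by (rule_tac finite_subset[of _ "{..<256 * N}"]) auto
        then have "card ({i. (l, i) \<in> U} \<inter> {..<256 * N}) \<le> card {i. (l, i) \<in> U}"
          by (intro card_mono) auto
        ultimately show "card ({i. (l, i) \<in> U} \<inter> {..<256 * N}) \<le> N" by simp
      qed simp
      then have "real (card Bad) \<le> real (2 ^ card {..<6 * N} * (N ^ N * (256 * N) ^ (card {..<6 * N} - N)))"
        by (rule of_nat_mono)
      then have "real (card Bad) \<le> 2 ^ (6 * N) * (real N ^ N * real (256 * N) ^ (5 * N))"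
        by simp
      then have "real (card Bad) * B\<^sup>2 \<le> 2 ^ (6 * N) * (real N ^ N * real (256 * N) ^ (5 * N)) * B\<^sup>2"
        by (intro mult_right_mono) auto
      also have "\<dots> = (2 ^ (6 * N) * B\<^sup>2 * real N ^ N) * real (256 * N) ^ (5 * N)" by (simp only: mult_ac)
      also have "\<dots> = real (256 * N) ^ N * real (256 * N) ^ (5 * N)"
      proof -
        have "2 ^ (6 * N) * B\<^sup>2 = (2 :: real) ^ (8 * N)"
          by (simp add: B_def flip: power_mult power_add)
        also have "\<dots> = 256 ^ N" by (simp add: power_mult)
        finally show ?thesis by (simp add: power_mult_distrib)
      qed
      also have "\<dots> = F"
        unfolding F power_add[symmetric] by simp
      finally show ?thesis .
    qed
    have good: "F / (2 * A) \<le> real (card (G x - Bad))" if "x \<in> X" for x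
    proof -
      have "F / A \<le> real (card (G x))" using prems(4)[OF that] A by (simp add: F_def field_simps)
      moreover have "real (card (G x)) \<le> real (card (G x - Bad)) + real (card Bad)"
      proof -
        have "card (G x) \<le> card ((G x - Bad) \<union> Bad)"
          using G[of x] finF by (intro card_mono) (auto intro: finite_subset simp: Bad_def)
        also have "\<dots> \<le> card (G x - Bad) + card Bad" by (rule card_Un_le)
        finally show ?thesis by simp
      qed
      moreover have "real (card Bad) \<le> F / (2 * A)"
      proof -
        have "2 * A \<le> B * 1" using A by simp
        also have "\<dots> \<le> B * B" using B1 by (intro mult_left_mono) auto
        finally have "real (card Bad) * (2 * A) \<le> real (card Bad) * B\<^sup>2"
          by (intro mult_left_mono) (auto simp: power2_eq_square)
        then show ?thesis using BadF A by (simp add: field_simps)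
      qed
      ultimately show ?thesis by (simp add: field_simps)
    qed
    \<comment> \<open>Averaging: every table of \<open>X\<close> has at least a
      \<open>1 / (2 * A)\<close> fraction of all column choices in \<open>G x - Bad\<close>, so some
      choice outside \<open>Bad\<close> is good for that fraction of \<open>X\<close>.\<close>
    obtain I where I: "I \<in> columns N" "I \<notin> Bad" and XI: "real (card X) \<le> 2 * A * real (card {x \<in> X. I \<in> G x})"
    proof (rule ccontr)
      assume "\<not> thesis"
      with that have lt: "2 * A * real (card {x \<in> X. I \<in> G x}) < real (card X)" if "I \<in> columns N - Bad" for I
        using that by force
      have "(\<Sum>x\<in>X. card (G x - Bad)) = (\<Sum>x\<in>X. card {I \<in> columns N - Bad. I \<in> G x})"
        using G by (intro sum.cong refl arg_cong[where f = card]) auto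
      also have "\<dots> = (\<Sum>I\<in>columns N - Bad. card {x \<in> X. I \<in> G x})"
        by (rule sum_multicount_gen[symmetric]) (use finX finF in auto)
      finally have eq: "(\<Sum>x\<in>X. card (G x - Bad)) = (\<Sum>I\<in>columns N - Bad. card {x \<in> X. I \<in> G x})" .
      have "0 < \<delta> * 256 ^ card ({..<6 * N} \<times> {..<256 * N} - U)" using prems(7) by simp
      then have Xpos: "real (card X) > 0" using prems(8) by linarith
      have "real (card X) * F = 2 * A * (\<Sum>x\<in>X. F / (2 * A))" using A by simp
      also have "\<dots> \<le> 2 * A * (\<Sum>x\<in>X. real (card (G x - Bad)))"
        using A good by (intro mult_left_mono sum_mono) auto
      also have "\<dots> = (\<Sum>I\<in>columns N - Bad. 2 * A * real (card {x \<in> X. I \<in> G x}))"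
        using eq by (simp flip: of_nat_sum sum_distrib_left)
      also have "\<dots> < real (card X) * F"
      proof (cases "columns N - Bad = {}")
        case True
        then show ?thesis unfolding True using Xpos F0 by simp
      next
        case False
        have "(\<Sum>I\<in>columns N - Bad. 2 * A * real (card {x \<in> X. I \<in> G x})) < (\<Sum>I\<in>columns N - Bad. real (card X))"
          using False finF by (intro sum_strict_mono lt) auto
        also have "\<dots> = real (card X) * real (card (columns N - Bad))" by (simp only: sum_constant mult.commute)
        also have "\<dots> \<le> real (card X) * F"
          unfolding F_def using finF by (intro mult_left_mono of_nat_mono card_mono) auto
        finally show ?thesis .
      qed
      finally show False by simp
    qed
    define X1 where "X1 = {x \<in> X. I \<in> G x}"
    define W where "W = {l \<in> {..<k}. (l, I l) \<notin> U}"
    define U' where "U' = U \<union> (\<lambda>l. (l, I l)) ` {..<k}"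
    define c where "c = card (P - U')"
    define fib where "fib = (\<lambda>v. {x \<in> X1. read_cells k x I = v})"
    \<comment> \<open>The size of a fibre of density \<open>\<delta> / (4 * A)\<close>. The at most
      \<open>256 ^ card W\<close> fibres share \<open>2 * \<theta> * 256 ^ card W\<close> tables, so
      those smaller than \<theta> contain at most half of this number.\<close>
    define \<theta> where "\<theta> = \<delta> / (4 * A) * 256 ^ c"
    have \<theta>0: "\<theta> > 0" using prems(7) A by (simp add: \<theta>_def)
    have Il: "I l < 256 * N" if "l < k" for l using I(1) that by (auto simp: k_def PiE_iff)
    have finW: "finite W" by (simp add: W_def)
    have cardW: "card ({..<k} - W) < N" "card W \<le> 6 * N"
    proof -
      have "{..<k} - W = {l \<in> {..<6 * N}. I l \<in> {i. (l, i) \<in> U}}" by (auto simp: W_def k_def)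
      then show "card ({..<k} - W) < N" using I by (auto simp: Bad_def)
      have "card W \<le> card {..<k}" by (intro card_mono) (auto simp: W_def)
      then show "card W \<le> 6 * N" by (simp add: k_def)
    qed
    have cardW5: "N \<le> card W"
    proof -
      have "card ({..<k} - W) = k - card W"
        using finW by (subst card_Diff_subset) (auto simp: W_def)
      then show ?thesis using cardW N unfolding k_def by linarith
    qed
    have cPU: "card (P - U) = c + card W"
    proof -
      have "P - U = (P - U') \<union> (\<lambda>l. (l, I l)) ` W"
        using Il by (auto simp: U'_def W_def P_def k_def)
      moreover have "(P - U') \<inter> (\<lambda>l. (l, I l)) ` W = {}" by (auto simp: U'_def W_def)
      moreover have "card ((\<lambda>l. (l, I l)) ` W) = card W" by (intro card_image) (auto simp: inj_on_def)
      ultimately show ?thesis using finP finW by (simp add: c_def card_Un_disjoint)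
    qed
    have X1X: "X1 \<subseteq> X" by (auto simp: X1_def)
    have finX1: "finite X1" using finX X1X finite_subset by blast
    have X1big: "2 * \<theta> * 256 ^ card W \<le> real (card X1)"
    proof -
      have "\<delta> * 256 ^ (c + card W) \<le> 2 * A * real (card X1)"
        using prems(8) XI by (simp add: cPU[unfolded P_def] X1_def)
      then show ?thesis using A by (simp add: \<theta>_def power_add field_simps)
    qed
    define V1 where "V1 = (\<lambda>x. read_cells k x I) ` X1"
    have V1: "V1 \<subseteq> PiE {..<k} (\<lambda>_. {..<256})"
    proof
      fix v assume "v \<in> V1"
      then obtain x where x: "x \<in> words N" and v: "v = read_cells k x I"
        using prems(1) X1X unfolding V1_def by blast
      have "x (l, I l) \<in> {..<256}" if "l < k" for l
        by (rule PiE_mem[OF x]) (use that Il in \<open>simp add: k_def\<close>)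
      then show "v \<in> PiE {..<k} (\<lambda>_. {..<256})" by (auto simp: v read_cells_def)
    qed
    have V1agree: "v l = v' l" if h: "v \<in> V1" "v' \<in> V1" "l \<in> {..<k}" "l \<notin> W" for v v' l
    proof -
      obtain x x' where x: "x \<in> X" "x' \<in> X" and v: "v = read_cells k x I" "v' = read_cells k x' I"
        using h(1,2) X1X unfolding V1_def by blast
      have "(l, I l) \<in> U" using h(3,4) by (simp add: W_def)
      then show ?thesis using prems(3)[OF x] h(3) by (simp add: v read_cells_def)
    qed
    have finV1: "finite V1" by (simp add: V1_def finX1)
    have WK: "W \<subseteq> {..<k}" by (auto simp: W_def)
    have V1W: "inj_on (\<lambda>v. restrict v W) V1" "card V1 \<le> 256 ^ card W"
      by (rule card_agreeing_le[where P = "{..<k}"], simp, rule V1, rule V1agree, assumption+, rule WK)+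
    have V1card: "real (card V1) \<le> 256 ^ card W"
      using of_nat_mono[OF V1W(2), where ?'a = real] by simp
    have fibsum: "card X1 = (\<Sum>v\<in>V1. card (fib v))"
    proof -
      have "card X1 = card (\<Union>v\<in>V1. fib v)" by (rule arg_cong[where f = card]) (auto simp: V1_def fib_def)
      also have "\<dots> = (\<Sum>v\<in>V1. card (fib v))"
        using finX1 finV1 by (intro card_UN_disjoint) (auto simp: fib_def)
      finally show ?thesis .
    qed
    define H where "H = {v \<in> V1. \<theta> \<le> real (card (fib v))}"
    have IH: "shatter acc rej d'' (fib v)"
      if "\<delta>' > 0" "\<delta>' * 256 ^ c \<le> real (card (fib v))" "(4 * A * B) ^ d'' \<le> \<delta>' * B ^ n" for \<delta>' v d''
    proof (rule Suc.IH[where U = U' and \<delta> = \<delta>'])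
      show "fib v \<subseteq> words N" using prems(1) X1X by (auto simp: fib_def)
      show "U' \<subseteq> {..<6 * N} \<times> {..<256 * N}" using prems(2) Il by (auto simp: U'_def k_def)
      show "x p = y p" if h: "x \<in> fib v" "y \<in> fib v" "p \<in> U'" for x y p
      proof (cases "p \<in> U")
        case True
        then show ?thesis using h X1X by (intro prems(3)) (auto simp: fib_def)
      next
        case False
        then obtain l where "l < k" "p = (l, I l)" using h by (auto simp: U'_def)
        moreover have "read_cells k x I = read_cells k y I" using h by (simp add: fib_def)
        ultimately show ?thesis by (auto simp: read_cells_def dest: fun_cong[of _ _ l])
      qed
      show "real (card (columns N)) \<le> A * real (card (G x))" if "x \<in> fib v" for x
        using prems(4)[of x] that X1X by (auto simp: fib_def)
      show "card {i. (l, i) \<in> U'} \<le> N - n" if "l < 6 * N" for l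
      proof -
        have "finite {i. (l, i) \<in> U}"
          using prems(2) by (rule_tac finite_subset[of _ "{..<256 * N}"]) auto
        then have "card {i. (l, i) \<in> U'} \<le> card (insert (I l) {i. (l, i) \<in> U})"
          by (intro card_mono) (auto simp: U'_def)
        also have "\<dots> \<le> Suc (N - Suc n)" using prems(5)[OF that] by (rule_tac le_trans[OF card_insert_le_m1]) (auto simp: card_insert_if \<open>finite {i. (l, i) \<in> U}\<close>)
        also have "\<dots> = N - n" using prems(6) by simp
        finally show ?thesis .
      qed
      show "n \<le> N" using prems(6) by simp
    qed (use that in \<open>auto simp: c_def P_def\<close>)
    show ?thesis
    proof (cases "\<exists>v0\<in>H. \<exists>v1\<in>H. 3 * agreement k v1 v0 \<le> k")
      case True
      then obtain v0 v1 where v: "v0 \<in> H" "v1 \<in> H" "3 * agreement k v1 v0 \<le> k" by blast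
      have sh: "shatter acc rej d' (fib v)" if "v \<in> H" for v
      proof (rule IH[of "\<delta> / (4 * A)"])
        show "\<delta> / (4 * A) * 256 ^ c \<le> real (card (fib v))" using that by (simp add: H_def \<theta>_def)
        have "(4 * A * B) * (4 * A * B) ^ d' \<le> \<delta> * (B * B ^ n)" using prems(9) by (simp add: Suc)
        then have "B * (4 * A * (4 * A * B) ^ d') \<le> B * (\<delta> * B ^ n)" by (simp only: mult_ac)
        then show "(4 * A * B) ^ d' \<le> \<delta> / (4 * A) * B ^ n"
          using A B1 by (simp add: field_simps)
      qed (use prems(7) A in simp)
      obtain x0 where x0: "x0 \<in> X1" "v0 = read_cells k x0 I" using v(1) by (auto simp: H_def V1_def)
      show ?thesis unfolding Suc
      \<comment> \<open>Bob's claims are the answers \<open>v0\<close>: they are true for the tables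
        of \<open>fib v0\<close>, and at most a third of them are true for those of
        \<open>fib v1\<close>.\<close>
      proof (rule shatter.node[of "fib v0" _ "fib v1" _ "(I, v0)"])
        show "acc x (I, v0)" if "x \<in> fib v0" for x
          using acc[of x I] that prems(1) by (auto simp: fib_def X1_def k_def)
        show "rej x (I, v0)" if "x \<in> fib v1" for x
          using rej[of x x0 I] that prems(1) v(3) x0 I(1) by (auto simp: fib_def X1_def k_def)
      qed (use sh v X1X in \<open>auto simp: fib_def\<close>)
    next
      case False
      have Hsum: "\<theta> * 256 ^ card W \<le> (\<Sum>v\<in>H. real (card (fib v)))"
      proof -
        have "real (card X1) = (\<Sum>v\<in>H. real (card (fib v))) + (\<Sum>v\<in>V1 - H. real (card (fib v)))"
          using finV1 unfolding fibsum of_nat_sum by (subst sum.subset_diff[of H V1]) (auto simp: H_def)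
        also have "(\<Sum>v\<in>V1 - H. real (card (fib v))) \<le> (\<Sum>v\<in>V1 - H. \<theta>)"
          by (intro sum_mono) (auto simp: H_def)
        also have "\<dots> \<le> real (card V1) * \<theta>"
          using finV1 \<theta>0 by (simp add: card_mono)
        also have "\<dots> \<le> 256 ^ card W * \<theta>" using V1card \<theta>0 by (intro mult_right_mono) auto
        finally show ?thesis using X1big by (simp add: mult.commute mult.left_commute)
      qed
      moreover have "0 < \<theta> * 256 ^ card W" using \<theta>0 by simp
      ultimately have "H \<noteq> {}" by auto
      then obtain v0 where v0: "v0 \<in> H" by blast
      have HV: "H \<subseteq> V1" by (auto simp: H_def)
      have finH: "finite H" using HV finV1 finite_subset by blast
      \<comment> \<open>Any two heavy answers agree in more than \<open>2 * N\<close> rows, and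
        fewer than \<open>N\<close> of these are rows whose cell was known. So all of
        \<open>H\<close> agrees with \<open>v0\<close> in at least \<open>N\<close> new rows, which
        leaves at most a \<open>1 / B\<^sup>2\<close> fraction of the possible answers.\<close>
      have Hcard: "real (card H) * B\<^sup>2 \<le> 256 ^ card W"
      proof -
        have "inj_on (\<lambda>v. restrict v W) H" using V1W(1) HV by (rule inj_on_subset)
        then have "card H \<le> card {g \<in> PiE W (\<lambda>_. {..<256}). N \<le> card {l \<in> W. g l \<in> {v0 l}}}"
        proof (rule card_inj_on_le)
          show "finite {g \<in> PiE W (\<lambda>_. {..<256::nat}). N \<le> card {l \<in> W. g l \<in> {v0 l}}}"
            by (rule finite_subset[of _ "PiE W (\<lambda>_. {..<256})"]) (auto intro: finite_PiE finW)
          show "(\<lambda>v. restrict v W) ` H \<subseteq> {g \<in> PiE W (\<lambda>_. {..<256}). N \<le> card {l \<in> W. g l \<in> {v0 l}}}"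
          proof (intro image_subsetI CollectI conjI)
            fix v assume v: "v \<in> H"
            show "restrict v W \<in> PiE W (\<lambda>_. {..<256})"
              using V1 HV v by (auto simp: W_def PiE_iff subset_iff)
            have "{l \<in> {..<k}. v l = v0 l} \<subseteq> {l \<in> W. restrict v W l \<in> {v0 l}} \<union> ({..<k} - W)" by auto
            then have "agreement k v v0 \<le> card ({l \<in> W. restrict v W l \<in> {v0 l}} \<union> ({..<k} - W))"
              unfolding agreement_def using finW by (intro card_mono) auto
            also have "\<dots> \<le> card {l \<in> W. restrict v W l \<in> {v0 l}} + card ({..<k} - W)" by (rule card_Un_le)
            finally have "agreement k v v0 \<le> card {l \<in> W. restrict v W l \<in> {v0 l}} + card ({..<k} - W)" .
            moreover have "\<not> 3 * agreement k v v0 \<le> 6 * N" using False v v0 by (auto simp: k_def)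
            ultimately show "N \<le> card {l \<in> W. restrict v W l \<in> {v0 l}}"
              using cardW(1) by linarith
          qed
        qed
        also have "\<dots> \<le> 2 ^ card W * (1 ^ N * 256 ^ (card W - N))"
          by (rule card_many_hits[OF finW]) (simp add: Int_insert_left)
        finally have "real (card H) \<le> real (2 ^ card W * (1 ^ N * 256 ^ (card W - N)))"
          by (rule of_nat_mono)
        then have "real (card H) \<le> 2 ^ card W * 256 ^ (card W - N)" by simp
        also have "\<dots> \<le> 2 ^ (6 * N) * 256 ^ (card W - N)"
          using cardW(2) by (intro mult_right_mono power_increasing) auto
        finally have "real (card H) * B\<^sup>2 \<le> 2 ^ (6 * N) * 256 ^ (card W - N) * B\<^sup>2"
          by (intro mult_right_mono) auto
        also have "\<dots> = 2 ^ (8 * N) * 256 ^ (card W - N)"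
          by (simp add: B_def flip: power_mult power_add)
        also have "\<dots> = 256 ^ (N + (card W - N))" by (simp add: power_mult power_add)
        finally show ?thesis using cardW5 by simp
      qed
      obtain v where v: "v \<in> H" "\<theta> * B\<^sup>2 \<le> real (card (fib v))"
      proof (rule ccontr)
        assume "\<not> thesis"
        then have "(\<Sum>v\<in>H. real (card (fib v))) < (\<Sum>v\<in>H. \<theta> * B\<^sup>2)"
          using that finH \<open>H \<noteq> {}\<close> by (intro sum_strict_mono) (auto simp: not_le[symmetric])
        also have "\<dots> = \<theta> * (real (card H) * B\<^sup>2)" by simp
        also have "\<dots> \<le> \<theta> * 256 ^ card W" using Hcard \<theta>0 by (intro mult_left_mono) auto
        finally show False using Hsum by simp
      qed
      have "shatter acc rej d (fib v)"
      proof (rule IH[of "\<delta> / (4 * A) * B\<^sup>2"])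
        show "\<delta> / (4 * A) * B\<^sup>2 > 0" using prems(7) A B1 by simp
        show "\<delta> / (4 * A) * B\<^sup>2 * 256 ^ c \<le> real (card (fib v))"
          using v(2) by (simp add: \<theta>_def mult_ac)
        have "B * (4 * A) \<le> B * B" using A B1 by (intro mult_left_mono) auto
        then have "B \<le> B\<^sup>2 / (4 * A)" using A by (simp add: field_simps power2_eq_square)
        then have "\<delta> * B ^ n * B \<le> \<delta> * B ^ n * (B\<^sup>2 / (4 * A))"
          using prems(7) B1 by (intro mult_left_mono) auto
        then show "(4 * A * B) ^ d \<le> \<delta> / (4 * A) * B\<^sup>2 * B ^ n"
          using prems(9) by (simp add: mult_ac)
      qed
      then show ?thesis
        by (rule shatter_superset) (use X1X in \<open>auto simp: fib_def\<close>)
    qed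
  qed
qed

section \<open>The quantum proof\<close>

lemma positive_op_iff_psd: "positive_op d A \<longleftrightarrow> A \<in> carrier_mat d d \<and> psd {..<d} (kernel A)"
proof
  assume "A \<in> carrier_mat d d \<and> psd {..<d} (kernel A)"
  then have A: "A \<in> carrier_mat d d" and p: "psd {..<d} (kernel A)" by auto
  have "(A *\<^sub>v v) \<bullet>c v = quad_form {..<d} (kernel A) (vec_index v)" if "v \<in> carrier_vec d" for v
    using that A by (simp add: scalar_prod_def sum_distrib_right atLeast0LessThan quad_form_def kernel_def sum_distrib_left mult_ac)
  then show "positive_op d A" using A p by (auto simp: positive_op_def psd_def)
qed (auto simp: psd_kernel positive_op_def)

text \<open>For nonempty \<open>T\<close> inside the range, the projection onto the uniform
  superposition of the basis states in \<open>T\<close>. Having rank one and trace 1, it serves both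
  as Merlin's state and as Bob's measurement.\<close>

definition uproj :: "nat \<Rightarrow> nat set \<Rightarrow> complex mat" where
  "uproj d T = mat d d (\<lambda>(i, j). if i \<in> T \<and> j \<in> T then of_real (1 / real (card T)) else 0)"

lemma quad_uproj:
  assumes "T \<subseteq> {..<d}"
  shows "quad_form {..<d} (kernel (uproj d T)) u = of_real ((cmod (\<Sum>i\<in>T. u i))\<^sup>2 / real (card T))"
proof -
  have fin: "finite T" using assms finite_subset by blast
  have "quad_form {..<d} (kernel (uproj d T)) u =
     (\<Sum>i<d. \<Sum>j<d. if i \<in> T then (if j \<in> T then cnj (u i) * u j * of_real (1 / real (card T)) else 0) else 0)"
    unfolding quad_form_def by (intro sum.cong refl) (auto simp: kernel_def uproj_def)
  also have "\<dots> = (\<Sum>i<d. if i \<in> T then (\<Sum>j<d. if j \<in> T then cnj (u i) * u j * of_real (1 / real (card T)) else 0) else 0)"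
    by (intro sum.cong refl) auto
  also have "\<dots> = (\<Sum>i\<in>T. \<Sum>j\<in>T. cnj (u i) * u j * of_real (1 / real (card T)))"
  proof -
    have sub: "(\<Sum>i<d. if i \<in> T then h i else 0) = (\<Sum>i\<in>T. h i)" for h :: "nat \<Rightarrow> complex"
      using assms by (subst sum.inter_restrict[symmetric]) (auto intro: sum.cong)
    show ?thesis unfolding sub ..
  qed
  also have "\<dots> = (cnj (\<Sum>i\<in>T. u i) * (\<Sum>i\<in>T. u i)) * of_real (1 / real (card T))"
    by (subst cnj_sum, subst sum_product) (simp only: sum_distrib_right)
  also have "cnj (\<Sum>i\<in>T. u i) * (\<Sum>i\<in>T. u i) = of_real ((cmod (\<Sum>i\<in>T. u i))\<^sup>2)"
    unfolding complex_norm_square by (simp only: mult.commute)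
  finally show ?thesis by (simp only: of_real_mult[symmetric]) simp
qed

lemma uproj_carrier: "uproj d T \<in> carrier_mat d d"
  by (simp add: uproj_def)

lemma positive_uproj: "T \<subseteq> {..<d} \<Longrightarrow> positive_op d (uproj d T)"
  unfolding positive_op_iff_psd psd_def by (auto simp: quad_uproj uproj_carrier less_eq_complex_def)

lemma effect_uproj:
  assumes T: "T \<subseteq> {..<d}" "T \<noteq> {}"
  shows "effect d (uproj d T)"
proof -
  have fin: "finite T" using T(1) finite_subset by blast
  have le: "(cmod (\<Sum>i\<in>T. u i))\<^sup>2 / real (card T) \<le> norm2 {..<d} u" for u
  proof -
    have "(cmod (\<Sum>i\<in>T. u i))\<^sup>2 / real (card T) \<le> (\<Sum>i\<in>T. (cmod (u i))\<^sup>2)"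
      using cmod_sum_square_le_card[of u T] T(2) fin by (simp add: divide_le_eq card_gt_0_iff mult.commute)
    also have "\<dots> \<le> norm2 {..<d} u" unfolding norm2_def using T by (intro sum_mono2) auto
    finally show ?thesis .
  qed
  have "psd {..<d} (\<lambda>i j. id_kernel i j - kernel (uproj d T) i j)"
    unfolding psd_def
  proof
    fix u
    have "quad_form {..<d} (\<lambda>i j. id_kernel i j - kernel (uproj d T) i j) u =
        of_real (norm2 {..<d} u - (cmod (\<Sum>i\<in>T. u i))\<^sup>2 / real (card T))"
      using quad_add_kernel[of "{..<d}" "\<lambda>i j. id_kernel i j - kernel (uproj d T) i j" "kernel (uproj d T)" u]
      by (simp add: quad_idk quad_uproj[OF T(1)])
    then show "0 \<le> quad_form {..<d} (\<lambda>i j. id_kernel i j - kernel (uproj d T) i j) u"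
      using le[of u] by (simp add: less_eq_complex_def)
  qed
  moreover have "psd {..<d} (kernel (1\<^sub>m d - uproj d T)) \<longleftrightarrow> psd {..<d} (\<lambda>i j. id_kernel i j - kernel (uproj d T) i j)"
    by (intro psd_cong) (auto simp: kernel_def id_kernel_def uproj_def)
  ultimately show ?thesis
    unfolding effect_def using positive_uproj[OF T(1)] by (auto simp: positive_op_iff_psd uproj_def)
qed

lemma density_uproj:
  assumes T: "T \<subseteq> {..<d}" "T \<noteq> {}"
  shows "density_op d (uproj d T)"
proof -
  have fin: "finite T" using T(1) finite_subset by blast
  have "mat_trace (uproj d T) = (\<Sum>i<d. if i \<in> T then of_real (1 / real (card T)) else 0)"
    by (simp add: mat_trace_def uproj_def)
  also have "\<dots> = (\<Sum>i\<in>T. of_real (1 / real (card T)))"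
    using T(1) by (subst sum.inter_restrict[symmetric]) (auto simp: Int_absorb1)
  also have "\<dots> = 1" using fin T(2) by simp
  finally show ?thesis using positive_uproj[OF T(1)] by (simp add: density_op_def)
qed

text \<open>The basis state \<open>j * 256 + s\<close> stands for the position \<open>j\<close> together with the symbol \<open>s\<close>.\<close>

definition append_sym :: "nat \<Rightarrow> (nat \<Rightarrow> nat) \<Rightarrow> complex mat" where
  "append_sym d sy = mat (d * 256) d (\<lambda>(i, j). if i = j * 256 + sy j then 1 else 0)"

lemma append_sym_lt: "j < d \<Longrightarrow> s < 256 \<Longrightarrow> j * 256 + s < d * (256 :: nat)"
  by linarith

lemma append_sym_inj:
  assumes "s < 256" "s' < (256 :: nat)"
  shows "j * 256 + s = j' * 256 + s' \<longleftrightarrow> j = j' \<and> s = s'"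
proof -
  have "(j * 256 + s) div 256 = j" "(j * 256 + s) mod 256 = s"
    "(j' * 256 + s') div 256 = j'" "(j' * 256 + s') mod 256 = s'"
    using assms by simp_all
  then show ?thesis by metis
qed

lemma channel_append_sym:
  assumes sy: "\<And>j. sy j < 256"
  shows "channel d (d * 256) [append_sym d sy]"
proof -
  have K: "append_sym d sy \<in> carrier_mat (d * 256) d" by (simp add: append_sym_def)
  have "mat_adjoint (append_sym d sy) * append_sym d sy = 1\<^sub>m d"
  proof (rule eq_matI)
    fix a b assume "a < dim_row (1\<^sub>m d :: complex mat)" "b < dim_col (1\<^sub>m d :: complex mat)"
    then have ab: "a < d" "b < d" by auto
    have ent: "append_sym d sy $$ (i, c) = (if i = c * 256 + sy c then 1 else 0)" if "i < d * 256" "c < d" for i c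
      using that by (simp add: append_sym_def)
    have "(mat_adjoint (append_sym d sy) * append_sym d sy) $$ (a, b) =
       (\<Sum>i<d * 256. if i = a * 256 + sy a then (if a = b then 1 else 0) else 0)"
      unfolding mult_index[OF adjoint_index(1)[OF K] K ab]
    proof (intro sum.cong refl)
      fix i assume "i \<in> {..<d * 256}"
      then have i: "i < d * 256" by simp
      show "mat_adjoint (append_sym d sy) $$ (a, i) * append_sym d sy $$ (i, b) =
          (if i = a * 256 + sy a then (if a = b then 1 else 0) else 0)"
        unfolding adjoint_index(2)[OF K ab(1) i] ent[OF i ab(1)] ent[OF i ab(2)]
        using append_sym_inj[OF sy sy, of a a b b] by auto
    qed
    then show "(mat_adjoint (append_sym d sy) * append_sym d sy) $$ (a, b) = 1\<^sub>m d $$ (a, b)"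
      using ab append_sym_lt[OF ab(1) sy[of a]] by simp
  qed (use K adjoint_index(1)[OF K] in auto)
  then show ?thesis using K by (simp add: channel_def sum_mats_def)
qed

lemma kmap_append_sym:
  assumes "\<And>j. sy j < 256" "j < d" "s < 256"
  shows "apply_mat d (append_sym d sy) g (j * 256 + s) = (if s = sy j then g j else 0)"
proof -
  have "apply_mat d (append_sym d sy) g (j * 256 + s) = (\<Sum>j'<d. if j' = j then (if s = sy j then g j else 0) else 0)"
    unfolding apply_mat_def
  proof (intro sum.cong refl)
    fix j' assume "j' \<in> {..<d}"
    then show "append_sym d sy $$ (j * 256 + s, j') * g j' = (if j' = j then (if s = sy j then g j else 0) else 0)"
      using append_sym_inj[of s "sy j'" j j'] append_sym_lt[of j d s] assms by (auto simp: append_sym_def)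
  qed
  then show ?thesis using assms by simp
qed

text \<open>Alice's symbol at the cell \<open>p l\<close> is \<open>sy (p l)\<close>. In a row with
  a true claim the amplitude of the cell therefore reaches the basis state that Bob expects; in a
  row with a false claim this basis state has amplitude 0.\<close>

lemma fingerprint_accept:
  fixes k :: nat
  assumes k: "k \<ge> 1" and p: "inj_on p {..<k}" "\<And>l. l < k \<Longrightarrow> p l < d"
    and v: "\<And>l. l < k \<Longrightarrow> v l < 256" and sy: "\<And>j. sy j < 256"
    and \<sigma>: "\<sigma> \<in> carrier_mat d d"
    and gram: "\<And>i j. i < d \<Longrightarrow> j < d \<Longrightarrow> \<sigma> $$ (i, j) = (\<Sum>g\<leftarrow>gs. g i * cnj (g j))"
  defines "T \<equiv> (\<lambda>l. p l * 256 + v l) ` {..<k}"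
  shows "T \<subseteq> {..<d * 256}" "T \<noteq> {}"
    "accept_prob (uproj (d * 256) T) (apply_channel (d * 256) [append_sym d sy] \<sigma>) =
      (\<Sum>g\<leftarrow>gs. (cmod (\<Sum>l\<in>{l \<in> {..<k}. sy (p l) = v l}. g (p l)))\<^sup>2 / real k)"
proof -
  show T: "T \<subseteq> {..<d * 256}" "T \<noteq> {}" using append_sym_lt[OF p(2) v] k by (auto simp: T_def lessThan_empty_iff)
  have inj: "inj_on (\<lambda>l. p l * 256 + v l) {..<k}"
    using p(1) v append_sym_inj by (auto simp: inj_on_def)
  then have cardT: "card T = k" by (simp add: T_def card_image)
  have K: "append_sym d sy \<in> carrier_mat (d * 256) d" by (simp add: append_sym_def)
  have sum: "(\<Sum>i\<in>T. apply_mat d (append_sym d sy) g i) = (\<Sum>l\<in>{l \<in> {..<k}. sy (p l) = v l}. g (p l))" for g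
  proof -
    have "(\<Sum>i\<in>T. apply_mat d (append_sym d sy) g i) = (\<Sum>l<k. if sy (p l) = v l then g (p l) else 0)"
      unfolding T_def sum.reindex[OF inj] o_def
      using p(2) v by (intro sum.cong refl) (auto simp: kmap_append_sym[OF sy])
    also have "\<dots> = (\<Sum>l\<in>{l \<in> {..<k}. sy (p l) = v l}. g (p l))"
      by (subst sum.inter_filter[symmetric]) auto
    finally show ?thesis .
  qed
  show "accept_prob (uproj (d * 256) T) (apply_channel (d * 256) [append_sym d sy] \<sigma>) =
      (\<Sum>g\<leftarrow>gs. (cmod (\<Sum>l\<in>{l \<in> {..<k}. sy (p l) = v l}. g (p l)))\<^sup>2 / real k)"
    using K by (subst accept_prob_gram[OF uproj_carrier _ \<sigma> gram]) (auto simp: quad_uproj[OF T(1)] sum cardT)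
qed

lemma fingerprint_complete:
  fixes k :: nat
  assumes k: "k \<ge> 1" and p: "inj_on p {..<k}" "\<And>l. l < k \<Longrightarrow> p l < d"
    and v: "\<And>l. l < k \<Longrightarrow> v l < 256" and sy: "\<And>j. sy j < 256"
    and eq: "\<And>l. l < k \<Longrightarrow> sy (p l) = v l"
  shows "density_op d (uproj d (p ` {..<k}))"
    "accept_prob (uproj (d * 256) ((\<lambda>l. p l * 256 + v l) ` {..<k}))
      (apply_channel (d * 256) [append_sym d sy] (uproj d (p ` {..<k}))) = 1"
proof -
  have "0 \<in> {..<k}" using k by simp
  then have ne: "p ` {..<k} \<noteq> {}" by blast
  show "density_op d (uproj d (p ` {..<k}))" using p ne by (intro density_uproj) auto
  define c where "c = (of_real (1 / sqrt (real k)) :: complex)"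
  define g where "g = (\<lambda>i. if i \<in> p ` {..<k} then c else 0)"
  have cc: "c * cnj c = of_real (1 / real k)" unfolding c_def complex_cnj_complex_of_real of_real_mult[symmetric] by simp
  have gr: "uproj d (p ` {..<k}) $$ (i, j) = (\<Sum>g\<leftarrow>[g]. g i * cnj (g j))" if "i < d" "j < d" for i j
    using that cc by (auto simp: uproj_def g_def card_image[OF p(1)])
  have "accept_prob (uproj (d * 256) ((\<lambda>l. p l * 256 + v l) ` {..<k}))
      (apply_channel (d * 256) [append_sym d sy] (uproj d (p ` {..<k}))) =
      (\<Sum>g\<leftarrow>[g]. (cmod (\<Sum>l\<in>{l \<in> {..<k}. sy (p l) = v l}. g (p l)))\<^sup>2 / real k)"
    by (rule fingerprint_accept(3)[OF k p v sy uproj_carrier gr])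
  also have "{l \<in> {..<k}. sy (p l) = v l} = {..<k}" using eq by auto
  also have "(\<Sum>g\<leftarrow>[g]. (cmod (\<Sum>l<k. g (p l)))\<^sup>2 / real k) = (cmod (of_nat k * c))\<^sup>2 / real k"
    by (simp add: g_def)
  also have "\<dots> = 1" using k by (simp add: c_def norm_mult power_mult_distrib power_divide power2_eq_square del: of_real_divide)
  finally show "accept_prob (uproj (d * 256) ((\<lambda>l. p l * 256 + v l) ` {..<k}))
      (apply_channel (d * 256) [append_sym d sy] (uproj d (p ` {..<k}))) = 1" .
qed

text \<open>Cauchy-Schwarz over the rows with true claims: \<open>|\<Sum> g (p l)|^2\<close> is at
  most their number times the squared norm of \<open>g\<close>. Summing over the Gram vectors covers
  every state, mixed ones included.\<close>

lemma fingerprint_sound: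
  fixes k :: nat
  assumes k: "k \<ge> 1" and p: "inj_on p {..<k}" "\<And>l. l < k \<Longrightarrow> p l < d"
    and v: "\<And>l. l < k \<Longrightarrow> v l < 256" and sy: "\<And>j. sy j < 256"
    and \<sigma>: "density_op d \<sigma>"
  shows "accept_prob (uproj (d * 256) ((\<lambda>l. p l * 256 + v l) ` {..<k}))
      (apply_channel (d * 256) [append_sym d sy] \<sigma>) \<le> real (card {l \<in> {..<k}. sy (p l) = v l}) / real k"
proof -
  have \<sigma>c: "\<sigma> \<in> carrier_mat d d"
    using \<sigma> by (auto simp: density_op_def positive_op_def)
  obtain gs where gram: "\<And>i j. i < d \<Longrightarrow> j < d \<Longrightarrow> \<sigma> $$ (i, j) = (\<Sum>g\<leftarrow>gs. g i * cnj (g j))"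
    and gsn: "(\<Sum>g\<leftarrow>gs. norm2 {..<d} g) = 1"
    using density_op_gram[OF \<sigma>] by blast
  define L where "L = {l \<in> {..<k}. sy (p l) = v l}"
  have "accept_prob (uproj (d * 256) ((\<lambda>l. p l * 256 + v l) ` {..<k}))
      (apply_channel (d * 256) [append_sym d sy] \<sigma>) = (\<Sum>g\<leftarrow>gs. (cmod (\<Sum>l\<in>L. g (p l)))\<^sup>2 / real k)"
    unfolding L_def by (rule fingerprint_accept(3)[OF k p v sy \<sigma>c gram])
  also have "\<dots> \<le> (\<Sum>g\<leftarrow>gs. (real (card L) / real k) * norm2 {..<d} g)"
  proof (rule sum_list_mono)
    fix g
    have "(cmod (\<Sum>l\<in>L. g (p l)))\<^sup>2 \<le> real (card L) * (\<Sum>l\<in>L. (cmod (g (p l)))\<^sup>2)"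
      by (rule cmod_sum_square_le_card)
    also have "(\<Sum>l\<in>L. (cmod (g (p l)))\<^sup>2) = (\<Sum>i\<in>p ` L. (cmod (g i))\<^sup>2)"
      using p(1) by (subst sum.reindex) (auto simp: L_def inj_on_def)
    also have "\<dots> \<le> norm2 {..<d} g"
      unfolding norm2_def using p(2) by (intro sum_mono2) (auto simp: L_def)
    finally have "(cmod (\<Sum>l\<in>L. g (p l)))\<^sup>2 \<le> real (card L) * norm2 {..<d} g" by (simp add: mult_left_mono)
    then show "(cmod (\<Sum>l\<in>L. g (p l)))\<^sup>2 / real k \<le> (real (card L) / real k) * norm2 {..<d} g"
      by (simp add: divide_right_mono)
  qed
  also have "\<dots> = real (card L) / real k" unfolding sum_list_const_mult gsn by simp
  finally show ?thesis by (simp add: L_def)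
qed

section \<open>The separation\<close>

definition queries :: "nat \<Rightarrow> ((nat \<Rightarrow> nat) \<times> (nat \<Rightarrow> nat)) set" where
  "queries N = columns N \<times> PiE {..<6 * N} (\<lambda>_. {..<256})"

definition fval :: "nat \<Rightarrow> (nat \<times> nat \<Rightarrow> nat) \<Rightarrow> (nat \<Rightarrow> nat) \<times> (nat \<Rightarrow> nat) \<Rightarrow> bool option" where
  "fval N x y = (let g = agreement (6 * N) (read_cells (6 * N) x (fst y)) (snd y)
    in if g = 6 * N then Some True else if 3 * g \<le> 6 * N then Some False else None)"

lemma agr_refl: "agreement k v v = k"
  by (simp add: agreement_def)

lemma rd_PiE: "x \<in> words N \<Longrightarrow> I \<in> columns N \<Longrightarrow> read_cells (6 * N) x I \<in> PiE {..<6 * N} (\<lambda>_. {..<256})"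
proof -
  assume x: "x \<in> words N" and I: "I \<in> columns N"
  have "x (l, I l) \<in> {..<256}" if "l < 6 * N" for l
    by (rule PiE_mem[OF x]) (use PiE_mem[OF I, of l] that in simp)
  then show ?thesis by (auto simp: read_cells_def)
qed

text \<open>Pigeonhole. It is applied to the column choices of each table and then to the tables,
  and so fixes a single message; this is the place that relies on Merlin's messages being finitely
  many classical strings.\<close>

lemma popular_value:
  assumes "finite A" "finite W" "W \<noteq> {}" "\<And>a. a \<in> A \<Longrightarrow> h a \<in> W"
  shows "\<exists>w\<in>W. card A \<le> card W * card {a \<in> A. h a = w}"
proof (rule ccontr)
  assume "\<not> ?thesis"
  then have lt: "card W * card {a \<in> A. h a = w} < card A" if "w \<in> W" for w using that by (auto simp: not_le)
  have "card A = card (\<Union>w\<in>W. {a \<in> A. h a = w})"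
    using assms(4) by (intro arg_cong[where f = card]) auto
  also have "\<dots> = (\<Sum>w\<in>W. card {a \<in> A. h a = w})"
    using assms(1,2) by (intro card_UN_disjoint) auto
  finally have "card W * card A = (\<Sum>w\<in>W. card W * card {a \<in> A. h a = w})"
    by (simp add: sum_distrib_left)
  also have "\<dots> < (\<Sum>w\<in>W. card A)"
    using assms(2,3) lt by (intro sum_strict_mono) auto
  finally show False by simp
qed

text \<open>The true claims about \<open>x\<close> at any column choice form a 1-input, so each pair
  of a table and a choice has a good message. The two applications of pigeonhole give the initial
  density \<open>1 / A\<close> and the bound on \<open>G x\<close> with
  \<open>A = 2 ^ a\<close>.\<close>

lemma ex_tree:
  fixes acc :: "'w \<Rightarrow> (nat \<times> nat \<Rightarrow> nat) \<Rightarrow> (nat \<Rightarrow> nat) \<times> (nat \<Rightarrow> nat) \<Rightarrow> real"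
  assumes W: "finite W" "card W = 2 ^ a" and a: "a + 2 \<le> N"
    and one: "\<And>x y. x \<in> words N \<Longrightarrow> y \<in> queries N \<Longrightarrow> fval N x y = Some True \<Longrightarrow> \<exists>w\<in>W. acc w x y \<ge> 2 / 3"
    and zero: "\<And>x y w. x \<in> words N \<Longrightarrow> y \<in> queries N \<Longrightarrow> fval N x y = Some False \<Longrightarrow> w \<in> W \<Longrightarrow> acc w x y \<le> 1 / 3"
  shows "\<exists>w\<in>W. shatter (\<lambda>x y. x \<in> words N \<and> y \<in> queries N \<and> acc w x y \<ge> 2 / 3)
    (\<lambda>x y. x \<in> words N \<and> y \<in> queries N \<and> acc w x y \<le> 1 / 3) ((N - 1) div 2) (words N)"
proof -
  let ?k = "6 * N"
  have Wne: "W \<noteq> {}" using W by auto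
  have finF: "finite (columns N)" and finX: "finite (words N)" by (auto intro: finite_PiE)
  have q: "(I, read_cells ?k x I) \<in> queries N" if "x \<in> words N" "I \<in> columns N" for x I
    using rd_PiE[OF that] that by (simp add: queries_def)
  have "\<exists>w. w \<in> W \<and> acc w x (I, read_cells ?k x I) \<ge> 2 / 3" if "x \<in> words N" "I \<in> columns N" for x I
    using one[OF that(1) q[OF that]] by (auto simp: fval_def agr_refl)
  then obtain h where h: "\<And>x I. x \<in> words N \<Longrightarrow> I \<in> columns N \<Longrightarrow> h x I \<in> W \<and> acc (h x I) x (I, read_cells ?k x I) \<ge> 2 / 3"
    by metis
  have "\<exists>w\<in>W. card (columns N) \<le> card W * card {I \<in> columns N. h x I = w}" if "x \<in> words N" for x
    using h[OF that] by (intro popular_value finF W(1) Wne) auto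
  then have "\<forall>x\<in>words N. \<exists>w. w \<in> W \<and> card (columns N) \<le> card W * card {I \<in> columns N. h x I = w}"
    by blast
  from bchoice[OF this] obtain wx where
    wx: "\<And>x. x \<in> words N \<Longrightarrow> wx x \<in> W \<and> card (columns N) \<le> card W * card {I \<in> columns N. h x I = wx x}"
    by blast
  obtain w where w: "w \<in> W" "card (words N) \<le> card W * card {x \<in> words N. wx x = w}"
    using popular_value[OF finX W(1) Wne, of wx] wx by blast
  define X where "X = {x \<in> words N. wx x = w}"
  define G where "G = (\<lambda>x. {I \<in> columns N. acc w x (I, read_cells ?k x I) \<ge> 2 / 3})"
  define A where "A = (2 ^ a :: real)"
  define B where "B = (2 ^ N :: real)"
  \<comment> \<open>As \<open>4 * A * B \<le> B\<^sup>2\<close> and the initial density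
    \<open>1 / A\<close> is at least \<open>1 / B\<close>, the potential suffices for depth
    \<open>d\<close> as soon as \<open>2 * d + 1 \<le> N\<close>.\<close>
  define d where "d = (N - 1) div 2"
  let ?acc = "\<lambda>x y. x \<in> words N \<and> y \<in> queries N \<and> acc w x y \<ge> 2 / 3"
  let ?rej = "\<lambda>x y. x \<in> words N \<and> y \<in> queries N \<and> acc w x y \<le> 1 / 3"
  have A: "1 \<le> A" "4 * A \<le> B"
  proof -
    have "4 * A = 2 ^ (a + 2)" by (simp add: A_def power_add)
    also have "\<dots> \<le> B" unfolding B_def using a by (intro power_increasing) auto
    finally show "4 * A \<le> B" .
  qed (simp add: A_def)
  have "shatter ?acc ?rej d X"
  proof (rule build_tree[where N = N and A = A and G = G and X = X and U = "{}" and n = N and \<delta> = "1 / A"])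
    show "1 \<le> A" "4 * A \<le> 2 ^ N" using A by (simp_all add: B_def)
    show "G x \<subseteq> columns N" for x by (auto simp: G_def)
    show "?acc x (I, read_cells ?k x I)" if "x \<in> words N" "I \<in> G x" for x I
      using that q[of x I] by (simp add: G_def)
    show "?rej x (I, read_cells ?k x' I)"
      if "x \<in> words N" "x' \<in> words N" "I \<in> columns N" "3 * agreement ?k (read_cells ?k x I) (read_cells ?k x' I) \<le> ?k" for x x' I
    proof -
      \<comment> \<open>The bound \<open>a + 2 \<le> N\<close> makes \<open>N\<close> positive, so
        agreement in at most a third of the rows is not full agreement and the first case of
        \<open>fval\<close> does not apply.\<close>
      have "fval N x (I, read_cells ?k x' I) = Some False"
        using that(4) a by (auto simp: fval_def Let_def)
      then show ?thesis using zero[OF that(1) q[OF that(2,3)]] that q[OF that(2,3)] w(1) by auto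
    qed
    show "X \<subseteq> words N" by (auto simp: X_def)
    show "real (card (columns N)) \<le> A * real (card (G x))" if "x \<in> X" for x
    proof -
      have x: "x \<in> words N" "wx x = w" using that by (auto simp: X_def)
      have "I \<in> G x" if "I \<in> columns N" "h x I = wx x" for I
        using h[OF x(1) that(1)] x(2) that by (simp add: G_def)
      then have "card {I \<in> columns N. h x I = wx x} \<le> card (G x)"
        using finF by (intro card_mono) (auto simp: G_def)
      then have "card W * card {I \<in> columns N. h x I = wx x} \<le> card W * card (G x)" by simp
      then have "card (columns N) \<le> 2 ^ a * card (G x)" using wx[OF x(1)] unfolding W(2) by linarith
      then have "real (card (columns N)) \<le> real (2 ^ a * card (G x))" by (rule of_nat_mono)
      then show ?thesis by (simp add: A_def)
    qed
    show "1 / A * 256 ^ card ({..<?k} \<times> {..<256 * N} - {}) \<le> real (card X)"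
    proof -
      have "real (card (words N)) \<le> real (2 ^ a * card X)" using w(2) W(2) by (intro of_nat_mono) (simp add: X_def)
      moreover have "real (card (words N)) = 256 ^ card ({..<?k} \<times> {..<256 * N})" by (simp add: card_PiE)
      ultimately show ?thesis using A(1) by (simp add: A_def field_simps)
    qed
    show "(4 * A * 2 ^ N) ^ d \<le> 1 / A * (2 ^ N) ^ N"
    proof -
      have B1: "1 \<le> B" by (simp add: B_def)
      have "(4 * A * B) ^ d * A \<le> (B * B) ^ d * B"
        using A B1 by (intro mult_mono power_mono) auto
      also have "\<dots> = B ^ (2 * d + 1)" by (simp add: power_mult power2_eq_square)
      also have "\<dots> \<le> B ^ N" using B1 a by (intro power_increasing) (auto simp: d_def)
      finally have "(4 * A * B) ^ d \<le> 1 / A * B ^ N" using A(1) by (simp add: field_simps)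
      then show ?thesis by (simp add: B_def)
    qed
  qed (use A in auto)
  then have "shatter ?acc ?rej d (words N)" by (rule shatter_superset) (auto simp: X_def)
  then show ?thesis using w(1) by (auto simp: d_def)
qed

text \<open>Preimages under the decoders turn the protocol into one for tables and queries. With
  \<open>D = 2 ^ b\<close> the bound on the tree reads
  \<open>2 ^ d / 2 \<le> 2 ^ (4 * b * s)\<close>, and the exponents are compared.\<close>

lemma qcma_lower:
  assumes decx: "decx ` bits n = words N" and decy: "decy ` bits m = queries N"
    and f: "\<And>x y. x \<in> bits n \<Longrightarrow> y \<in> bits m \<Longrightarrow> f x y = fval N (decx x) (decy y)"
    and prot: "QCMA_ent_protocol n m f a b coin dA dB \<rho> alice bob"
    and a: "a + 2 \<le> N" and d: "d = (N - 1) div 2" "d \<ge> 1"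
    and s: "(15 / 16) ^ s \<le> 1 / (16 * (real d)\<^sup>2)"
  shows "d \<le> 4 * b * s + 1"
proof -
  define ex where "ex = inv_into (bits n) decx"
  define ey where "ey = inv_into (bits m) decy"
  have ex: "ex x \<in> bits n" "decx (ex x) = x" if "x \<in> words N" for x
    using that decx unfolding ex_def by (auto intro: inv_into_into f_inv_into_f)
  have ey: "ey y \<in> bits m" "decy (ey y) = y" if "y \<in> queries N" for y
    using that decy unfolding ey_def by (auto intro: inv_into_into f_inv_into_f)
  define acc where "acc = (\<lambda>w x y. measure_pmf.expectation coin
          (\<lambda>r. accept_prob (bob r (ey y)) (apply_channel_left (2 ^ b) dB (alice r (ex x) w) \<rho>)))"
  have dens: "density_op (dA * dB) \<rho>"
    and ch: "\<And>r x w. x \<in> bits n \<Longrightarrow> w \<in> bits a \<Longrightarrow> channel dA (2 ^ b) (alice r x w)"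
    and ef: "\<And>r y. y \<in> bits m \<Longrightarrow> effect (2 ^ b * dB) (bob r y)"
    and cor: "MA_correct n m f (bits a)
       (\<lambda>w x y. measure_pmf.expectation coin
          (\<lambda>r. accept_prob (bob r y) (apply_channel_left (2 ^ b) dB (alice r x w) \<rho>)))"
    using prot unfolding QCMA_ent_protocol_def by auto
  have fx: "f (ex x) (ey y) = fval N x y" if "x \<in> words N" "y \<in> queries N" for x y
    using f[OF ex(1)[OF that(1)] ey(1)[OF that(2)]] ex(2)[OF that(1)] ey(2)[OF that(2)] by simp
  have "\<exists>w\<in>bits a. shatter (\<lambda>x y. x \<in> words N \<and> y \<in> queries N \<and> acc w x y \<ge> 2 / 3)
    (\<lambda>x y. x \<in> words N \<and> y \<in> queries N \<and> acc w x y \<le> 1 / 3) ((N - 1) div 2) (words N)"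
  proof (rule ex_tree[OF finite_bits card_bits a])
    fix x y assume xy: "x \<in> words N" "y \<in> queries N"
    note c = cor[unfolded MA_correct_def, rule_format, OF ex(1)[OF xy(1)] ey(1)[OF xy(2)], unfolded fx[OF xy]]
    show "\<exists>w\<in>bits a. acc w x y \<ge> 2 / 3" if "fval N x y = Some True"
      using c that by (simp add: acc_def)
    show "acc w x y \<le> 1 / 3" if "fval N x y = Some False" "w \<in> bits a" for w
      using c that unfolding acc_def by fastforce
  qed
  then obtain w where w: "w \<in> bits a"
    and sh: "shatter (\<lambda>x y. x \<in> words N \<and> y \<in> queries N \<and> acc w x y \<ge> 2 / 3)
      (\<lambda>x y. x \<in> words N \<and> y \<in> queries N \<and> acc w x y \<le> 1 / 3) d (words N)"
    unfolding d by blast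
  have "2 ^ d / 2 \<le> (real (2 ^ b) * real (2 ^ b)) ^ (2 * s)"
    by (rule qcma_shatter_bound[where alice = "\<lambda>r x. alice r (ex x) w" and bob = "\<lambda>r y. bob r (ey y)"
        and U = "words N" and Y = "queries N" and acc = "acc w" and coin = coin, OF dens _ _ _ sh d(2) s])
      (use ch ef ex ey w in \<open>auto simp: acc_def\<close>)
  also have "\<dots> = (2 :: real) ^ (4 * b * s)"
    by (simp flip: power_add power_mult)
  finally have "(2 :: real) ^ d \<le> 2 ^ (4 * b * s + 1)" by simp
  then show ?thesis by (rule power_le_imp_le_exp[rotated]) simp
qed

text \<open>A short message of Merlin leaves \<open>N \<le> 8 * b * s + 4\<close> by the tree, and a
  long one has \<open>a\<close> close to \<open>N\<close> or more, so either part of the cost alone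
  reaches the bound. For \<open>N \<le> 2\<close> the left-hand side is negative.\<close>

lemma qcma_cost_lower:
  assumes decx: "decx ` bits n = words N" and decy: "decy ` bits m = queries N"
    and f: "\<And>x y. x \<in> bits n \<Longrightarrow> y \<in> bits m \<Longrightarrow> f x y = fval N (decx x) (decy y)"
    and s: "s \<ge> 1" "16 * (real ((N - 1) div 2))\<^sup>2 * (15 / 16) ^ s \<le> 1"
  shows "(real N - 4) / (8 * real s) \<le> real (QCMA_ent_cost n m f)"
proof -
  define d where "d = (N - 1) div 2"
  have "\<exists>c a b coin dA dB \<rho> alice bob. c = a + b \<and> QCMA_ent_protocol n m f a b coin dA dB \<rho> alice bob"
    using ex_QCMA_ent_protocol[of n m f] by blast
  then have "\<exists>a b coin dA dB \<rho> alice bob. QCMA_ent_cost n m f = a + b \<and> QCMA_ent_protocol n m f a b coin dA dB \<rho> alice bob"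
    unfolding QCMA_ent_cost_def by (rule LeastI_ex)
  then obtain a b coin dA dB \<rho> alice bob where c: "QCMA_ent_cost n m f = a + b"
    and prot: "QCMA_ent_protocol n m f a b coin dA dB \<rho> alice bob" by blast
  show ?thesis
  proof (cases "a + 2 \<le> N \<and> d \<ge> 1")
    case True
    have "(15 / 16) ^ s \<le> 1 / (16 * (real d)\<^sup>2)" using s(2) True by (simp add: d_def field_simps)
    then have "d \<le> 4 * b * s + 1"
      using qcma_lower[OF decx decy f prot _ d_def] True by auto
    moreover have "N \<le> 2 * d + 2" by (simp add: d_def)
    ultimately have "N \<le> 8 * b * s + 4" by linarith
    then have "real N \<le> real (8 * b * s + 4)" by (rule of_nat_mono)
    then have "(real N - 4) / (8 * real s) \<le> real b" using s(1) by (simp add: field_simps)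
    then show ?thesis by (simp add: c)
  next
    case False
    then have "real N - 4 \<le> real a"
    proof (cases "a + 2 \<le> N")
      case True
      then have "N \<le> 2" using False by (simp add: d_def)
      then show ?thesis by simp
    qed simp
    moreover have "real a \<le> real a * (8 * real s)" using s(1) by (intro mult_le_cancel_left1[THEN iffD2]) auto
    ultimately have "(real N - 4) / (8 * real s) \<le> real a" using s(1) by (simp add: divide_le_eq)
    then show ?thesis by (simp add: c)
  qed
qed

text \<open>The cells are numbered row by row and padded to \<open>2 ^ A\<close> basis states.
  Merlin sends \<open>A\<close> qubits, and Alice's symbol takes 8 more.\<close>

lemma qma_cost_upper:
  assumes decx: "decx ` bits n = words N" and decy: "decy ` bits m = queries N"
    and f: "\<And>x y. x \<in> bits n \<Longrightarrow> y \<in> bits m \<Longrightarrow> f x y = fval N (decx x) (decy y)"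
    and N: "N \<ge> 1" and A: "6 * N * (256 * N) \<le> 2 ^ A"
  shows "QMA_cost n m f \<le> 2 * A + 8"
proof -
  define k where "k = 6 * N"
  define C where "C = 256 * N"
  define d where "d = (2 ^ A :: nat)"
  have k: "k \<ge> 1" and C: "C > 0" using N by (auto simp: k_def C_def)
  have d8: "2 ^ (A + 8) = d * 256" by (simp add: d_def power_add)
  \<comment> \<open>The padding positions carry the symbol 0. Bob never expects such a position, but
    Alice's channel has to be defined on all \<open>2 ^ A\<close> basis states.\<close>
  define sy where "sy = (\<lambda>x j. if j < k * C then decx x (j div C, j mod C) else 0)"
  define p where "p = (\<lambda>y l. l * C + fst (decy y) l)"
  define vv where "vv = (\<lambda>y. snd (decy y))"
  define alice where "alice = (\<lambda>(r :: nat) x. [append_sym d (sy x)])"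
  define bob where "bob = (\<lambda>(r :: nat) y. uproj (d * 256) ((\<lambda>l. p y l * 256 + vv y l) ` {..<k}))"
  have sy: "sy x j < 256" if "x \<in> bits n" for x j
  proof (cases "j < k * C")
    case True
    have x: "decx x \<in> words N" using that decx by blast
    have "j div C < k" "j mod C < C" using True C by (auto simp: less_mult_imp_div_less)
    then have "decx x (j div C, j mod C) \<in> {..<256}"
      by (intro PiE_mem[OF x]) (simp add: k_def C_def)
    then show ?thesis using True by (simp add: sy_def)
  qed (simp add: sy_def)
  have I: "fst (decy y) l < C" "vv y l < 256" if "y \<in> bits m" "l < k" for y l
  proof -
    have "decy y \<in> queries N" using that decy by blast
    then have "fst (decy y) \<in> columns N" "snd (decy y) \<in> PiE {..<6 * N} (\<lambda>_. {..<256})"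
      by (auto simp: queries_def mem_Times_iff)
    then show "fst (decy y) l < C" "vv y l < 256"
      using that(2) PiE_mem[of _ "{..<6 * N}" _ l] by (force simp: k_def C_def vv_def)+
  qed
  have dm: "p y l div C = l" "p y l mod C = fst (decy y) l" if "y \<in> bits m" "l < k" for y l
    using I[OF that] C by (simp_all add: p_def)
  have plt: "p y l < k * C" if "y \<in> bits m" "l < k" for y l
  proof -
    have "p y l < Suc l * C" using I[OF that] by (simp add: p_def)
    also have "\<dots> \<le> k * C" using that by (intro mult_le_mono) auto
    finally show ?thesis .
  qed
  have kd: "k * C \<le> d" using A by (simp add: k_def C_def d_def)
  have p: "inj_on (p y) {..<k}" if "y \<in> bits m" for y
    by (rule inj_onI) (metis dm(1)[OF that] lessThan_iff)
  have pd: "p y l < d" if "y \<in> bits m" "l < k" for y l using plt[OF that] kd by simp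
  have syp: "sy x (p y l) = read_cells k (decx x) (fst (decy y)) l" if "y \<in> bits m" "l < k" for x y l
    using plt[OF that] dm[OF that] that by (simp add: sy_def read_cells_def)
  have ag: "{l \<in> {..<k}. sy x (p y l) = vv y l} = {l \<in> {..<k}. read_cells k (decx x) (fst (decy y)) l = snd (decy y) l}"
    if "y \<in> bits m" for x y using syp[OF that] by (auto simp: vv_def)
  have ex: "measure_pmf.expectation (return_pmf 0) (\<lambda>r. accept_prob (bob r y) (apply_channel (2 ^ (A + 8)) (alice r x) \<sigma>))
      = accept_prob (bob 0 y) (apply_channel (d * 256) [append_sym d (sy x)] \<sigma>)" for x y \<sigma>
    by (simp add: alice_def d8)
  have "QMA_protocol n m f A (A + 8) (return_pmf 0) alice bob"
    unfolding QMA_protocol_def MA_correct_def ex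
  proof (intro conjI allI ballI impI)
    show "channel (2 ^ A) (2 ^ (A + 8)) (alice r x)" if "x \<in> bits n" for r x
      unfolding alice_def d8 d_def[symmetric] by (rule channel_append_sym[OF sy[OF that]])
    fix y assume y: "y \<in> bits m"
    have "(\<lambda>l. p y l * 256 + vv y l) ` {..<k} \<subseteq> {..<d * 256}"
      using append_sym_lt[OF pd[OF y] I(2)[OF y]] by auto
    moreover have "0 \<in> {..<k}" using k by simp
    ultimately show "effect (2 ^ (A + 8)) (bob r y)" for r
      unfolding bob_def d8 by (intro effect_uproj) blast+
  next
    fix x y assume x: "x \<in> bits n" and y: "y \<in> bits m" and t: "f x y = Some True"
    have "agreement k (read_cells k (decx x) (fst (decy y))) (snd (decy y)) = k"
      using t f[OF x y] by (auto simp: fval_def Let_def k_def split: if_splits)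
    then have "{l \<in> {..<k}. sy x (p y l) = vv y l} = {..<k}"
      unfolding agreement_def ag[OF y] by (intro card_subset_eq) auto
    then have eq: "sy x (p y l) = vv y l" if "l < k" for l using that by blast
    note fc = fingerprint_complete[where p = "p y" and v = "vv y" and sy = "sy x" and d = d, OF k p[OF y] pd[OF y] I(2)[OF y] sy[OF x] eq]
    show "\<exists>\<sigma>\<in>{\<sigma>. density_op (2 ^ A) \<sigma>}. 2 / 3 \<le> accept_prob (bob 0 y) (apply_channel (d * 256) [append_sym d (sy x)] \<sigma>)"
      using fc by (intro bexI[of _ "uproj d (p y ` {..<k})"]) (auto simp: bob_def d_def)
  next
    fix x y \<sigma> assume x: "x \<in> bits n" and y: "y \<in> bits m" and t: "f x y = Some False"
      and \<sigma>: "\<sigma> \<in> {\<sigma>. density_op (2 ^ A) \<sigma>}"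
    have le: "3 * agreement k (read_cells k (decx x) (fst (decy y))) (snd (decy y)) \<le> k"
      using t f[OF x y] by (auto simp: fval_def Let_def k_def split: if_splits)
    have "accept_prob (bob 0 y) (apply_channel (d * 256) [append_sym d (sy x)] \<sigma>)
        \<le> real (card {l \<in> {..<k}. sy x (p y l) = vv y l}) / real k"
      unfolding bob_def using \<sigma> by (intro fingerprint_sound[where p = "p y" and v = "vv y" and sy = "sy x" and d = d, OF k p[OF y] pd[OF y] I(2)[OF y] sy[OF x]]) (auto simp: d_def)
    also have "\<dots> \<le> 1 / 3"
      using le k unfolding ag[OF y] agreement_def by (simp add: divide_le_eq)
    finally show "2 / 3 \<le> 1 - accept_prob (bob 0 y) (apply_channel (d * 256) [append_sym d (sy x)] \<sigma>)" by simp
  qed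
  moreover have "2 * A + 8 = A + (A + 8)" by simp
  ultimately show ?thesis
    unfolding QMA_cost_def by (intro Least_le) blast
qed

text \<open>A surjection from strings in place of an injective encoding: every string then has a
  meaning, so the function has no invalid inputs, and the lower bound uses any right
  inverse.\<close>

lemma ex_decoder:
  assumes "finite A" "A \<noteq> {}" "card A \<le> 2 ^ n"
  shows "\<exists>dec. dec ` bits n = A"
proof -
  obtain e where e: "e ` A \<subseteq> bits n" "inj_on e A"
    using card_le_inj[of A "bits n"] assms finite_bits card_bits by metis
  obtain a0 where a0: "a0 \<in> A" using assms(2) by blast
  define dec where "dec = (\<lambda>z. if z \<in> e ` A then inv_into A e z else a0)"
  have "dec (e a) = a" if "a \<in> A" for a using that e(2) by (simp add: dec_def)
  moreover have "dec z \<in> A" for z using a0 by (auto simp: dec_def intro: inv_into_into)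
  ultimately have "dec ` bits n = A" using e(1) by (force simp: image_iff)
  then show ?thesis by blast
qed

text \<open>A table has \<open>6 * N * (256 * N)\<close> cells of 8 bits each.\<close>

definition side :: "nat \<Rightarrow> nat" where
  "side n = nat \<lfloor>sqrt (real n / 12288)\<rfloor>"

lemma side_bounds:
  "real (side n) \<le> sqrt (real n / 12288)" "sqrt (real n / 12288) - 1 \<le> real (side n)" "12288 * (side n)\<^sup>2 \<le> n"
proof -
  show a: "real (side n) \<le> sqrt (real n / 12288)" by (simp add: side_def)
  show "sqrt (real n / 12288) - 1 \<le> real (side n)" by (simp add: side_def)
  have "(real (side n))\<^sup>2 \<le> (sqrt (real n / 12288))\<^sup>2" using a by (intro power_mono) auto
  then have "real (12288 * (side n)\<^sup>2) \<le> real n" by simp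
  then show "12288 * (side n)\<^sup>2 \<le> n" by (simp only: of_nat_le_iff)
qed

lemma ex_family:
  "\<exists>m f decx decy. decx ` bits n = words (side n) \<and> decy ` bits m = queries (side n) \<and>
    (\<forall>x y. f x y = fval (side n) (decx x) (decy y))"
proof -
  define N where "N = side n"
  have "card (words N) = 256 ^ (6 * N * (256 * N))" by (simp add: card_PiE)
  also have "\<dots> = (2 ^ 8) ^ (6 * N * (256 * N))" by simp
  also have "\<dots> = 2 ^ (12288 * N\<^sup>2)" unfolding power_mult[symmetric] by (simp add: power2_eq_square)
  also have "\<dots> \<le> 2 ^ n" unfolding N_def by (intro power_increasing side_bounds) auto
  finally have cw: "card (words N) \<le> 2 ^ n" .
  have "(0 :: nat) \<in> {..<256}" by simp
  then have ne256: "{..<256 :: nat} \<noteq> {}" by blast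
  have fw: "finite (words N)" by (auto intro: finite_PiE)
  have nw: "words N \<noteq> {}" using ne256 by (simp only: PiE_eq_empty_iff) blast
  obtain decx where x: "decx ` bits n = words N"
    using ex_decoder[OF fw nw cw] by blast
  have fin: "finite (queries N)" unfolding queries_def by (auto intro: finite_PiE)
  have "{..<256 * N} \<noteq> {} \<or> {..<6 * N} = {}" by (cases "N = 0") (auto simp: lessThan_empty_iff)
  then have "columns N \<noteq> {}" "PiE {..<6 * N} (\<lambda>_. {..<256 :: nat}) \<noteq> {}"
    using ne256 by (simp_all only: PiE_eq_empty_iff) blast+
  then have ne: "queries N \<noteq> {}" by (simp add: queries_def)
  \<comment> \<open>Bob's input has as many bits as there are queries. This length is free, since
    both bounds are in terms of Alice's input length \<open>n\<close>.\<close>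
  have "card (queries N) \<le> 2 ^ card (queries N)" by (simp add: less_imp_le)
  then obtain decy where y: "decy ` bits (card (queries N)) = queries N"
    using ex_decoder[OF fin ne] by blast
  show ?thesis
    using x y unfolding N_def
    by (intro exI[of _ "card (queries (side n))"] exI[of _ "\<lambda>x y. fval (side n) (decx x) (decy y)"] exI[of _ decx] exI[of _ decy]) auto
qed

theorem mainTheorem2:
  shows "\<exists>(m :: nat \<Rightarrow> nat) (f :: nat \<Rightarrow> partial_bf).
    (\<lambda>n. real (QMA_cost n (m n) (f n))) \<in> O(\<lambda>n. log 2 (real n)) \<and>
    (\<lambda>n. real (QCMA_ent_cost n (m n) (f n))) \<in> \<Omega>(\<lambda>n. sqrt (real n) / log 2 (real n))"
proof -
  obtain m :: "nat \<Rightarrow> nat" and f :: "nat \<Rightarrow> partial_bf" and decx decy where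
    decx: "\<And>n. decx n ` bits n = words (side n)" and decy: "\<And>n. decy n ` bits (m n) = queries (side n)"
    and f: "\<And>n x y. f n x y = fval (side n) (decx n x) (decy n y)"
    using ex_family by metis
  have upper: "real (QMA_cost n (m n) (f n)) \<le> 2 * (log 2 (real n) + 1) + 8" if n: "n \<ge> 12288" for n
  proof -
    define A where "A = nat \<lceil>log 2 (real n)\<rceil>"
    have lg: "log 2 (real n) \<ge> 0" using n by simp
    have "real n = 2 powr log 2 (real n)" using n by simp
    also have "\<dots> \<le> 2 powr real A" unfolding A_def by (intro powr_mono) linarith+
    also have "\<dots> = real (2 ^ A)" by (simp add: powr_realpow)
    finally have nA: "n \<le> 2 ^ A" by (simp only: of_nat_le_iff)
    have "side n \<ge> 1"
    proof -
      have "1 \<le> sqrt (real n / 12288)" using n by simp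
      then show ?thesis unfolding side_def by linarith
    qed
    moreover have "6 * side n * (256 * side n) \<le> 2 ^ A"
    proof -
      have "6 * side n * (256 * side n) \<le> 12288 * (side n)\<^sup>2" by (simp add: power2_eq_square)
      then show ?thesis using side_bounds(3)[of n] nA by linarith
    qed
    ultimately have "QMA_cost n (m n) (f n) \<le> 2 * A + 8"
      using f by (intro qma_cost_upper[OF decx decy]) auto
    then have "real (QMA_cost n (m n) (f n)) \<le> real (2 * A + 8)" by (rule of_nat_mono)
    moreover have "real A \<le> log 2 (real n) + 1" unfolding A_def using lg by linarith
    ultimately show ?thesis by simp
  qed
  \<comment> \<open>Rounding down in \<open>side\<close> turns \<open>N - 4\<close> into
    \<open>sqrt (n / 12288) - 5\<close>; from \<open>12288 * 25\<close> on this is nonnegative, so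
    the two fractions can be compared.\<close>
  have lower: "(sqrt (real n / 12288) - 5) / (8 * (16 * ln (real n) + 1)) \<le> real (QCMA_ent_cost n (m n) (f n))"
    if n: "n \<ge> 12288 * 25" for n
  proof -
    \<comment> \<open>From \<open>15 / 16 \<le> exp (- (1 / 16))\<close> the amplified error is at
      most \<open>1 / n\<close>, and \<open>16 * d^2 \<le> n\<close> for the depth \<open>d\<close>
      of the tree.\<close>
    define s where "s = nat \<lceil>16 * ln (real n)\<rceil>"
    have ln1: "ln (real n) \<ge> 1"
    proof -
      have "exp 1 \<le> real n" using exp_le n by linarith
      then show ?thesis using n by (simp add: ln_ge_iff)
    qed
    have s1: "s \<ge> 1" and s16: "16 * ln (real n) \<le> real s" and s17: "real s \<le> 16 * ln (real n) + 1"
      using ln1 unfolding s_def by linarith+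
    have "(15 / 16 :: real) ^ s \<le> exp (- (1 / 16)) ^ s"
      using exp_ge_add_one_self[of "- (1 / 16)"] by (intro power_mono) auto
    also have "\<dots> = exp (- (real s / 16))" by (simp flip: exp_of_nat_mult)
    also have "\<dots> \<le> exp (- ln (real n))" using s16 by simp
    also have "\<dots> = 1 / real n" using n by (simp add: exp_minus field_simps)
    finally have q: "(15 / 16 :: real) ^ s \<le> 1 / real n" .
    have "16 * (real ((side n - 1) div 2))\<^sup>2 \<le> real n"
    proof -
      have "(side n - 1) div 2 \<le> side n" by simp
      then have "((side n - 1) div 2)\<^sup>2 \<le> (side n)\<^sup>2" by (intro power_mono) auto
      then have "16 * ((side n - 1) div 2)\<^sup>2 \<le> n" using side_bounds(3)[of n] by linarith
      then have "real (16 * ((side n - 1) div 2)\<^sup>2) \<le> real n" by (rule of_nat_mono)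
      then show ?thesis by simp
    qed
    then have "16 * (real ((side n - 1) div 2))\<^sup>2 * (15 / 16) ^ s \<le> real n * (1 / real n)"
      using q by (intro mult_mono) auto
    then have "16 * (real ((side n - 1) div 2))\<^sup>2 * (15 / 16) ^ s \<le> 1" using n by simp
    then have "(real (side n) - 4) / (8 * real s) \<le> real (QCMA_ent_cost n (m n) (f n))"
      using f s1 by (intro qcma_cost_lower[OF decx decy]) auto
    moreover have "(sqrt (real n / 12288) - 5) / (8 * (16 * ln (real n) + 1)) \<le> (real (side n) - 4) / (8 * real s)"
    proof (rule frac_le)
      have "5 \<le> sqrt (real n / 12288)"
        by (rule real_le_rsqrt) (use n in simp)
      then show "0 \<le> real (side n) - 4" using side_bounds(2)[of n] by linarith
      show "sqrt (real n / 12288) - 5 \<le> real (side n) - 4" using side_bounds(2)[of n] by linarith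
    qed (use s1 s17 in auto)
    ultimately show ?thesis by linarith
  qed
  have "(\<lambda>n. real (QMA_cost n (m n) (f n))) \<in> O(\<lambda>n. 2 * (log 2 (real n) + 1) + 8)"
    using upper by (intro landau_o.big_mono eventually_sequentiallyI[of 12288]) force
  also have "(\<lambda>n::nat. 2 * (log 2 (real n) + 1) + 8) \<in> O(\<lambda>n. log 2 (real n))"
    by real_asymp
  finally have U: "(\<lambda>n. real (QMA_cost n (m n) (f n))) \<in> O(\<lambda>n. log 2 (real n))" .
  have "(\<lambda>n::nat. (sqrt (real n / 12288) - 5) / (8 * (16 * ln (real n) + 1))) \<in> \<Omega>(\<lambda>n. sqrt (real n) / log 2 (real n))"
    by real_asymp
  moreover have "(\<lambda>n. real (QCMA_ent_cost n (m n) (f n))) \<in> \<Omega>(\<lambda>n. (sqrt (real n / 12288) - 5) / (8 * (16 * ln (real n) + 1)))"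
  proof (rule landau_omega.big_mono)
    have "eventually (\<lambda>n::nat. (sqrt (real n / 12288) - 5) / (8 * (16 * ln (real n) + 1)) \<ge> 0) sequentially"
      by real_asymp
    then show "eventually (\<lambda>n. norm ((sqrt (real n / 12288) - 5) / (8 * (16 * ln (real n) + 1))) \<le> norm (real (QCMA_ent_cost n (m n) (f n)))) sequentially"
      using eventually_ge_at_top[of "12288 * 25"] by eventually_elim (use lower in \<open>simp only: real_norm_def abs_of_nonneg of_nat_0_le_iff\<close>)
  qed
  ultimately have L: "(\<lambda>n. real (QCMA_ent_cost n (m n) (f n))) \<in> \<Omega>(\<lambda>n. sqrt (real n) / log 2 (real n))"
    using landau_omega.big_trans by blast
  show ?thesis using U L by blast
qed

end
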